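(* Let $0\le k\le n$, and let $w^{\odot}\in S_{n,k}^{\odot}$ have associated positroid $\mathcal{M}$. The following are equivalent: (1) The positroid variety $\Pi_{\mathcal{M}}$ is smooth. (2) For every $J\in\mathcal{M}$, $\#\{I\in\mathcal{M}: |I\cap J|=k-1\}=k(n-k)-\#Alignments(w^{\odot})$. (3) The graph $J(\mathcal{M})$ is regular, and each vertex has degree $k(n-k)-\#Alignments(w^{\odot})$. (4) The decorated permutation $w^{\odot}$ has no crossed alignments. (5) The chord diagram of $w^{\odot}$ is a union of spirographs on a noncrossing partition of $[n]$.
   Context: $[n]=\{1,\dots,n\}$, $\binom{[n]}{k}$ the set of $k$-subsets. $Gr(k,n)$ is the Grassmannian of $k$-dimensional subspaces of $\mathbb{C}^n$; $\Delta_I$ denotes the Plücker coordinate (maximal minor in columns $I$). A decorated permutation on $n$ elements is $w\in S_n$ together with a label "clockwise" or "counterclockwise" on each fixed point. An element $i$ is an anti-exceedance if $i<w^{-1}(i)$ or $i$ is a clockwise fixed point; $S_{n,k}^{\odot}$ is the set of decorated permutations on $n$ elements with exactly $k$ anti-exceedances. For $r\in[n]$ let $<_r$ be the order $r<_r r+1<_r\cdots<_r n<_r 1<_r\cdots<_r r-1$, and $I_r(w)=\{i: i<_r w^{-1}(i)\text{ or } i \text{ a clockwise fixed point}\}$. For $I=\{i_1<_r\dots<_r i_k\}$, $J=\{j_1<_r\dots<_r j_k\}$, $I\preceq_r J$ means $i_h\le_r j_h$ for all $h$. The positroid is $\mathcal{M}=\{I\in\binom{[n]}{k}: I_r(w)\preceq_r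 I\ \forall r\}$, and the positroid variety $\Pi_{\mathcal{M}}$ is the subvariety of $Gr(k,n)$ whose vanishing ideal is generated by $\{\Delta_I: I\notin\mathcal{M}\}$. The chord diagram $D(w^{\odot})$: place $1,\dots,n$ clockwise on a circle and for each $i$ draw a directed arc from $i$ to $w(i)$ inside the circle with a minimal number of crossings between distinct arcs; arcs at fixed points are small loops drawn clockwise or counterclockwise according to the decoration. A pair of arcs $(i\mapsto w(i), j\mapsto w(j))$ is an alignment if they can be drawn as distinct noncrossing arcs oriented in the same direction, a misalignment if they can be drawn as distinct noncrossing arcs oriented in opposite directions, and a crossing if they must cross when both are drawn inside the circle. $Alignments(w^{\odot})$ is the set of alignments. An alignment $(i\mapsto w(i),j\mapsto w(j))$ is a crossed alignment if there is a third arc $h\mapsto w(h)$ forming a crossing with both. A spirograph permutation is one of the form $w(i)=i+t \pmod n$ for a fixed $1\le t\le n$, and its chord diagram is a spirograph; "union of spirographs on a noncrossing partition" means there is a noncrossing partition of $[n]$ whose blocks are each mapped to themselves by $w$, and on each block $B=\{b_1<\dots<b_m\}$ the permutation acts as $b_i\mapsto b_{i+t\pmod m}$ for some fixed $t$ (i.e., after relabeling $B$ as $[m]$ it is a spirograph permutation). The Johnson graph $J(\mathcal{M})$ has vertex set $\mathcal{M}$, with $I,J$ adjacent iff $|I\cap J|=k-1$. *)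

theory Defs
  imports
    Complex_Main
    "HOL-Library.Function_Algebras"
    "HOL-Library.Extended_Nat"
    "HOL-Library.Disjoint_Sets"
    "HOL-Combinatorics.Permutations"
    "Jordan_Normal_Form.Determinant"
begin

section \<open>Decorated permutations and positroids\<close>

definition ksubsets :: "nat \<Rightarrow> nat \<Rightarrow> nat set set" where
  "ksubsets n k = {I. I \<subseteq> {1..n} \<and> card I = k}"

text \<open>A decorated permutation is a pair \<open>(w, C)\<close>, where \<open>C\<close> is the set of fixed points
  labelled clockwise; the remaining fixed points are labelled counterclockwise.\<close>

definition anti_exceedances :: "nat \<Rightarrow> (nat \<Rightarrow> nat) \<Rightarrow> nat set \<Rightarrow> nat set" where
  "anti_exceedances n w C = {i \<in> {1..n}. i < inv_into UNIV w i \<or> i \<in> C}"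

definition decorated_perms :: "nat \<Rightarrow> nat \<Rightarrow> ((nat \<Rightarrow> nat) \<times> nat set) set" where
  "decorated_perms n k =
     {(w, C). w permutes {1..n} \<and> C \<subseteq> {i \<in> {1..n}. w i = i} \<and> card (anti_exceedances n w C) = k}"

text \<open>\<open>cyc_pos n r i\<close> is the number of elements of \<open>{1..n}\<close> preceding \<open>i\<close> in the order
  \<open>r <\<^sub>r r+1 <\<^sub>r \<dots> <\<^sub>r n <\<^sub>r 1 <\<^sub>r \<dots> <\<^sub>r r-1\<close>, so \<open>i <\<^sub>r j\<close> iff \<open>cyc_pos n r i < cyc_pos n r j\<close>.\<close>

definition cyc_pos :: "nat \<Rightarrow> nat \<Rightarrow> nat \<Rightarrow> nat" where
  "cyc_pos n r i = (i + n - r) mod n"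

definition shifted_anti_exceedances ::
    "nat \<Rightarrow> (nat \<Rightarrow> nat) \<Rightarrow> nat set \<Rightarrow> nat \<Rightarrow> nat set" where
  "shifted_anti_exceedances n w C r =
     {i \<in> {1..n}. cyc_pos n r i < cyc_pos n r (inv_into UNIV w i) \<or> i \<in> C}"

definition gale_le :: "nat \<Rightarrow> nat \<Rightarrow> nat set \<Rightarrow> nat set \<Rightarrow> bool" where
  "gale_le n r I J \<longleftrightarrow>
     list_all2 (\<lambda>i j. cyc_pos n r i \<le> cyc_pos n r j)
       (sorted_key_list_of_set (cyc_pos n r) I) (sorted_key_list_of_set (cyc_pos n r) J)"

definition positroid :: "nat \<Rightarrow> nat \<Rightarrow> (nat \<Rightarrow> nat) \<Rightarrow> nat set \<Rightarrow> nat set set" where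
  "positroid n k w C =
     {I \<in> ksubsets n k. \<forall>r\<in>{1..n}. gale_le n r (shifted_anti_exceedances n w C r) I}"


section \<open>Chord diagrams\<close>

text \<open>The arcs are drawn as chords of a circle with marked points at integer positions, in
  clockwise order.  The vertex \<open>i\<close> sits at position \<open>3 * i\<close>, and the loop at a fixed point is
  replaced by a short chord with the same orientation: a loop inside the circle that runs clockwise
  returns to \<open>i\<close> from the counterclockwise side of \<open>i\<close>, and vice versa.\<close>

definition arc_tail :: "nat \<Rightarrow> nat" where
  "arc_tail i = 3 * i"

definition arc_head :: "(nat \<Rightarrow> nat) \<Rightarrow> nat set \<Rightarrow> nat \<Rightarrow> nat" where
  "arc_head w C i =
     (if w i = i then (if i \<in> C then 3 * i - 1 else 3 * i + 1) else 3 * w i)"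

definition clockwise :: "nat \<Rightarrow> nat \<Rightarrow> nat \<Rightarrow> bool" where
  "clockwise a b c \<longleftrightarrow> a < b \<and> b < c \<or> b < c \<and> c < a \<or> c < a \<and> a < b"

text \<open>A point \<open>x\<close> lies strictly to the left of the directed chord from \<open>a\<close> to \<open>b\<close> iff it is met when
  travelling clockwise from \<open>a\<close> to \<open>b\<close>.\<close>

definition left_of :: "(nat \<Rightarrow> nat) \<Rightarrow> nat set \<Rightarrow> nat \<Rightarrow> nat \<Rightarrow> bool" where
  "left_of w C i x \<longleftrightarrow> clockwise (arc_tail i) x (arc_head w C i)"

text \<open>Two arcs cross if they cannot be drawn disjointly in the closed disc, so arcs sharing a vertex
  (meeting on the circle) count as crossing.\<close>

definition crossing :: "(nat \<Rightarrow> nat) \<Rightarrow> nat set \<Rightarrow> nat \<Rightarrow> nat \<Rightarrow> bool" where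
  "crossing w C i j \<longleftrightarrow> i \<noteq> j \<and>
     ({arc_tail i, arc_head w C i} \<inter> {arc_tail j, arc_head w C j} \<noteq> {} \<or>
      left_of w C i (arc_tail j) \<noteq> left_of w C i (arc_head w C j))"

text \<open>Noncrossing chords point in the same direction iff exactly one of them lies to the left of the
  other.\<close>

definition alignment :: "(nat \<Rightarrow> nat) \<Rightarrow> nat set \<Rightarrow> nat \<Rightarrow> nat \<Rightarrow> bool" where
  "alignment w C i j \<longleftrightarrow> i \<noteq> j \<and> \<not> crossing w C i j \<and>
     left_of w C i (arc_tail j) \<noteq> left_of w C j (arc_tail i)"

definition alignments :: "nat \<Rightarrow> (nat \<Rightarrow> nat) \<Rightarrow> nat set \<Rightarrow> nat set set" where
  "alignments n w C = {{i, j} | i j. i \<in> {1..n} \<and> j \<in> {1..n} \<and> alignment w C i j}"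

definition crossed_alignment :: "nat \<Rightarrow> (nat \<Rightarrow> nat) \<Rightarrow> nat set \<Rightarrow> nat \<Rightarrow> nat \<Rightarrow> bool" where
  "crossed_alignment n w C i j \<longleftrightarrow>
     alignment w C i j \<and> (\<exists>h\<in>{1..n}. crossing w C h i \<and> crossing w C h j)"

definition noncrossing :: "nat set set \<Rightarrow> bool" where
  "noncrossing P \<longleftrightarrow>
     (\<forall>A\<in>P. \<forall>B\<in>P. A \<noteq> B \<longrightarrow>
        \<not> (\<exists>a b c d. a < b \<and> b < c \<and> c < d \<and> a \<in> A \<and> c \<in> A \<and> b \<in> B \<and> d \<in> B))"

definition spirograph_on :: "(nat \<Rightarrow> nat) \<Rightarrow> nat set \<Rightarrow> bool" where
  "spirograph_on w B \<longleftrightarrow>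
     (\<exists>t\<in>{1..card B}. \<forall>i<card B.
        w (sorted_list_of_set B ! i) = sorted_list_of_set B ! ((i + t) mod card B))"

definition union_of_spirographs :: "nat \<Rightarrow> (nat \<Rightarrow> nat) \<Rightarrow> bool" where
  "union_of_spirographs n w \<longleftrightarrow>
     (\<exists>P. partition_on {1..n} P \<and> noncrossing P \<and>
        (\<forall>B\<in>P. w ` B = B \<and> spirograph_on w B))"


section \<open>The Johnson graph\<close>

text \<open>Graphs are pairs of a vertex set and a set of two-element edges.  The condition
  \<open>|I \<inter> J| = k - 1\<close> is written without the truncated subtraction, which would be wrong for
  \<open>k = 0\<close>.\<close>

definition johnson_graph :: "nat \<Rightarrow> nat set set \<Rightarrow> nat set set \<times> nat set set set" where
  "johnson_graph k M = (M, {{I, J} | I J. I \<in> M \<and> J \<in> M \<and> card (I \<inter> J) + 1 = k})"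

definition degree_in :: "'a set \<times> 'a set set \<Rightarrow> 'a \<Rightarrow> nat" where
  "degree_in G v = card {e \<in> snd G. v \<in> e}"

definition regular_graph :: "'a set \<times> 'a set set \<Rightarrow> bool" where
  "regular_graph G \<longleftrightarrow> (\<exists>d. \<forall>v\<in>fst G. degree_in G v = d)"


section \<open>Affine algebraic sets over the complex numbers\<close>

text \<open>The affine space with coordinates indexed by \<open>S\<close> is the set of functions supported on \<open>S\<close>.\<close>

definition cscale :: "complex \<Rightarrow> ('v \<Rightarrow> complex) \<Rightarrow> 'v \<Rightarrow> complex" where
  "cscale c v = (\<lambda>i. c * v i)"

interpretation cfun: vector_space "cscale :: complex \<Rightarrow> ('v \<Rightarrow> complex) \<Rightarrow> 'v \<Rightarrow> complex"
  by unfold_locales (auto simp: cscale_def fun_eq_iff algebra_simps)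

definition affine_space :: "'v set \<Rightarrow> ('v \<Rightarrow> complex) set" where
  "affine_space S = {x. \<forall>i. i \<notin> S \<longrightarrow> x i = 0}"

inductive_set poly_funs :: "'v set \<Rightarrow> (('v \<Rightarrow> complex) \<Rightarrow> complex) set" for S :: "'v set" where
  const: "(\<lambda>x. c) \<in> poly_funs S"
| coord: "i \<in> S \<Longrightarrow> (\<lambda>x. x i) \<in> poly_funs S"
| add: "f \<in> poly_funs S \<Longrightarrow> g \<in> poly_funs S \<Longrightarrow> (\<lambda>x. f x + g x) \<in> poly_funs S"
| mult: "f \<in> poly_funs S \<Longrightarrow> g \<in> poly_funs S \<Longrightarrow> (\<lambda>x. f x * g x) \<in> poly_funs S"

definition zariski_closed :: "'v set \<Rightarrow> ('v \<Rightarrow> complex) set \<Rightarrow> bool" where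
  "zariski_closed S Z \<longleftrightarrow>
     (\<exists>F. F \<subseteq> poly_funs S \<and> Z = {x \<in> affine_space S. \<forall>f\<in>F. f x = 0})"

definition vanishing_ideal ::
    "'v set \<Rightarrow> ('v \<Rightarrow> complex) set \<Rightarrow> (('v \<Rightarrow> complex) \<Rightarrow> complex) set" where
  "vanishing_ideal S X = {f \<in> poly_funs S. \<forall>x\<in>X. f x = 0}"

definition irreducible_closed :: "'v set \<Rightarrow> ('v \<Rightarrow> complex) set \<Rightarrow> bool" where
  "irreducible_closed S Z \<longleftrightarrow> zariski_closed S Z \<and> Z \<noteq> {} \<and>
     (\<forall>A B. zariski_closed S A \<and> zariski_closed S B \<and> Z \<subseteq> A \<union> B \<longrightarrow> Z \<subseteq> A \<or> Z \<subseteq> B)"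

text \<open>The dimension of \<open>X\<close> at \<open>p\<close>, i.e. the Krull dimension of the local ring at \<open>p\<close>.\<close>

definition local_dim :: "'v set \<Rightarrow> ('v \<Rightarrow> complex) set \<Rightarrow> ('v \<Rightarrow> complex) \<Rightarrow> enat" where
  "local_dim S X p =
     (SUP d \<in> {d. \<exists>Z. (\<forall>i\<le>d. irreducible_closed S (Z i) \<and> p \<in> Z i \<and> Z i \<subseteq> X) \<and>
                      (\<forall>i<d. Z i \<subset> Z (Suc i))}. enat d)"

text \<open>The Zariski tangent space: the common kernel of the differentials at \<open>p\<close> of all elements of the
  vanishing ideal.\<close>

definition tangent_space ::
    "'v set \<Rightarrow> ('v \<Rightarrow> complex) set \<Rightarrow> ('v \<Rightarrow> complex) \<Rightarrow> ('v \<Rightarrow> complex) set" where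
  "tangent_space S X p =
     {v \<in> affine_space S. \<forall>f \<in> vanishing_ideal S X.
        ((\<lambda>t. f (\<lambda>i. p i + t * v i)) has_field_derivative 0) (at 0)}"

definition smooth_affine :: "'v set \<Rightarrow> ('v \<Rightarrow> complex) set \<Rightarrow> bool" where
  "smooth_affine S X \<longleftrightarrow> (\<forall>p\<in>X. enat (cfun.dim (tangent_space S X p)) = local_dim S X p)"


section \<open>The Grassmannian and positroid varieties\<close>

definition grassmannian :: "nat \<Rightarrow> nat \<Rightarrow> (nat \<Rightarrow> complex) set set" where
  "grassmannian n k = {V. cfun.subspace V \<and> V \<subseteq> affine_space {1..n} \<and> cfun.dim V = k}"

text \<open>\<open>plucker k A I\<close> is the minor in columns \<open>I\<close> of the matrix with rows \<open>A 0, \<dots>, A (k - 1)\<close>.\<close>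

definition plucker :: "nat \<Rightarrow> (nat \<Rightarrow> nat \<Rightarrow> complex) \<Rightarrow> nat set \<Rightarrow> complex" where
  "plucker k A I = det (mat k k (\<lambda>(r, c). A r (sorted_list_of_set I ! c)))"

text \<open>The vanishing of a Pluecker coordinate at \<open>V\<close> does not depend on the matrix with row span
  \<open>V\<close>.\<close>

definition positroid_variety :: "nat \<Rightarrow> nat \<Rightarrow> nat set set \<Rightarrow> (nat \<Rightarrow> complex) set set" where
  "positroid_variety n k M =
     {V \<in> grassmannian n k. \<forall>I \<in> ksubsets n k - M.
        \<forall>A. cfun.span (A ` {..<k}) = V \<longrightarrow> plucker k A I = 0}"

text \<open>The standard affine chart \<open>\<Delta>\<^sub>J \<noteq> 0\<close>: the row span of the matrix, with rows indexed by \<open>J\<close>, that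
  is the identity in the columns \<open>J\<close> and has entries \<open>x (i, j)\<close> in the columns \<open>j \<notin> J\<close>.\<close>

definition chart_index :: "nat \<Rightarrow> nat set \<Rightarrow> (nat \<times> nat) set" where
  "chart_index n J = J \<times> ({1..n} - J)"

definition chart_point :: "nat set \<Rightarrow> (nat \<times> nat \<Rightarrow> complex) \<Rightarrow> (nat \<Rightarrow> complex) set" where
  "chart_point J x =
     cfun.span ((\<lambda>i j. if j \<in> J then (if j = i then 1 else 0) else x (i, j)) ` J)"

definition smooth_in_grassmannian :: "nat \<Rightarrow> nat \<Rightarrow> (nat \<Rightarrow> complex) set set \<Rightarrow> bool" where
  "smooth_in_grassmannian n k X \<longleftrightarrow>
     (\<forall>J \<in> ksubsets n k. smooth_affine (chart_index n J)
        {x \<in> affine_space (chart_index n J). chart_point J x \<in> X})"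

end

theory Submission
  imports Defs
begin

text \<open>
  In the affine chart around the coordinate subspace of a basis \<open>J\<close>, the positroid variety lies in the
  coordinate space \<open>L\<^sub>J\<close> spanned by the exchanges \<open>J - i + j \<in> M\<close>, and \<open>L\<^sub>J\<close> is its tangent space at the
  origin. A chain of irreducible closed sets in affine \<open>m\<close>-space has length at most \<open>m\<close>, so smoothness
  at the origin forces the variety to be all of \<open>L\<^sub>J\<close>. Evaluating minors at 0/1 points, this says that two
  disjoint exchanges at \<open>J\<close> can always be performed simultaneously. Hence the exchange graph of every
  basis is a union of complete bipartite graphs whose components are constant along exchanges;
  following the Grassmann necklace, \<open>w\<close> preserves these components and acts on each of them as a
  rotation, and a crossing of two components would produce an exchange between them. Conversely,
  spirographs on a noncrossing partition give a direct sum of uniform matroids, and then every chart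
  is a coordinate space.

  A basis \<open>I\<close> belongs to the positroid iff every cyclic interval contains at least as many non-elements
  of \<open>I\<close> as it contains arcs. For a necklace basis, the exchanges blocked by an interval are counted by
  a flow argument: they inject into the alignments, and they are strictly fewer if some alignment is
  crossed. Finally, suppose that no alignment is crossed. If the span of an arc exceeds the span of the
  arc into the preceding head by at least two, then some proper cyclic interval is invariant, and an
  excess of exactly one is impossible. So if the permutation cannot be split along a noncrossing
  partition, its spans decrease weakly around the circle; hence they are constant, and it is a rotation.
\<close>

section \<open>Polynomial functions and irreducible closed sets\<close>

lemma poly_funs_line:
  assumes "f \<in> poly_funs S"
  shows "\<exists>q. \<forall>t. f (\<lambda>i. a i + t * v i) = poly q t"
  using assms
proof induction
  case (const c)
  show ?case by (rule exI[of _ "[:c:]"]) simp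
next
  case (coord i)
  show ?case by (rule exI[of _ "[:a i, v i:]"]) (simp add: algebra_simps)
next
  case (add f g)
  then show ?case by (metis poly_add)
next
  case (mult f g)
  then show ?case by (metis poly_mult)
qed

lemma poly_funs_mono: "f \<in> poly_funs T \<Longrightarrow> T \<subseteq> S \<Longrightarrow> f \<in> poly_funs S"
  by (induction rule: poly_funs.induct) (auto intro: poly_funs.intros)

lemma poly_funs_power: "f \<in> poly_funs S \<Longrightarrow> (\<lambda>x. f x ^ e) \<in> poly_funs S"
  by (induction e) (auto intro: poly_funs.const poly_funs.mult)

lemma poly_funs_sum:
  "finite A \<Longrightarrow> (\<And>a. a \<in> A \<Longrightarrow> f a \<in> poly_funs S) \<Longrightarrow> (\<lambda>x. \<Sum>a\<in>A. f a x) \<in> poly_funs S"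
  by (induction A rule: finite_induct) (auto intro: poly_funs.const poly_funs.add)

lemma poly_funs_restrict:
  "f \<in> poly_funs S \<Longrightarrow> (\<lambda>x. f (\<lambda>i. if i \<in> T then x i else 0)) \<in> poly_funs T"
proof (induction rule: poly_funs.induct)
  case (coord i)
  show ?case by (cases "i \<in> T") (auto intro: poly_funs.coord poly_funs.const)
qed (auto intro: poly_funs.intros)

lemma affine_space_restrict:
  "x \<in> affine_space T \<Longrightarrow> (\<lambda>i. if i \<in> T then x i else 0) = x"
  by (auto simp: affine_space_def)

lemma affine_space_mono: "T \<subseteq> S \<Longrightarrow> affine_space T \<subseteq> affine_space S"
  by (auto simp: affine_space_def)

lemma zariski_closed_subset: "zariski_closed S Z \<Longrightarrow> Z \<subseteq> affine_space S"
  by (auto simp: zariski_closed_def)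

lemma irreducible_closed_subset: "irreducible_closed S Z \<Longrightarrow> Z \<subseteq> affine_space S"
  by (simp add: irreducible_closed_def zariski_closed_subset)

lemma zariski_closed_separating:
  assumes "zariski_closed S Z" "T \<subseteq> S" "Z \<subseteq> affine_space T" "x \<in> affine_space T" "x \<notin> Z"
  obtains f where "f \<in> poly_funs T" "\<And>z. z \<in> Z \<Longrightarrow> f z = 0" "f x \<noteq> 0"
proof -
  obtain F where F: "F \<subseteq> poly_funs S" "Z = {x \<in> affine_space S. \<forall>f\<in>F. f x = 0}"
    using assms(1) unfolding zariski_closed_def by auto
  then obtain f where f: "f \<in> F" "f x \<noteq> 0"
    using assms(4,5) affine_space_mono[OF assms(2)] by auto
  let ?g = "\<lambda>x. f (\<lambda>i. if i \<in> T then x i else 0)"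
  have "?g \<in> poly_funs T" using f(1) F(1) by (intro poly_funs_restrict) auto
  moreover have "?g z = 0" if "z \<in> Z" for z
    using that f(1) F(2) assms(3) affine_space_restrict[of z T] by auto
  moreover have "?g x \<noteq> 0" using f(2) affine_space_restrict[OF assms(4)] by simp
  ultimately show thesis by (rule that)
qed

lemma irreducible_closed_if_lines:
  assumes "zariski_closed S Z" "Z \<noteq> {}"
    and line: "\<And>x y t. x \<in> Z \<Longrightarrow> y \<in> Z \<Longrightarrow> (\<lambda>i. x i + t * (y i - x i)) \<in> Z"
  shows "irreducible_closed S Z"
  unfolding irreducible_closed_def
proof (intro conjI allI impI assms(1,2))
  fix A B
  assume AB: "zariski_closed S A \<and> zariski_closed S B \<and> Z \<subseteq> A \<union> B"
  show "Z \<subseteq> A \<or> Z \<subseteq> B"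
  proof (rule ccontr)
    assume "\<not> (Z \<subseteq> A \<or> Z \<subseteq> B)"
    then obtain x y where xy: "x \<in> Z" "x \<notin> A" "y \<in> Z" "y \<notin> B" by auto
    have xyS: "x \<in> affine_space S" "y \<in> affine_space S"
      using zariski_closed_subset[OF assms(1)] xy by auto
    obtain f where f: "f \<in> poly_funs S" "\<And>z. z \<in> A \<Longrightarrow> f z = 0" "f x \<noteq> 0"
      using zariski_closed_separating[of S A S x] zariski_closed_subset AB xy xyS by blast
    obtain g where g: "g \<in> poly_funs S" "\<And>z. z \<in> B \<Longrightarrow> g z = 0" "g y \<noteq> 0"
      using zariski_closed_separating[of S B S y] zariski_closed_subset AB xy xyS by blast
    define L where "L t = (\<lambda>i. x i + t * (y i - x i))" for t
    obtain p where p: "\<And>t. f (L t) = poly p t"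
      using poly_funs_line[OF f(1), of x "\<lambda>i. y i - x i"] unfolding L_def by auto
    obtain q where q: "\<And>t. g (L t) = poly q t"
      using poly_funs_line[OF g(1), of x "\<lambda>i. y i - x i"] unfolding L_def by auto
    have "L 0 = x" "L 1 = y" by (auto simp: L_def)
    then have "p \<noteq> 0" "q \<noteq> 0" using f(3) g(3) p[of 0] q[of 1] by auto
    moreover have "poly (p * q) t = 0" for t
    proof -
      have "L t \<in> A \<union> B" using line[OF xy(1,3)] AB unfolding L_def by blast
      then show ?thesis using f(2)[of "L t"] g(2)[of "L t"] p[of t] q[of t] by auto
    qed
    ultimately show False by (metis mult_eq_0_iff poly_all_0_iff_0)
  qed
qed

lemma irreducible_closed_integral:
  assumes "irreducible_closed S Z" "f \<in> poly_funs S" "g \<in> poly_funs S" "\<And>x. x \<in> Z \<Longrightarrow> f x * g x = 0"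
    and "x \<in> Z" "f x \<noteq> 0" "y \<in> Z"
  shows "g y = 0"
proof -
  have "zariski_closed S {x \<in> affine_space S. h x = 0}" if "h \<in> poly_funs S" for h
    unfolding zariski_closed_def using that by (intro exI[of _ "{h}"]) auto
  moreover have "Z \<subseteq> {x \<in> affine_space S. f x = 0} \<union> {x \<in> affine_space S. g x = 0}"
    using irreducible_closed_subset[OF assms(1)] assms(4) by auto
  ultimately have "Z \<subseteq> {x \<in> affine_space S. f x = 0} \<or> Z \<subseteq> {x \<in> affine_space S. g x = 0}"
    using assms(1,2,3) unfolding irreducible_closed_def by blast
  then show ?thesis using assms by auto
qed

definition slice :: "'v set \<Rightarrow> 'v set \<Rightarrow> ('v \<Rightarrow> complex) \<Rightarrow> ('v \<Rightarrow> complex) set" where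
  "slice S T p = {x \<in> affine_space S. \<forall>i\<in>S - T. x i = p i}"

lemma mem_slice: "p \<in> affine_space S \<Longrightarrow> p \<in> slice S T p"
  by (simp add: slice_def)

lemma irreducible_closed_slice:
  assumes "p \<in> affine_space S"
  shows "irreducible_closed S (slice S T p)"
proof (rule irreducible_closed_if_lines)
  have "(\<lambda>x. x i + (- p i)) \<in> poly_funs S" if "i \<in> S" for i
    using that by (intro poly_funs.add poly_funs.coord poly_funs.const)
  then show "zariski_closed S (slice S T p)"
    unfolding zariski_closed_def slice_def by (intro exI[of _ "(\<lambda>i x. x i + (- p i)) ` (S - T)"]) auto
  show "slice S T p \<noteq> {}" using mem_slice[OF assms] by auto
qed (auto simp: slice_def affine_space_def)

lemma slice_eq_affine_space:
  assumes "T \<subseteq> S" "p \<in> affine_space T"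
  shows "slice S T p = affine_space T"
proof
  show "affine_space T \<subseteq> slice S T p" using assms by (auto simp: slice_def affine_space_def)
  show "slice S T p \<subseteq> affine_space T"
  proof
    fix x assume x: "x \<in> slice S T p"
    have "x i = 0" if "i \<notin> T" for i
      using x that assms(2) by (cases "i \<in> S") (auto simp: slice_def affine_space_def)
    then show "x \<in> affine_space T" by (simp add: affine_space_def)
  qed
qed

section \<open>Monomials and degree bounds\<close>

fun monomial :: "('a \<Rightarrow> complex) list \<Rightarrow> nat list \<Rightarrow> 'a \<Rightarrow> complex" where
  "monomial (f # fs) (e # es) = (\<lambda>x. f x ^ e * monomial fs es x)"
| "monomial _ _ = (\<lambda>x. 1)"

definition exponents :: "nat \<Rightarrow> nat \<Rightarrow> nat list set" where
  "exponents d N = {es. set es \<subseteq> {..<N} \<and> length es = d}"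

lemma finite_exponents [simp]: "finite (exponents d N)"
  unfolding exponents_def by (rule finite_lists_length_eq) simp

lemma card_exponents [simp]: "card (exponents d N) = N ^ d"
  unfolding exponents_def using card_lists_length_eq[of "{..<N}" d] by simp

lemma exponents_0 [simp]: "exponents 0 N = {[]}"
  by (auto simp: exponents_def)

lemma exponents_SucE:
  assumes "es \<in> exponents (Suc d) N"
  obtains e es' where "es = e # es'" "e < N" "es' \<in> exponents d N"
  using assms by (auto simp: exponents_def length_Suc_conv)

lemma sum_exponents_Suc:
  fixes g :: "nat list \<Rightarrow> 'a::comm_monoid_add"
  shows "(\<Sum>es\<in>exponents (Suc d) N. g es) = (\<Sum>e<N. \<Sum>es\<in>exponents d N. g (e # es))"
proof -
  have "exponents (Suc d) N = (\<lambda>(e, es). e # es) ` ({..<N} \<times> exponents d N)"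
    by (auto simp: exponents_def length_Suc_conv image_iff)
  moreover have "inj_on (\<lambda>(e, es). e # es) ({..<N} \<times> exponents d N)"
    by (auto simp: inj_on_def)
  ultimately show ?thesis
    by (simp only: sum.reindex sum.cartesian_product) (auto intro: sum.cong)
qed

lemma poly_funs_monomial:
  "set fs \<subseteq> poly_funs S \<Longrightarrow> monomial fs es \<in> poly_funs S"
  by (induction fs es rule: list_induct2')
     (auto intro: poly_funs.const poly_funs.mult poly_funs_power)

lemma monomial_replicate_0: "monomial fs (replicate (length fs) 0) = (\<lambda>x. 1)"
  by (induction fs) auto

lemma monomial_mult:
  "length es = length fs \<Longrightarrow> length es' = length fs \<Longrightarrow>
   monomial fs (map2 (+) es es') x = monomial fs es x * monomial fs es' x"
proof (induction fs arbitrary: es es')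
  case (Cons f fs)
  then show ?case
    by (cases es; cases es') (auto simp: power_add mult_ac)
qed simp

lemma ex_monomial_eq_member:
  "f \<in> set fs \<Longrightarrow> \<exists>es\<in>exponents (length fs) 2. monomial fs es = f"
proof (induction fs)
  case (Cons h fs)
  show ?case
  proof (cases "f = h")
    case True
    then show ?thesis
      by (intro bexI[of _ "1 # replicate (length fs) 0"])
        (auto simp: exponents_def monomial_replicate_0)
  next
    case False
    then obtain es where "es \<in> exponents (length fs) 2" "monomial fs es = f"
      using Cons by auto
    then show ?thesis by (intro bexI[of _ "0 # es"]) (auto simp: exponents_def)
  qed
qed simp

lemma subspace_multiplier_in_span: "cfun.subspace {f. (\<lambda>x. f x * g x) \<in> cfun.span D}"
  unfolding cfun.subspace_def mem_Collect_eq
proof (intro conjI ballI allI)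
  show "(\<lambda>x. (0 :: 'a \<Rightarrow> complex) x * g x) \<in> cfun.span D"
    using cfun.span_zero[of D] by (simp add: zero_fun_def)
next
  fix f h assume "f \<in> {f. (\<lambda>x. f x * g x) \<in> cfun.span D}" "h \<in> {f. (\<lambda>x. f x * g x) \<in> cfun.span D}"
  then have "(\<lambda>x. f x * g x) + (\<lambda>x. h x * g x) \<in> cfun.span D" by (auto intro: cfun.span_add)
  then show "(\<lambda>x. (f + h) x * g x) \<in> cfun.span D" by (simp add: plus_fun_def distrib_right)
next
  fix c f assume "f \<in> {f. (\<lambda>x. f x * g x) \<in> cfun.span D}"
  then have "cscale c (\<lambda>x. f x * g x) \<in> cfun.span D" by (auto intro: cfun.span_scale)
  then show "(\<lambda>x. cscale c f x * g x) \<in> cfun.span D" by (simp add: cscale_def mult.assoc)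
qed

lemma span_mult_in_span:
  assumes "f \<in> cfun.span A" "g \<in> cfun.span B"
    and prod: "\<And>a b. a \<in> A \<Longrightarrow> b \<in> B \<Longrightarrow> (\<lambda>x. a x * b x) \<in> cfun.span D"
  shows "(\<lambda>x. f x * g x) \<in> cfun.span D"
proof -
  have "A \<subseteq> {f. (\<lambda>x. f x * g x) \<in> cfun.span D}"
  proof
    fix a assume "a \<in> A"
    then have "B \<subseteq> {g. (\<lambda>x. g x * a x) \<in> cfun.span D}"
      using prod by (auto simp: mult.commute[of _ "a _"])
    then have "cfun.span B \<subseteq> {g. (\<lambda>x. g x * a x) \<in> cfun.span D}"
      by (intro cfun.span_minimal subspace_multiplier_in_span)
    then show "a \<in> {f. (\<lambda>x. f x * g x) \<in> cfun.span D}" using assms(2) by (auto simp: mult.commute)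
  qed
  then have "cfun.span A \<subseteq> {f. (\<lambda>x. f x * g x) \<in> cfun.span D}"
    by (intro cfun.span_minimal subspace_multiplier_in_span)
  then show ?thesis using assms(1) by auto
qed

definition coord_monomials :: "'v list \<Rightarrow> nat \<Rightarrow> (('v \<Rightarrow> complex) \<Rightarrow> complex) set" where
  "coord_monomials vs D = monomial (map (\<lambda>i x. x i) vs) ` exponents (length vs) (Suc D)"

definition bounded_polys :: "'v list \<Rightarrow> nat \<Rightarrow> (('v \<Rightarrow> complex) \<Rightarrow> complex) set" where
  "bounded_polys vs D = cfun.span (coord_monomials vs D)"

lemma bounded_polys_mono:
  assumes "D \<le> E" "f \<in> bounded_polys vs D"
  shows "f \<in> bounded_polys vs E"
proof -
  have "coord_monomials vs D \<subseteq> coord_monomials vs E"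
    unfolding coord_monomials_def using assms(1) by (intro image_mono) (auto simp: exponents_def)
  then show ?thesis using cfun.span_mono assms(2) unfolding bounded_polys_def by blast
qed

lemma bounded_polys_const: "(\<lambda>x. c) \<in> bounded_polys vs D"
proof -
  have "replicate (length vs) 0 \<in> exponents (length vs) (Suc D)" by (auto simp: exponents_def)
  then have "(\<lambda>x. 1) \<in> coord_monomials vs D"
    unfolding coord_monomials_def
    using monomial_replicate_0[of "map (\<lambda>i x. x i) vs"] by (metis image_eqI length_map)
  then have "cscale c (\<lambda>x. 1) \<in> bounded_polys vs D"
    unfolding bounded_polys_def by (intro cfun.span_scale cfun.span_base)
  then show ?thesis by (simp add: cscale_def)
qed

lemma bounded_polys_coord:
  assumes "i \<in> set vs" shows "(\<lambda>x. x i) \<in> bounded_polys vs 1"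
proof -
  have "(\<lambda>x. x i) \<in> set (map (\<lambda>i x. x i) vs)" using assms by auto
  from ex_monomial_eq_member[OF this] have "(\<lambda>x. x i) \<in> coord_monomials vs 1"
    unfolding coord_monomials_def by (metis One_nat_def Suc_1 image_eqI length_map)
  then show ?thesis unfolding bounded_polys_def by (rule cfun.span_base)
qed

lemma bounded_polys_mult:
  assumes "f \<in> bounded_polys vs D" "g \<in> bounded_polys vs E"
  shows "(\<lambda>x. f x * g x) \<in> bounded_polys vs (D + E)"
  unfolding bounded_polys_def
proof (rule span_mult_in_span[OF assms[unfolded bounded_polys_def]])
  let ?m = "monomial (map (\<lambda>i x. x i) vs)"
  fix a b
  assume "a \<in> coord_monomials vs D" "b \<in> coord_monomials vs E"
  then obtain es es' where e: "a = ?m es" "b = ?m es'" "es \<in> exponents (length vs) (Suc D)"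
    "es' \<in> exponents (length vs) (Suc E)" by (auto simp: coord_monomials_def)
  have "x + y < Suc (D + E)" if "(x, y) \<in> set (zip es es')" for x y
    using e(3,4) set_zip_leftD[OF that] set_zip_rightD[OF that] by (force simp: exponents_def)
  then have "map2 (+) es es' \<in> exponents (length vs) (Suc (D + E))"
    using e(3,4) by (auto simp: exponents_def)
  moreover have "(\<lambda>x. a x * b x) = ?m (map2 (+) es es')"
    using e by (auto simp: fun_eq_iff exponents_def monomial_mult)
  ultimately show "(\<lambda>x. a x * b x) \<in> cfun.span (coord_monomials vs (D + E))"
    unfolding coord_monomials_def by (intro cfun.span_base image_eqI)
qed

lemma bounded_polys_power:
  "f \<in> bounded_polys vs D \<Longrightarrow> (\<lambda>x. f x ^ e) \<in> bounded_polys vs (e * D)"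
proof (induction e)
  case (Suc e)
  then show ?case using bounded_polys_mult[of f vs D "\<lambda>x. f x ^ e" "e * D"] by simp
qed (simp add: bounded_polys_const)

lemma bounded_polys_monomial:
  assumes "set fs \<subseteq> bounded_polys vs D" "es \<in> exponents (length fs) N"
  shows "monomial fs es \<in> bounded_polys vs (length fs * (N * D))"
  using assms
proof (induction fs arbitrary: es)
  case Nil
  then show ?case by (simp add: bounded_polys_const)
next
  case (Cons f fs)
  obtain e es' where e: "es = e # es'" "e < N" "es' \<in> exponents (length fs) N"
    using Cons.prems(2) by (auto elim: exponents_SucE)
  have "(\<lambda>x. f x ^ e) \<in> bounded_polys vs (N * D)"
    using bounded_polys_mono[OF _ bounded_polys_power[of f vs D e], of "N * D"] e(2) Cons.prems(1)
    by auto
  then show ?case using bounded_polys_mult[OF _ Cons.IH[OF _ e(3)]] Cons.prems(1) e(1) by simp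
qed

lemma poly_funs_bounded:
  assumes "f \<in> poly_funs (set vs)"
  shows "\<exists>D. f \<in> bounded_polys vs D"
  using assms
proof induction
  case (const c)
  show ?case using bounded_polys_const by (rule exI)
next
  case (coord i)
  then have "(\<lambda>x. x i) \<in> bounded_polys vs 1" by (rule bounded_polys_coord)
  then show ?case by (rule exI)
next
  case (add f g)
  then obtain D E where "f \<in> bounded_polys vs D" "g \<in> bounded_polys vs E" by blast
  then have "f \<in> bounded_polys vs (max D E)" "g \<in> bounded_polys vs (max D E)"
    using bounded_polys_mono max.cobounded1 max.cobounded2 by blast+
  then have "f + g \<in> bounded_polys vs (max D E)" unfolding bounded_polys_def by (rule cfun.span_add)
  then show ?case by (auto simp: plus_fun_def)
next
  case (mult f g)
  then show ?case using bounded_polys_mult by blast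
qed

lemma poly_funs_bounded_uniform:
  assumes "finite I" "\<And>i. i \<in> I \<Longrightarrow> f i \<in> poly_funs (set vs)"
  shows "\<exists>D. \<forall>i\<in>I. f i \<in> bounded_polys vs D"
  using assms
proof (induction I rule: finite_induct)
  case (insert i I)
  obtain D where D: "\<forall>i\<in>I. f i \<in> bounded_polys vs D" using insert by auto
  obtain E where E: "f i \<in> bounded_polys vs E" using insert.prems poly_funs_bounded by blast
  show ?case
    using D E bounded_polys_mono max.cobounded1[of D E] max.cobounded2[of E D]
    by (intro exI[of _ "max D E"]) blast
qed simp

section \<open>Dimension of affine space\<close>

lemma sum_fun_apply: "(\<Sum>a\<in>A. f a) x = (\<Sum>a\<in>A. f a x)" for f :: "'a \<Rightarrow> 'b \<Rightarrow> 'c::comm_monoid_add"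
  by (induction A rule: infinite_finite_induct) auto

context vector_space
begin

lemma independent_familyI:
  assumes "finite A" and trivial: "\<And>c a. (\<Sum>a\<in>A. c a *s v a) = 0 \<Longrightarrow> a \<in> A \<Longrightarrow> c a = 0"
  shows "inj_on v A \<and> independent (v ` A)"
proof
  show inj: "inj_on v A"
  proof (rule inj_onI, rule ccontr)
    fix a b assume ab: "a \<in> A" "b \<in> A" "v a = v b" "a \<noteq> b"
    define c where "c = (\<lambda>_. 0)(a := 1, b := - 1 :: 'a)"
    have "(\<Sum>x\<in>A. c x *s v x) = (\<Sum>x\<in>{a, b}. c x *s v x)"
      by (rule sum.mono_neutral_right) (use ab assms(1) in \<open>auto simp: c_def\<close>)
    also have "\<dots> = 0" using ab(3,4) by (simp add: c_def)
    finally have "c a = 0" using trivial ab(1) by blast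
    then show False using ab(4) by (simp add: c_def)
  qed
  show "independent (v ` A)"
  proof (rule independent_if_scalars_zero)
    fix c x assume "(\<Sum>x\<in>v ` A. c x *s x) = 0" "x \<in> v ` A"
    then show "c x = 0" using trivial[of "\<lambda>a. c (v a)"] by (auto simp: sum.reindex[OF inj])
  qed (use assms(1) in simp)
qed

end

definition separating_sequence ::
    "'v set \<Rightarrow> nat \<Rightarrow> (nat \<Rightarrow> ('v \<Rightarrow> complex) set) \<Rightarrow> (nat \<Rightarrow> ('v \<Rightarrow> complex) \<Rightarrow> complex) \<Rightarrow> bool" where
  "separating_sequence S d Z f \<longleftrightarrow> (\<forall>i\<le>d. irreducible_closed S (Z i)) \<and>
     (\<forall>i<d. Z i \<subseteq> Z (Suc i) \<and> f i \<in> poly_funs S \<and> (\<forall>x\<in>Z i. f i x = 0) \<and> (\<exists>x\<in>Z (Suc i). f i x \<noteq> 0))"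

text \<open>Dividing the relation by \<open>f ^ e\<close> is possible because \<open>Z\<close> is irreducible.\<close>

lemma lowest_coefficient_vanishes:
  assumes irr: "irreducible_closed S Z" and f: "f \<in> poly_funs S" "z \<in> Z" "f z \<noteq> 0"
    and g: "\<And>e. g e \<in> poly_funs S"
    and relation: "\<And>x. x \<in> Z \<Longrightarrow> (\<Sum>e<N. f x ^ e * g e x) = 0"
    and e: "e < N" and lower: "\<And>e' x. e' < e \<Longrightarrow> x \<in> Z \<Longrightarrow> g e' x = 0"
    and x: "x \<in> Z" "f x = 0"
  shows "g e x = 0"
proof -
  define h where "h x = (\<Sum>e'\<in>{e..<N}. f x ^ (e' - e) * g e' x)" for x
  have h_poly: "h \<in> poly_funs S"
    unfolding h_def by (intro poly_funs_sum poly_funs.mult poly_funs_power f(1) g) simp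
  have "f y ^ e * h y = 0" if y: "y \<in> Z" for y
  proof -
    have "f y ^ e * h y = (\<Sum>e'\<in>{e..<N}. f y ^ e' * g e' y)"
      unfolding h_def sum_distrib_left
      by (intro sum.cong refl) (simp add: mult.assoc[symmetric] power_add[symmetric])
    also have "\<dots> = (\<Sum>e'<N. f y ^ e' * g e' y)"
      by (intro sum.mono_neutral_left) (auto simp: lower[OF _ y])
    finally show ?thesis using relation[OF y] by simp
  qed
  then have "h x = 0"
    by (rule irreducible_closed_integral[OF irr poly_funs_power[OF f(1)] h_poly _ f(2) _ x(1)])
      (use f(3) in simp_all)
  moreover have "h x = (\<Sum>e'\<in>{e}. f x ^ (e' - e) * g e' x)"
    unfolding h_def by (rule sum.mono_neutral_right) (use e x(2) in auto)
  ultimately show ?thesis by simp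
qed

lemma monomials_linearly_independent:
  assumes "separating_sequence S d Z f"
    and "\<And>x. x \<in> Z d \<Longrightarrow> (\<Sum>es\<in>exponents d N. c es * monomial (map f (rev [0..<d])) es x) = 0"
    and "es \<in> exponents d N"
  shows "c es = 0"
  using assms
proof (induction d arbitrary: c es)
  case 0
  then obtain x where "x \<in> Z 0" by (auto simp: separating_sequence_def irreducible_closed_def)
  then show ?case using "0.prems"(2)[of x] "0.prems"(3) by simp
next
  case (Suc d)
  let ?fs = "map f (rev [0..<d])"
  have seq: "separating_sequence S d Z f" and irr: "irreducible_closed S (Z (Suc d))"
    and step: "Z d \<subseteq> Z (Suc d)" "f d \<in> poly_funs S" "\<And>x. x \<in> Z d \<Longrightarrow> f d x = 0"
    using Suc.prems(1) by (auto simp: separating_sequence_def)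
  obtain z where z: "z \<in> Z (Suc d)" "f d z \<noteq> 0"
    using Suc.prems(1) by (auto simp: separating_sequence_def)
  define g where "g e x = (\<Sum>es\<in>exponents d N. c (e # es) * monomial ?fs es x)" for e x
  have g: "g e \<in> poly_funs S" for e
    unfolding g_def
    by (intro poly_funs_sum finite_exponents poly_funs.mult poly_funs.const poly_funs_monomial)
      (use seq in \<open>auto simp: separating_sequence_def\<close>)
  have relation: "(\<Sum>e<N. f d x ^ e * g e x) = 0" if "x \<in> Z (Suc d)" for x
    using Suc.prems(2)[OF that] by (simp add: sum_exponents_Suc g_def sum_distrib_left mult_ac)
  have "\<forall>es\<in>exponents d N. c (e # es) = 0" if "e < N" for e
    using that
  proof (induction e rule: less_induct)
    case (less e)
    have lower: "g e' x = 0" if "e' < e" for e' x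
      using less that unfolding g_def by (intro sum.neutral) auto
    have "g e x = 0" if "x \<in> Z d" for x
      by (rule lowest_coefficient_vanishes[OF irr step(2) z g relation less.prems])
        (use lower step that in auto)
    then show ?case
      using Suc.IH[OF seq, of "\<lambda>es. c (e # es)"] unfolding g_def by blast
  qed
  then show ?case using Suc.prems(3) by (auto elim: exponents_SucE)
qed

lemma power_bound_exponent_le:
  fixes d m c :: nat
  assumes "\<And>N. N \<ge> 1 \<Longrightarrow> N ^ d \<le> (Suc (d * (N * c))) ^ m"
  shows "d \<le> m"
proof (rule ccontr)
  assume "\<not> d \<le> m"
  define N where "N = Suc ((Suc (d * c)) ^ m)"
  have "N * N ^ m = N ^ Suc m" by simp
  also have "\<dots> \<le> N ^ d" using \<open>\<not> d \<le> m\<close> by (intro power_increasing) (auto simp: N_def)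
  also have "\<dots> \<le> (Suc (d * (N * c))) ^ m" using assms[of N] by (simp add: N_def)
  also have "\<dots> \<le> (N * Suc (d * c)) ^ m"
    by (intro power_mono) (auto simp: N_def algebra_simps)
  also have "\<dots> = N ^ m * (Suc (d * c)) ^ m" by (simp only: power_mult_distrib)
  finally have "N \<le> (Suc (d * c)) ^ m" by (simp add: N_def)
  then show False by (simp add: N_def)
qed

lemma separating_sequence_length_le:
  assumes seq: "separating_sequence S d Z f" and bounded: "\<And>i. i < d \<Longrightarrow> f i \<in> bounded_polys vs c"
  shows "d \<le> length vs"
proof (rule power_bound_exponent_le[of d c])
  fix N :: nat
  let ?m = "monomial (map f (rev [0..<d]))" and ?B = "coord_monomials vs (d * (N * c))"
  have trivial: "u es = 0"
    if "(\<Sum>es\<in>exponents d N. cscale (u es) (?m es)) = 0" "es \<in> exponents d N" for u es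
    by (rule monomials_linearly_independent[OF seq _ that(2)])
      (use fun_cong[OF that(1)] in \<open>simp add: sum_fun_apply cscale_def\<close>)
  have independent: "inj_on ?m (exponents d N) \<and> cfun.independent (?m ` exponents d N)"
    using trivial by (intro cfun.independent_familyI) auto
  have "set (map f (rev [0..<d])) \<subseteq> bounded_polys vs c" using bounded by auto
  then have "?m es \<in> cfun.span ?B" if "es \<in> exponents d N" for es
    using bounded_polys_monomial[of "map f (rev [0..<d])" vs c es N] that
    by (simp add: bounded_polys_def)
  then have "card (?m ` exponents d N) \<le> card ?B"
    using cfun.independent_span_bound[of ?B "?m ` exponents d N"] independent by (auto simp: coord_monomials_def)
  also have "\<dots> \<le> card (exponents (length vs) (Suc (d * (N * c))))"
    unfolding coord_monomials_def by (rule card_image_le) simp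
  finally show "N ^ d \<le> Suc (d * (N * c)) ^ length vs"
    using independent card_image by force
qed

definition irreducible_chain ::
    "'v set \<Rightarrow> ('v \<Rightarrow> complex) set \<Rightarrow> ('v \<Rightarrow> complex) \<Rightarrow> nat \<Rightarrow> (nat \<Rightarrow> ('v \<Rightarrow> complex) set) \<Rightarrow> bool" where
  "irreducible_chain S X p d Z \<longleftrightarrow>
     (\<forall>i\<le>d. irreducible_closed S (Z i) \<and> p \<in> Z i \<and> Z i \<subseteq> X) \<and> (\<forall>i<d. Z i \<subset> Z (Suc i))"

lemma irreducible_chain_extend:
  assumes "irreducible_chain S X p d Z" "irreducible_closed S Y" "X \<subset> Y" "p \<in> Y"
  shows "irreducible_chain S Y p (Suc d) (Z(Suc d := Y))"
  unfolding irreducible_chain_def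
proof (intro conjI allI impI)
  let ?Z = "Z(Suc d := Y)"
  fix i assume i: "i \<le> Suc d"
  show "irreducible_closed S (?Z i)" "p \<in> ?Z i" "?Z i \<subseteq> Y"
    using assms i by (cases "i = Suc d"; auto simp: irreducible_chain_def le_Suc_eq)+
next
  fix i assume i: "i < Suc d"
  then show "(Z(Suc d := Y)) i \<subset> (Z(Suc d := Y)) (Suc i)"
    using assms by (cases "i = d") (auto simp: irreducible_chain_def)
qed

lemma ex_separating_sequence:
  assumes "T \<subseteq> S" "X \<subseteq> affine_space T" and chain: "irreducible_chain S X p d Z"
  obtains f where "separating_sequence S d Z f" "\<And>i. i < d \<Longrightarrow> f i \<in> poly_funs T"
proof -
  have "\<exists>f. f \<in> poly_funs T \<and> (\<forall>x\<in>Z i. f x = 0) \<and> (\<exists>x\<in>Z (Suc i). f x \<noteq> 0)" if i: "i < d" for i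
  proof -
    obtain x where x: "x \<in> Z (Suc i)" "x \<notin> Z i" using chain i unfolding irreducible_chain_def by blast
    have "Z i \<subseteq> X" "Z (Suc i) \<subseteq> X" and closed: "zariski_closed S (Z i)"
      using chain i by (simp_all add: irreducible_chain_def irreducible_closed_def)
    then have "Z i \<subseteq> affine_space T" "x \<in> affine_space T" using assms(2) x(1) by auto
    then show ?thesis using zariski_closed_separating[OF closed assms(1), of x] x by metis
  qed
  then obtain f where "\<And>i. i < d \<Longrightarrow>
      f i \<in> poly_funs T \<and> (\<forall>x\<in>Z i. f i x = 0) \<and> (\<exists>x\<in>Z (Suc i). f i x \<noteq> 0)" by metis
  moreover from this have "separating_sequence S d Z f"
    using chain poly_funs_mono[OF _ assms(1)]
    unfolding separating_sequence_def irreducible_chain_def by blast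
  ultimately show thesis using that by blast
qed

lemma irreducible_chain_length_le:
  assumes "finite T" "T \<subseteq> S" "X \<subseteq> affine_space T" "irreducible_chain S X p d Z"
  shows "d \<le> card T"
proof -
  obtain vs where vs: "set vs = T" "distinct vs" using finite_distinct_list[OF assms(1)] by auto
  obtain f where f: "separating_sequence S d Z f" "\<And>i. i < d \<Longrightarrow> f i \<in> poly_funs T"
    using ex_separating_sequence[OF assms(2-4)] by blast
  then obtain c where "\<And>i. i < d \<Longrightarrow> f i \<in> bounded_polys vs c"
    using poly_funs_bounded_uniform[of "{..<d}" f vs] vs(1) by auto
  then have "d \<le> length vs" by (rule separating_sequence_length_le[OF f(1)])
  then show ?thesis using vs distinct_card[of vs] by simp
qed

lemma local_dim_irreducible_chain:
  "local_dim S X p = (SUP d \<in> {d. \<exists>Z. irreducible_chain S X p d Z}. enat d)"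
  by (simp add: local_dim_def irreducible_chain_def)

lemma irreducible_chain_slice:
  assumes "finite T" "T \<subseteq> S" "p \<in> affine_space S"
  shows "\<exists>Z. irreducible_chain S (slice S T p) p (card T) Z"
  using assms(1,2)
proof (induction T rule: finite_induct)
  case empty
  then show ?case using irreducible_closed_slice[OF assms(3)] mem_slice[OF assms(3)]
    by (intro exI[of _ "\<lambda>_. slice S {} p"]) (simp add: irreducible_chain_def)
next
  case (insert i T)
  then obtain Z where Z: "irreducible_chain S (slice S T p) p (card T) Z" by auto
  have "p(i := p i + 1) \<in> slice S (insert i T) p" "p(i := p i + 1) \<notin> slice S T p"
    using insert assms(3) by (auto simp: slice_def affine_space_def)
  moreover have "slice S T p \<subseteq> slice S (insert i T) p" by (auto simp: slice_def)
  ultimately have "slice S T p \<subset> slice S (insert i T) p" by blast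
  then have "irreducible_chain S (slice S (insert i T) p) p (Suc (card T))
      (Z(Suc (card T) := slice S (insert i T) p))"
    by (rule irreducible_chain_extend[OF Z irreducible_closed_slice[OF assms(3)] _ mem_slice[OF assms(3)]])
  then show ?case using insert by auto
qed

lemma local_dim_affine_space:
  assumes "finite S" "T \<subseteq> S" "p \<in> affine_space T"
  shows "local_dim S (affine_space T) p = enat (card T)"
proof (rule antisym)
  have fin: "finite T" using assms finite_subset by blast
  show "local_dim S (affine_space T) p \<le> enat (card T)"
    unfolding local_dim_irreducible_chain
    using irreducible_chain_length_le[OF fin assms(2) order_refl] by (auto intro: SUP_least)
  have "\<exists>Z. irreducible_chain S (affine_space T) p (card T) Z"
    using irreducible_chain_slice[OF fin assms(2), of p] slice_eq_affine_space[OF assms(2,3)]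
      affine_space_mono[OF assms(2)] assms(3) by auto
  then show "enat (card T) \<le> local_dim S (affine_space T) p"
    unfolding local_dim_irreducible_chain by (auto intro: SUP_upper)
qed

lemma ex_irreducible_chain_if_le_local_dim:
  assumes "enat (Suc m) \<le> local_dim S X p"
  shows "\<exists>d Z. Suc m \<le> d \<and> irreducible_chain S X p d Z"
proof (rule ccontr)
  assume none: "\<not> ?thesis"
  have "enat d \<le> enat m" if "irreducible_chain S X p d Z" for d Z
    using none that by (metis enat_ord_simps(1) not_less_eq_eq)
  then have "local_dim S X p \<le> enat m"
    unfolding local_dim_irreducible_chain by (auto intro: SUP_least)
  then show False using assms order.trans by fastforce
qed

lemma eq_affine_space_if_local_dim_eq:
  assumes "finite S" "T \<subseteq> S" "X \<subseteq> affine_space T" "p \<in> X"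
    and dim: "local_dim S X p = enat (card T)"
  shows "X = affine_space T"
proof (rule ccontr)
  assume "X \<noteq> affine_space T"
  then have proper: "X \<subset> affine_space T" using assms(3) by blast
  have fin: "finite T" using assms finite_subset by blast
  have "T \<noteq> {}"
  proof
    assume "T = {}"
    then have "affine_space T = {\<lambda>_. 0}" by (auto simp: affine_space_def)
    then show False using proper assms(4) by auto
  qed
  then obtain m where m: "card T = Suc m" using fin by (metis card_0_eq not0_implies_Suc)
  obtain d Z where d: "card T \<le> d" and Z: "irreducible_chain S X p d Z"
    using ex_irreducible_chain_if_le_local_dim[of m S X p] dim m by auto
  have p: "p \<in> affine_space T" using assms(3,4) by blast
  then have "p \<in> affine_space S" using affine_space_mono[OF assms(2)] by blast
  then have "irreducible_closed S (affine_space T)"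
    using irreducible_closed_slice[of p S T] slice_eq_affine_space[OF assms(2) p] by simp
  then have "irreducible_chain S (affine_space T) p (Suc d) (Z(Suc d := affine_space T))"
    by (rule irreducible_chain_extend[OF Z _ proper p])
  then have "Suc d \<le> card T" by (rule irreducible_chain_length_le[OF fin assms(2) order_refl])
  then show False using d by simp
qed

section \<open>Tangent spaces\<close>

definition unit_fun :: "'v \<Rightarrow> 'v \<Rightarrow> complex" where
  "unit_fun i = (\<lambda>j. if j = i then 1 else 0)"

lemma subspace_affine_space: "cfun.subspace (affine_space T)"
  unfolding cfun.subspace_def by (auto simp: affine_space_def cscale_def)

lemma span_unit_fun:
  assumes "finite T" shows "cfun.span (unit_fun ` T) = affine_space T"
proof
  show "cfun.span (unit_fun ` T) \<subseteq> affine_space T"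
    by (rule cfun.span_minimal[OF _ subspace_affine_space]) (auto simp: affine_space_def unit_fun_def)
  show "affine_space T \<subseteq> cfun.span (unit_fun ` T)"
  proof
    fix x assume "x \<in> affine_space T"
    then have "x = (\<Sum>i\<in>T. cscale (x i) (unit_fun i))"
      using assms by (auto simp: fun_eq_iff sum_fun_apply cscale_def unit_fun_def affine_space_def
          if_distrib cong: if_cong)
    also have "\<dots> \<in> cfun.span (unit_fun ` T)"
      by (intro cfun.span_sum cfun.span_scale cfun.span_base) auto
    finally show "x \<in> cfun.span (unit_fun ` T)" .
  qed
qed

lemma independent_if_restricts_to_unit_fun:
  assumes "finite T" and unit: "\<And>i j. i \<in> T \<Longrightarrow> j \<in> T \<Longrightarrow> v i j = unit_fun i j"
  shows "inj_on v T \<and> cfun.independent (v ` T)"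
proof -
  have "c j = 0" if "(\<Sum>i\<in>T. cscale (c i) (v i)) = 0" "j \<in> T" for c j
  proof -
    have "0 = (\<Sum>i\<in>T. c i * v i j)"
      using fun_cong[OF that(1), of j] by (simp add: sum_fun_apply cscale_def)
    also have "\<dots> = (\<Sum>i\<in>T. if j = i then c i else 0)"
      using that(2) unit by (intro sum.cong) (auto simp: unit_fun_def)
    finally show ?thesis using that(2) assms(1) by simp
  qed
  then show ?thesis using assms(1) by (intro cfun.independent_familyI) auto
qed

lemma dim_eq_card_if_span:
  assumes "finite T" "unit_fun ` T \<subseteq> V" "V \<subseteq> affine_space T"
  shows "cfun.dim V = card T"
proof (rule cfun.dim_unique[OF assms(2)])
  note independent = independent_if_restricts_to_unit_fun[OF assms(1), of unit_fun]
  show "V \<subseteq> cfun.span (unit_fun ` T)" using assms(3) span_unit_fun[OF assms(1)] by simp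
  show "cfun.independent (unit_fun ` T)" "card (unit_fun ` T) = card T"
    using independent by (auto simp: card_image)
qed

lemma mem_tangent_space_if_line:
  assumes "v \<in> affine_space S" "\<And>t. (\<lambda>j. p j + t * v j) \<in> X"
  shows "v \<in> tangent_space S X p"
proof -
  have "((\<lambda>t. f (\<lambda>j. p j + t * v j)) has_field_derivative 0) (at 0)" if "f \<in> vanishing_ideal S X" for f
  proof -
    have "(\<lambda>t. f (\<lambda>j. p j + t * v j)) = (\<lambda>t. 0)"
      using that assms(2) by (auto simp: vanishing_ideal_def fun_eq_iff)
    then show ?thesis by simp
  qed
  then show ?thesis using assms(1) by (simp add: tangent_space_def)
qed

lemma tangent_space_subset_affine_space:
  assumes "X \<subseteq> affine_space T"
  shows "tangent_space S X p \<subseteq> affine_space T"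
proof
  fix v assume v: "v \<in> tangent_space S X p"
  have "v s = 0" if s: "s \<notin> T" for s
  proof (cases "s \<in> S")
    case True
    have "(\<lambda>x. x s) \<in> vanishing_ideal S X"
      using True s assms by (auto simp: vanishing_ideal_def affine_space_def intro: poly_funs.coord)
    then have "((\<lambda>t. p s + t * v s) has_field_derivative 0) (at 0)"
      using v unfolding tangent_space_def by fastforce
    moreover have "((\<lambda>t. p s + t * v s) has_field_derivative v s) (at 0)"
      by (auto intro!: derivative_eq_intros)
    ultimately show ?thesis by (rule DERIV_unique[symmetric])
  next
    case False
    then show ?thesis using v by (auto simp: tangent_space_def affine_space_def)
  qed
  then show "v \<in> affine_space T" by (simp add: affine_space_def)
qed

lemma dim_tangent_space:
  assumes "finite S" "T \<subseteq> S" "X \<subseteq> affine_space T"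
    and lines: "\<And>i t. i \<in> T \<Longrightarrow> (\<lambda>j. p j + t * unit_fun i j) \<in> X"
  shows "cfun.dim (tangent_space S X p) = card T"
proof (rule dim_eq_card_if_span)
  show "finite T" using assms finite_subset by blast
  show "unit_fun ` T \<subseteq> tangent_space S X p"
    using assms(2) lines by (auto intro!: mem_tangent_space_if_line simp: affine_space_def unit_fun_def)
  show "tangent_space S X p \<subseteq> affine_space T" by (rule tangent_space_subset_affine_space[OF assms(3)])
qed

lemma smooth_affine_affine_space:
  assumes "finite S" "T \<subseteq> S"
  shows "smooth_affine S (affine_space T)"
  unfolding smooth_affine_def
proof
  fix p assume p: "p \<in> affine_space T"
  then have "(\<lambda>j. p j + t * unit_fun i j) \<in> affine_space T" if "i \<in> T" for i t
    using that by (auto simp: affine_space_def unit_fun_def)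
  then show "enat (cfun.dim (tangent_space S (affine_space T) p)) = local_dim S (affine_space T) p"
    using dim_tangent_space[OF assms, of "affine_space T" p] local_dim_affine_space[OF assms p] by simp
qed

section \<open>Charts of positroid varieties\<close>

lemma ksubsetsD:
  assumes "J \<in> ksubsets n k" shows "J \<subseteq> {1..n}" "card J = k" "finite J"
  using assms by (auto simp: ksubsets_def intro: finite_subset)

lemma exchange_in_ksubsets:
  assumes "J \<in> ksubsets n k" "i \<in> J" "j \<in> {1..n} - J"
  shows "insert j (J - {i}) \<in> ksubsets n k"
  using assms ksubsetsD[OF assms(1)] card_Suc_Diff1[of J i] by (auto simp: ksubsets_def)

lemma bij_betw_nth_sorted_list_of_set:
  "finite J \<Longrightarrow> bij_betw ((!) (sorted_list_of_set J)) {..<card J} J"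
  by (rule bij_betw_nth) auto

lemma sorted_list_of_set_nth_in:
  "finite J \<Longrightarrow> r < card J \<Longrightarrow> sorted_list_of_set J ! r \<in> J"
  using bij_betwE[OF bij_betw_nth_sorted_list_of_set] by blast

lemma sorted_list_of_set_index:
  assumes "finite J" "i \<in> J" shows "\<exists>r<card J. sorted_list_of_set J ! r = i"
  using bij_betw_imp_surj_on[OF bij_betw_nth_sorted_list_of_set[OF assms(1)]] assms(2)
  by (metis imageE lessThan_iff)

definition chart_row :: "nat set \<Rightarrow> (nat \<times> nat \<Rightarrow> complex) \<Rightarrow> nat \<Rightarrow> nat \<Rightarrow> complex" where
  "chart_row J x i j = (if j \<in> J then (if j = i then 1 else 0) else x (i, j))"

definition chart_matrix :: "nat set \<Rightarrow> (nat \<times> nat \<Rightarrow> complex) \<Rightarrow> nat \<Rightarrow> nat \<Rightarrow> complex" where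
  "chart_matrix J x r = chart_row J x (sorted_list_of_set J ! r)"

lemma chart_row_neq_0D:
  "chart_row J x i j \<noteq> 0 \<Longrightarrow> j \<in> J \<and> j = i \<or> j \<notin> J \<and> x (i, j) \<noteq> 0"
  by (auto simp: chart_row_def split: if_splits)

lemma chart_matrix_image:
  assumes "finite J" shows "chart_matrix J x ` {..<card J} = chart_row J x ` J"
  using bij_betw_imp_surj_on[OF bij_betw_nth_sorted_list_of_set[OF assms]]
  unfolding chart_matrix_def image_image[symmetric] by simp

lemma chart_point_eq: "chart_point J x = cfun.span (chart_row J x ` J)"
  unfolding chart_point_def chart_row_def by simp

lemma independent_chart_row:
  "finite J \<Longrightarrow> inj_on (chart_row J x) J \<and> cfun.independent (chart_row J x ` J)"
  by (rule independent_if_restricts_to_unit_fun) (auto simp: chart_row_def unit_fun_def)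

lemma inj_on_chart_matrix: "finite J \<Longrightarrow> inj_on (chart_matrix J x) {..<card J}"
  using comp_inj_on[of "(!) (sorted_list_of_set J)" "{..<card J}" "chart_row J x"]
    independent_chart_row bij_betw_nth_sorted_list_of_set[of J]
  by (simp add: bij_betw_def chart_matrix_def[abs_def] comp_def)

lemma chart_point_in_grassmannian:
  assumes J: "J \<in> ksubsets n k" and x: "x \<in> affine_space (chart_index n J)"
  shows "chart_point J x \<in> grassmannian n k"
proof -
  have "chart_row J x ` J \<subseteq> affine_space {1..n}"
    using J x by (auto simp: affine_space_def chart_row_def ksubsets_def chart_index_def)
  then have "chart_point J x \<subseteq> affine_space {1..n}"
    unfolding chart_point_eq by (intro cfun.span_minimal subspace_affine_space)
  moreover have "cfun.dim (chart_point J x) = k"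
    using independent_chart_row[OF ksubsetsD(3)[OF J], of x] ksubsetsD(2)[OF J]
    by (simp add: chart_point_eq cfun.dim_eq_card_independent card_image)
  ultimately show ?thesis by (simp add: grassmannian_def chart_point_eq)
qed

lemma plucker_eq_0_if_in_span:
  assumes "finite J" "card J = k"
    and A: "\<And>r. r < k \<Longrightarrow> A r \<in> chart_point J x" and zero: "plucker k (chart_matrix J x) I = 0"
  shows "plucker k A I = 0"
proof -
  have "\<exists>g. A r = (\<Sum>s<k. cscale (g s) (chart_matrix J x s))" if r: "r < k" for r
  proof -
    have "A r \<in> cfun.span (chart_matrix J x ` {..<k})"
      using A[OF r] assms(1,2) chart_matrix_image[of J x] by (simp add: chart_point_eq)
    then obtain u where "A r = (\<Sum>v\<in>chart_matrix J x ` {..<k}. cscale (u v) v)"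
      by (auto simp: cfun.span_finite)
    then have "A r = (\<Sum>s<k. cscale (u (chart_matrix J x s)) (chart_matrix J x s))"
      using inj_on_chart_matrix[OF assms(1), of x] assms(2) by (simp add: sum.reindex)
    then show ?thesis by (rule exI[of _ "\<lambda>s. u (chart_matrix J x s)"])
  qed
  then obtain g where g: "\<And>r. r < k \<Longrightarrow> A r = (\<Sum>s<k. cscale (g r s) (chart_matrix J x s))" by metis
  let ?B = "mat k k (\<lambda>(r, c). chart_matrix J x r (sorted_list_of_set I ! c))"
  have "mat k k (\<lambda>(r, c). A r (sorted_list_of_set I ! c)) = mat k k (\<lambda>(r, s). g r s) * ?B"
    by (rule eq_matI)
       (auto simp: g sum_fun_apply cscale_def scalar_prod_def lessThan_atLeast0)
  then show ?thesis using zero det_mult[of "mat k k (\<lambda>(r, s). g r s)" k ?B] by (simp add: plucker_def)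
qed

lemma chart_point_in_variety_iff:
  assumes J: "J \<in> ksubsets n k" and x: "x \<in> affine_space (chart_index n J)"
  shows "chart_point J x \<in> positroid_variety n k M \<longleftrightarrow>
    (\<forall>I \<in> ksubsets n k - M. plucker k (chart_matrix J x) I = 0)"
proof -
  note J' = ksubsetsD[OF J]
  have span: "cfun.span (chart_matrix J x ` {..<k}) = chart_point J x"
    using chart_matrix_image[OF J'(3), of x] J'(2) by (simp add: chart_point_eq)
  have "plucker k A I = 0" if "plucker k (chart_matrix J x) I = 0"
    "cfun.span (A ` {..<k}) = chart_point J x" for A I
    using plucker_eq_0_if_in_span[OF J'(3,2) _ that(1), of A] that(2)
      cfun.span_base[of _ "A ` {..<k}"] by auto
  then show ?thesis using chart_point_in_grassmannian[OF J x] span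
    unfolding positroid_variety_def by blast
qed

lemma transversal_if_plucker_neq_0:
  assumes "plucker k A I \<noteq> 0"
  shows "\<exists>p. p permutes {..<k} \<and> (\<forall>r<k. A r (sorted_list_of_set I ! p r) \<noteq> 0)"
proof (rule ccontr)
  assume none: "\<not> ?thesis"
  let ?A = "mat k k (\<lambda>(r, c). A r (sorted_list_of_set I ! c))"
  have "plucker k A I = 0"
    unfolding plucker_def det_def'[OF mat_carrier]
  proof (rule sum.neutral, clarify)
    fix p assume p: "p permutes {0..<k}"
    then obtain r where r: "r < k" "A r (sorted_list_of_set I ! p r) = 0"
      using none by (auto simp: lessThan_atLeast0)
    then have "?A $$ (r, p r) = 0" using permutes_in_image[OF p, of r] by simp
    then have "(\<Prod>r=0..<k. ?A $$ (r, p r)) = 0" using r(1) by (intro prod_zero) auto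
    then show "signof p * (\<Prod>r=0..<k. ?A $$ (r, p r)) = 0" by simp
  qed
  then show False using assms by simp
qed

lemma matching_if_plucker_neq_0:
  assumes J: "J \<in> ksubsets n k" and I: "I \<in> ksubsets n k"
    and nonzero: "plucker k (chart_matrix J x) I \<noteq> 0"
  shows "\<exists>\<sigma>. bij_betw \<sigma> (J - I) (I - J) \<and> (\<forall>i\<in>J - I. x (i, \<sigma> i) \<noteq> 0)"
proof -
  note J' = ksubsetsD[OF J] and I' = ksubsetsD[OF I]
  obtain p where p: "p permutes {..<k}"
    and nonzero: "\<And>r. r < k \<Longrightarrow> chart_matrix J x r (sorted_list_of_set I ! p r) \<noteq> 0"
    using transversal_if_plucker_neq_0[OF nonzero] by blast
  define pos where "pos = inv_into {..<k} ((!) (sorted_list_of_set J))"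
  define \<sigma> where "\<sigma> = (!) (sorted_list_of_set I) \<circ> (p \<circ> pos)"
  have pos: "bij_betw pos J {..<k}"
    unfolding pos_def using bij_betw_nth_sorted_list_of_set[OF J'(3)] J'(2) by (auto intro: bij_betw_inv_into)
  have \<sigma>: "bij_betw \<sigma> J I"
    unfolding \<sigma>_def
    by (intro bij_betw_trans[OF bij_betw_trans[OF pos permutes_imp_bij[OF p]]])
      (use bij_betw_nth_sorted_list_of_set[OF I'(3)] I'(2) in simp)
  have row: "chart_row J x i (\<sigma> i) \<noteq> 0" if "i \<in> J" for i
  proof -
    have "pos i < k" using bij_betwE[OF pos] that by simp
    moreover have "sorted_list_of_set J ! pos i = i"
      unfolding pos_def using bij_betw_nth_sorted_list_of_set[OF J'(3)] that J'(2)
      by (intro f_inv_into_f) (simp add: bij_betw_def)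
    ultimately show ?thesis using nonzero[of "pos i"] by (simp add: chart_matrix_def \<sigma>_def)
  qed
  have matched: "\<sigma> i \<in> I - J \<and> x (i, \<sigma> i) \<noteq> 0" if "i \<in> J - I" for i
    using chart_row_neq_0D[OF row, of i] bij_betwE[OF \<sigma>] that by fastforce
  have "card (J - I) = card (I - J)"
    using J'(2,3) I'(2,3) by (metis card_Diff_subset_Int Int_commute finite_Int)
  moreover have "inj_on \<sigma> (J - I)" using \<sigma> by (auto simp: bij_betw_def intro: inj_on_subset)
  ultimately have "bij_betw \<sigma> (J - I) (I - J)"
    unfolding bij_betw_def using matched I'(3)
    by (metis (no_types, lifting) card_image card_subset_eq finite_Diff image_subsetI)
  then show ?thesis using matched by blast
qed

lemma kernel_vector_if_plucker_eq_0:
  assumes "plucker k A I = 0" "finite I" "card I = k"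
  shows "\<exists>v. (\<exists>j\<in>I. v j \<noteq> 0) \<and> (\<forall>r<k. (\<Sum>j\<in>I. A r j * v j) = 0)"
proof -
  let ?I = "(!) (sorted_list_of_set I)" and ?A = "mat k k (\<lambda>(r, c). A r (sorted_list_of_set I ! c))"
  obtain u where u: "u \<in> carrier_vec k" "u \<noteq> 0\<^sub>v k" "?A *\<^sub>v u = 0\<^sub>v k"
    using assms(1) det_0_iff_vec_prod_zero[of ?A k] by (auto simp: plucker_def)
  have bij: "bij_betw ?I {..<k} I" using bij_betw_nth_sorted_list_of_set[OF assms(2)] assms(3) by simp
  define v where "v j = u $ inv_into {..<k} ?I j" for j
  have v: "v (?I c) = u $ c" if "c < k" for c
    using that bij by (simp add: v_def bij_betw_def)
  obtain c where "c < k" "u $ c \<noteq> 0" using u(1,2) by (metis carrier_vecD eq_vecI index_zero_vec(1,2))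
  then have "\<exists>j\<in>I. v j \<noteq> 0" using v bij_betwE[OF bij] by (metis lessThan_iff)
  moreover have "(\<Sum>j\<in>I. A r j * v j) = 0" if r: "r < k" for r
  proof -
    have "(\<Sum>j\<in>I. A r j * v j) = (\<Sum>c<k. A r (?I c) * v (?I c))"
      by (rule sum.reindex_bij_betw[OF bij, symmetric])
    also have "\<dots> = (?A *\<^sub>v u) $ r"
      using r u(1) by (simp add: scalar_prod_def lessThan_atLeast0 v)
    finally show ?thesis using u(3) r by simp
  qed
  ultimately show ?thesis by blast
qed

lemma plucker_neq_0_if_unique_matching:
  assumes J: "J \<in> ksubsets n k" and I: "I \<in> ksubsets n k"
    and \<sigma>: "bij_betw \<sigma> (J - I) (I - J)" "\<And>i. i \<in> J - I \<Longrightarrow> x (i, \<sigma> i) \<noteq> 0"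
    and unique: "\<And>i j. i \<in> J - I \<Longrightarrow> j \<in> I - J \<Longrightarrow> j \<noteq> \<sigma> i \<Longrightarrow> x (i, j) = 0"
  shows "plucker k (chart_matrix J x) I \<noteq> 0"
proof
  note J' = ksubsetsD[OF J] and I' = ksubsetsD[OF I]
  assume "plucker k (chart_matrix J x) I = 0"
  then obtain v where v: "\<exists>j\<in>I. v j \<noteq> 0"
    and kernel: "\<And>r. r < k \<Longrightarrow> (\<Sum>j\<in>I. chart_matrix J x r j * v j) = 0"
    using kernel_vector_if_plucker_eq_0 I' by blast
  have row: "(\<Sum>j\<in>I. chart_row J x i j * v j) = 0" if i: "i \<in> J" for i
    using sorted_list_of_set_index[OF J'(3) i] J'(2) kernel by (auto simp: chart_matrix_def)
  have single_term: "chart_row J x i j * v j = 0"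
    if "i \<in> J" "j \<in> I" "\<And>j'. j' \<in> I \<Longrightarrow> j' \<noteq> j \<Longrightarrow> chart_row J x i j' * v j' = 0" for i j
  proof -
    have "(\<Sum>j\<in>I. chart_row J x i j * v j) = (\<Sum>j\<in>{j}. chart_row J x i j * v j)"
      using that I'(3) by (intro sum.mono_neutral_right) auto
    then show ?thesis using row[OF that(1)] by simp
  qed
  have outside: "v j = 0" if j: "j \<in> I - J" for j
  proof -
    obtain i where i: "i \<in> J - I" "\<sigma> i = j"
      using \<sigma>(1) j by (metis bij_betw_imp_surj_on imageE)
    have "chart_row J x i j * v j = 0"
      by (rule single_term) (use i j unique in \<open>auto simp: chart_row_def\<close>)
    then show ?thesis using \<sigma>(2)[OF i(1)] i j by (simp add: chart_row_def)
  qed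
  have "v j = 0" if j: "j \<in> I \<inter> J" for j
  proof -
    have "chart_row J x j j * v j = 0"
      by (rule single_term) (use j outside in \<open>auto simp: chart_row_def\<close>)
    then show ?thesis using j by (simp add: chart_row_def)
  qed
  then show False using v outside by blast
qed

definition exchange_edges :: "nat \<Rightarrow> nat set set \<Rightarrow> nat set \<Rightarrow> (nat \<times> nat) set" where
  "exchange_edges n M J = {(i, j) \<in> chart_index n J. insert j (J - {i}) \<in> M}"

lemma exchange_edges_subset: "exchange_edges n M J \<subseteq> chart_index n J"
  by (auto simp: exchange_edges_def)

lemma exchange_edgesD:
  assumes "(i, j) \<in> exchange_edges n M J"
  shows "i \<in> J" "j \<in> {1..n} - J" "insert j (J - {i}) \<in> M"
  using assms by (auto simp: exchange_edges_def chart_index_def)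

lemma exchange_edgesI:
  "i \<in> J \<Longrightarrow> j \<in> {1..n} - J \<Longrightarrow> insert j (J - {i}) \<in> M \<Longrightarrow> (i, j) \<in> exchange_edges n M J"
  by (simp add: exchange_edges_def chart_index_def)

lemma finite_chart_index: "J \<in> ksubsets n k \<Longrightarrow> finite (chart_index n J)"
  by (simp add: chart_index_def ksubsetsD)

lemma card_chart_index:
  "J \<in> ksubsets n k \<Longrightarrow> card (chart_index n J) = k * (n - k)"
  using ksubsetsD[of J n k] by (simp add: chart_index_def card_cartesian_product card_Diff_subset)

definition chart_variety :: "nat \<Rightarrow> nat \<Rightarrow> nat set set \<Rightarrow> nat set \<Rightarrow> (nat \<times> nat \<Rightarrow> complex) set" where
  "chart_variety n k M J =
     {x \<in> affine_space (chart_index n J). chart_point J x \<in> positroid_variety n k M}"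

lemma smooth_positroid_variety_iff:
  "smooth_in_grassmannian n k (positroid_variety n k M) \<longleftrightarrow>
    (\<forall>J \<in> ksubsets n k. smooth_affine (chart_index n J) (chart_variety n k M J))"
  by (simp add: smooth_in_grassmannian_def chart_variety_def)

lemma mem_chart_variety_iff:
  assumes "J \<in> ksubsets n k"
  shows "x \<in> chart_variety n k M J \<longleftrightarrow> x \<in> affine_space (chart_index n J) \<and>
    (\<forall>I \<in> ksubsets n k - M. plucker k (chart_matrix J x) I = 0)"
  using chart_point_in_variety_iff[OF assms] by (auto simp: chart_variety_def)

lemma chart_variety_subset:
  assumes J: "J \<in> ksubsets n k"
  shows "chart_variety n k M J \<subseteq> affine_space (exchange_edges n M J)"
proof
  fix x assume x: "x \<in> chart_variety n k M J"
  have "x (i, j) = 0" if ij: "(i, j) \<notin> exchange_edges n M J" for i j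
  proof (rule ccontr)
    assume nonzero: "x (i, j) \<noteq> 0"
    then have i: "i \<in> J" "j \<in> {1..n} - J"
      using x by (auto simp: mem_chart_variety_iff[OF J] affine_space_def chart_index_def)
    let ?I = "insert j (J - {i})"
    have I: "?I \<in> ksubsets n k - M"
      using exchange_in_ksubsets[OF J i] ij i by (auto simp: exchange_edges_def chart_index_def)
    have sets: "J - ?I = {i}" "?I - J = {j}" using i by auto
    have "plucker k (chart_matrix J x) ?I \<noteq> 0"
    proof (rule plucker_neq_0_if_unique_matching[OF J, where \<sigma> = "\<lambda>_. j"])
      show "?I \<in> ksubsets n k" using I by simp
    qed (use sets nonzero in \<open>auto simp: bij_betw_def\<close>)
    then show False using x I by (simp add: mem_chart_variety_iff[OF J])
  qed
  then show "x \<in> affine_space (exchange_edges n M J)" by (auto simp: affine_space_def)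
qed

lemma chart_variety_empty:
  assumes "J \<in> ksubsets n k" "J \<notin> M"
  shows "chart_variety n k M J = {}"
proof -
  have "plucker k (chart_matrix J x) J \<noteq> 0" for x
    by (rule plucker_neq_0_if_unique_matching[OF assms(1,1), where \<sigma> = id]) auto
  then show ?thesis using assms mem_chart_variety_iff[OF assms(1)] by blast
qed

lemma chart_variety_eq_if_matching_closed:
  assumes J: "J \<in> ksubsets n k"
    and closed: "\<And>I \<sigma>. I \<in> ksubsets n k \<Longrightarrow> bij_betw \<sigma> (J - I) (I - J) \<Longrightarrow>
       (\<And>i. i \<in> J - I \<Longrightarrow> insert (\<sigma> i) (J - {i}) \<in> M) \<Longrightarrow> I \<in> M"
  shows "chart_variety n k M J = affine_space (exchange_edges n M J)"
proof (rule antisym[OF chart_variety_subset[OF J]], rule subsetI)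
  fix x assume x: "x \<in> affine_space (exchange_edges n M J)"
  have "plucker k (chart_matrix J x) I = 0" if I: "I \<in> ksubsets n k - M" for I
  proof (rule ccontr)
    assume "plucker k (chart_matrix J x) I \<noteq> 0"
    then obtain \<sigma> where "bij_betw \<sigma> (J - I) (I - J)" "\<forall>i\<in>J - I. x (i, \<sigma> i) \<noteq> 0"
      using matching_if_plucker_neq_0[OF J] I by blast
    then have "I \<in> M"
      using closed[of I \<sigma>] I x by (auto simp: affine_space_def exchange_edges_def)
    then show False using I by simp
  qed
  then show "x \<in> chart_variety n k M J"
    using x affine_space_mono[OF exchange_edges_subset] mem_chart_variety_iff[OF J] by blast
qed

lemma smooth_if_matching_closed:
  assumes closed: "\<And>J I \<sigma>. J \<in> M \<Longrightarrow> I \<in> ksubsets n k \<Longrightarrow> bij_betw \<sigma> (J - I) (I - J) \<Longrightarrow>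
       (\<And>i. i \<in> J - I \<Longrightarrow> insert (\<sigma> i) (J - {i}) \<in> M) \<Longrightarrow> I \<in> M"
  shows "smooth_in_grassmannian n k (positroid_variety n k M)"
  unfolding smooth_positroid_variety_iff
proof
  fix J assume J: "J \<in> ksubsets n k"
  show "smooth_affine (chart_index n J) (chart_variety n k M J)"
  proof (cases "J \<in> M")
    case True
    then have "chart_variety n k M J = affine_space (exchange_edges n M J)"
      using closed by (intro chart_variety_eq_if_matching_closed[OF J]) blast
    then show ?thesis
      using smooth_affine_affine_space[OF finite_chart_index[OF J] exchange_edges_subset] by simp
  next
    case False
    then show ?thesis using chart_variety_empty[OF J] by (simp add: smooth_affine_def)
  qed
qed

lemma coordinate_axis_in_chart_variety:
  assumes J: "J \<in> ksubsets n k" "J \<in> M" and e: "e \<in> exchange_edges n M J"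
  shows "(\<lambda>s. 0 + t * unit_fun e s) \<in> chart_variety n k M J"
  unfolding mem_chart_variety_iff[OF J(1)]
proof (intro conjI ballI)
  let ?x = "\<lambda>s. 0 + t * unit_fun e s"
  obtain a b where ab: "e = (a, b)" by (cases e)
  show "?x \<in> affine_space (chart_index n J)"
    using e exchange_edges_subset[of n M J] by (auto simp: affine_space_def unit_fun_def)
  fix I assume I: "I \<in> ksubsets n k - M"
  show "plucker k (chart_matrix J ?x) I = 0"
  proof (rule ccontr)
    assume "plucker k (chart_matrix J ?x) I \<noteq> 0"
    then obtain \<sigma> where \<sigma>: "bij_betw \<sigma> (J - I) (I - J)" "\<forall>i\<in>J - I. ?x (i, \<sigma> i) \<noteq> 0"
      using matching_if_plucker_neq_0[OF J(1)] I by blast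
    have "J - I \<subseteq> {a}" "\<And>i. i \<in> J - I \<Longrightarrow> \<sigma> i = b"
      using \<sigma>(2) ab by (auto simp: unit_fun_def split: if_splits)
    then consider "J - I = {}" "I - J = {}" | "J - I = {a}" "I - J = {b}"
      using \<sigma>(1) by (cases "J - I = {}") (auto simp: bij_betw_def)
    then have "I = J \<or> I = insert b (J - {a})" by cases blast+
    then show False using I J(2) e ab by (auto simp: exchange_edges_def)
  qed
qed

lemma chart_variety_eq_if_smooth:
  assumes J: "J \<in> ksubsets n k" "J \<in> M" and e: "e \<in> exchange_edges n M J"
    and smooth: "smooth_in_grassmannian n k (positroid_variety n k M)"
  shows "chart_variety n k M J = affine_space (exchange_edges n M J)"
proof (rule eq_affine_space_if_local_dim_eq)
  let ?S = "chart_index n J" and ?X = "chart_variety n k M J"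
  show "finite ?S" "exchange_edges n M J \<subseteq> ?S" "?X \<subseteq> affine_space (exchange_edges n M J)"
    by (fact finite_chart_index[OF J(1)] exchange_edges_subset chart_variety_subset[OF J(1)])+
  note axes = coordinate_axis_in_chart_variety[OF J]
  show origin: "(\<lambda>s. 0) \<in> ?X" using axes[OF e, of 0] by simp
  have "smooth_affine ?S ?X" using smooth J(1) by (simp add: smooth_positroid_variety_iff)
  then show "local_dim ?S ?X (\<lambda>s. 0) = enat (card (exchange_edges n M J))"
    using dim_tangent_space[OF finite_chart_index[OF J(1)] exchange_edges_subset
        chart_variety_subset[OF J(1)] axes] origin by (metis smooth_affine_def)
qed

lemma double_exchange_in_ksubsets:
  assumes J: "J \<in> ksubsets n k" and "i \<in> J" "i' \<in> J" "i \<noteq> i'" "j \<in> {1..n} - J" "j' \<in> {1..n} - J" "j \<noteq> j'"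
  shows "insert j (insert j' (J - {i, i'})) \<in> ksubsets n k"
proof -
  have "insert j' (J - {i'}) \<in> ksubsets n k" using assms by (intro exchange_in_ksubsets) auto
  then have "insert j (insert j' (J - {i'}) - {i}) \<in> ksubsets n k"
    using assms by (intro exchange_in_ksubsets) auto
  moreover have "insert j' (J - {i'}) - {i} = insert j' (J - {i, i'})" using assms by auto
  ultimately show ?thesis by simp
qed

lemma double_exchange_if_smooth:
  assumes M: "M \<subseteq> ksubsets n k"
    and smooth: "smooth_in_grassmannian n k (positroid_variety n k M)"
    and J: "J \<in> M" and i: "i \<noteq> i'" and j: "j \<noteq> j'"
    and edges: "(i, j) \<in> exchange_edges n M J" "(i', j') \<in> exchange_edges n M J"
  shows "insert j (insert j' (J - {i, i'})) \<in> M"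
proof (rule ccontr)
  let ?I = "insert j (insert j' (J - {i, i'}))" and ?\<sigma> = "\<lambda>a. if a = i then j else j'"
  assume notin: "?I \<notin> M"
  have Jk: "J \<in> ksubsets n k" using M J by auto
  note e = exchange_edgesD(1,2)[OF edges(1)] exchange_edgesD(1,2)[OF edges(2)]
  define x :: "nat \<times> nat \<Rightarrow> complex" where "x = (\<lambda>s. if s = (i, j) \<or> s = (i', j') then 1 else 0)"
  have "x \<in> affine_space (exchange_edges n M J)" using edges by (auto simp: x_def affine_space_def)
  then have x: "x \<in> chart_variety n k M J"
    using chart_variety_eq_if_smooth[OF Jk J edges(1) smooth] by simp
  have I: "?I \<in> ksubsets n k" using e i j by (intro double_exchange_in_ksubsets[OF Jk]) auto
  have sets: "J - ?I = {i, i'}" "?I - J = {j, j'}" using e by auto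
  have "plucker k (chart_matrix J x) ?I \<noteq> 0"
  proof (rule plucker_neq_0_if_unique_matching[OF Jk I, where \<sigma> = ?\<sigma>])
    show "bij_betw ?\<sigma> (J - ?I) (?I - J)"
      unfolding sets using i j by (auto simp: bij_betw_def inj_on_def)
  qed (use i in \<open>auto simp only: sets x_def one_neq_zero split: if_splits\<close>)
  then show False using notin I x by (simp add: mem_chart_variety_iff[OF Jk])
qed

section \<open>Ranks in finite sets\<close>

definition rank_in :: "'a::linorder set \<Rightarrow> 'a \<Rightarrow> nat" where
  "rank_in S x = card {y \<in> S. y < x}"

lemma sorted_list_of_set_nth_less_iff:
  fixes S :: "'a::linorder set"
  assumes "i < card S" "j < card S"
  shows "sorted_list_of_set S ! i < sorted_list_of_set S ! j \<longleftrightarrow> i < j"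
proof -
  have "sorted_list_of_set S ! i < sorted_list_of_set S ! j" if "i < j" "j < card S" for i j
    using sorted_wrt_nth_less[OF strict_sorted_list_of_set that(1)] that(2) by simp
  then show ?thesis using assms by (metis linorder_neqE_nat order_less_asym order_less_irrefl)
qed

lemma rank_in_nth:
  assumes "finite S" "i < card S" shows "rank_in S (sorted_list_of_set S ! i) = i"
proof -
  let ?nth = "(!) (sorted_list_of_set S)"
  have bij: "bij_betw ?nth {..<card S} S" by (rule bij_betw_nth_sorted_list_of_set[OF assms(1)])
  have "{y \<in> S. y < ?nth i} = ?nth ` {..<i}"
  proof (intro equalityI subsetI)
    fix y assume y: "y \<in> {y \<in> S. y < ?nth i}"
    then obtain j where "j < card S" "y = ?nth j"
      using bij by (auto simp: bij_betw_def image_iff)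
    then show "y \<in> ?nth ` {..<i}" using y sorted_list_of_set_nth_less_iff assms(2) by auto
  next
    fix y assume "y \<in> ?nth ` {..<i}"
    then obtain j where "j < i" "y = ?nth j" by auto
    then show "y \<in> {y \<in> S. y < ?nth i}"
      using sorted_list_of_set_nth_less_iff[of j S i] bij_betwE[OF bij] assms(2) by auto
  qed
  moreover have "inj_on ?nth {..<i}"
    using bij assms(2) by (auto simp: bij_betw_def intro: inj_on_subset)
  ultimately show ?thesis by (simp add: rank_in_def card_image)
qed

lemma rank_in_less_card: "finite S \<Longrightarrow> x \<in> S \<Longrightarrow> rank_in S x < card S"
  unfolding rank_in_def by (intro psubset_card_mono) auto

lemma nth_rank_in: "finite S \<Longrightarrow> x \<in> S \<Longrightarrow> sorted_list_of_set S ! rank_in S x = x"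
  using sorted_list_of_set_index[of S x] rank_in_nth[of S] by auto

lemma rank_in_less_iff:
  assumes "finite S" "x \<in> S" "y \<in> S" shows "rank_in S x < rank_in S y \<longleftrightarrow> x < y"
  using sorted_list_of_set_nth_less_iff[of "rank_in S x" S "rank_in S y"] assms
  by (simp add: rank_in_less_card nth_rank_in)

lemma rank_in_eq_iff:
  assumes "finite S" "x \<in> S" "y \<in> S" shows "rank_in S x = rank_in S y \<longleftrightarrow> x = y"
  using nth_rank_in[OF assms(1,2)] nth_rank_in[OF assms(1,3)] by metis

lemma sorted_list_of_set_nth_le_iff:
  fixes S :: "'a::linorder set"
  assumes "finite S" "i < card S"
  shows "sorted_list_of_set S ! i \<le> b \<longleftrightarrow> i < card {x \<in> S. x \<le> b}"
proof -
  let ?x = "sorted_list_of_set S ! i"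
  have i: "i = card {x \<in> S. x < ?x}" using rank_in_nth[OF assms] by (simp add: rank_in_def)
  have "?x \<in> S" by (rule sorted_list_of_set_nth_in[OF assms])
  show ?thesis
  proof
    assume "?x \<le> b"
    then have "{x \<in> S. x < ?x} \<subset> {x \<in> S. x \<le> b}" using \<open>?x \<in> S\<close> by force
    then have "card {x \<in> S. x < ?x} < card {x \<in> S. x \<le> b}"
      using assms(1) by (intro psubset_card_mono) auto
    then show "i < card {x \<in> S. x \<le> b}" using i by linarith
  next
    assume "i < card {x \<in> S. x \<le> b}"
    moreover have "card {x \<in> S. x \<le> b} \<le> card {x \<in> S. x < ?x}" if "\<not> ?x \<le> b"
      using assms(1) that by (intro card_mono) auto
    ultimately show "?x \<le> b" using i by (metis not_le)
  qed
qed

lemma list_all2_le_sorted_list_of_set_iff: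
  fixes P Q :: "'a::linorder set"
  assumes "finite P" "finite Q"
  shows "list_all2 (\<le>) (sorted_list_of_set P) (sorted_list_of_set Q) \<longleftrightarrow>
    card P = card Q \<and> (\<forall>b. card {x \<in> Q. x \<le> b} \<le> card {x \<in> P. x \<le> b})"
  (is "?L \<longleftrightarrow> ?R")
proof
  assume L: ?L
  have card_eq: "card P = card Q" using list_all2_lengthD[OF L] by simp
  have nth_le: "sorted_list_of_set P ! i \<le> sorted_list_of_set Q ! i" if "i < card Q" for i
    using list_all2_nthD[OF L] that card_eq by simp
  have "card {x \<in> Q. x \<le> b} \<le> card {x \<in> P. x \<le> b}" for b
  proof (cases "card {x \<in> Q. x \<le> b}")
    case (Suc c)
    then have c: "c < card Q" using card_mono[of Q "{x \<in> Q. x \<le> b}"] assms by auto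
    then have "sorted_list_of_set Q ! c \<le> b"
      using sorted_list_of_set_nth_le_iff[OF assms(2) c] Suc by simp
    then have "sorted_list_of_set P ! c \<le> b" using nth_le[OF c] by simp
    then show ?thesis using sorted_list_of_set_nth_le_iff[OF assms(1)] c card_eq Suc by simp
  next
    case 0
    show ?thesis unfolding 0 by (rule le0)
  qed
  then show ?R using card_eq by blast
next
  assume R: ?R
  have "sorted_list_of_set P ! i \<le> sorted_list_of_set Q ! i" if i: "i < card P" for i
  proof -
    have "i < card {x \<in> Q. x \<le> sorted_list_of_set Q ! i}"
      using sorted_list_of_set_nth_le_iff[OF assms(2), of i "sorted_list_of_set Q ! i"] i R by simp
    then show ?thesis using sorted_list_of_set_nth_le_iff[OF assms(1) i] R by (meson less_le_trans)
  qed
  then show ?L using R by (auto simp: list_all2_conv_all_nth)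
qed

lemma (in linorder) map_sorted_key_list_of_set:
  assumes "inj_on f A" "finite A"
  shows "map f (sorted_key_list_of_set f A) = sorted_list_of_set (f ` A)"
proof -
  interpret folding_insort_key "(\<le>)" "(<)" A f by unfold_locales (rule assms(1))
  show ?thesis using assms(2) by (intro sorted_distinct_set_unique) auto
qed

section \<open>Cyclic orders and the Gale order\<close>

lemma cyc_pos_eq:
  assumes "r \<in> {1..n}" "x \<in> {1..n}"
  shows "cyc_pos n r x = (if r \<le> x then x - r else x + n - r)"
proof (cases "r \<le> x")
  case True
  then have "cyc_pos n r x = (x - r + n) mod n" by (simp add: cyc_pos_def)
  also have "\<dots> = x - r" using assms by (simp only: mod_add_self2) auto
  finally show ?thesis using True by simp
qed (use assms in \<open>auto simp: cyc_pos_def\<close>)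

lemma cyc_pos_less: "r \<in> {1..n} \<Longrightarrow> x \<in> {1..n} \<Longrightarrow> cyc_pos n r x < n"
  by (auto simp: cyc_pos_eq)

lemma cyc_pos_self: "cyc_pos n r r = 0"
  by (cases "n = 0") (auto simp: cyc_pos_def)

lemma cyc_pos_eq_iff: "r \<in> {1..n} \<Longrightarrow> x \<in> {1..n} \<Longrightarrow> y \<in> {1..n} \<Longrightarrow>
    cyc_pos n r x = cyc_pos n r y \<longleftrightarrow> x = y"
  by (auto simp: cyc_pos_eq split: if_splits)

lemma bij_betw_cyc_pos:
  assumes "r \<in> {1..n}" shows "bij_betw (cyc_pos n r) {1..n} {..<n}"
proof -
  have inj: "inj_on (cyc_pos n r) {1..n}" using assms by (auto simp: inj_on_def cyc_pos_eq_iff)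
  moreover have "cyc_pos n r ` {1..n} \<subseteq> {..<n}" using assms cyc_pos_less by auto
  ultimately have "cyc_pos n r ` {1..n} = {..<n}"
    by (intro card_subset_eq) (auto simp: card_image)
  then show ?thesis using inj by (simp add: bij_betw_def)
qed

lemma cyc_pos_less_iff:
  assumes "r \<in> {1..n}" "x \<in> {1..n}" "y \<in> {1..n}"
  shows "cyc_pos n r x < cyc_pos n r y \<longleftrightarrow> (if (r \<le> x) = (r \<le> y) then x < y else r \<le> x)"
  using assms by (auto simp: cyc_pos_eq)

lemma cyc_pos_change:
  assumes "r \<in> {1..n}" "r' \<in> {1..n}" "x \<in> {1..n}"
  shows "cyc_pos n r' x = (if cyc_pos n r r' \<le> cyc_pos n r x then cyc_pos n r x - cyc_pos n r r'
    else cyc_pos n r x + n - cyc_pos n r r')"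
  using assms by (auto simp: cyc_pos_eq split: if_splits)

lemma clockwise_cyc_pos:
  assumes "r \<in> {1..n}" "x \<in> {1..n}" "y \<in> {1..n}" "z \<in> {1..n}"
  shows "clockwise (cyc_pos n r x) (cyc_pos n r y) (cyc_pos n r z) \<longleftrightarrow> clockwise x y z"
  unfolding clockwise_def cyc_pos_less_iff[OF assms(1,2,3)] cyc_pos_less_iff[OF assms(1,3,4)]
    cyc_pos_less_iff[OF assms(1,4,2)]
  by (cases "r \<le> x"; cases "r \<le> y"; cases "r \<le> z"; simp; linarith)

definition cyc_succ :: "nat \<Rightarrow> nat \<Rightarrow> nat" where
  "cyc_succ n r = (if r = n then 1 else Suc r)"

lemma cyc_succ_mem: "r \<in> {1..n} \<Longrightarrow> cyc_succ n r \<in> {1..n}"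
  by (auto simp: cyc_succ_def)

lemma cyc_pos_cyc_succ_self: "r \<in> {1..n} \<Longrightarrow> cyc_pos n (cyc_succ n r) r = n - 1"
  using cyc_pos_eq[OF cyc_succ_mem, of r n r] by (auto simp: cyc_succ_def)

lemma cyc_pos_cyc_succ:
  "r \<in> {1..n} \<Longrightarrow> x \<in> {1..n} \<Longrightarrow> x \<noteq> r \<Longrightarrow> cyc_pos n r x = Suc (cyc_pos n (cyc_succ n r) x)"
  using cyc_pos_eq[OF cyc_succ_mem, of r n x] by (auto simp: cyc_pos_eq cyc_succ_def split: if_splits)

definition cyc_prefix :: "nat \<Rightarrow> nat \<Rightarrow> nat \<Rightarrow> nat set" where
  "cyc_prefix n r b = {x \<in> {1..n}. cyc_pos n r x \<le> b}"

lemma mem_cyc_prefix_iff: "x \<in> cyc_prefix n r b \<longleftrightarrow> x \<in> {1..n} \<and> cyc_pos n r x \<le> b"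
  by (simp add: cyc_prefix_def)

lemma cyc_prefix_subset: "cyc_prefix n r b \<subseteq> {1..n}"
  by (auto simp: cyc_prefix_def)

lemma finite_cyc_prefix [simp]: "finite (cyc_prefix n r b)"
  by (simp add: cyc_prefix_def)

lemma cyc_prefix_eq_all: "r \<in> {1..n} \<Longrightarrow> n \<le> Suc b \<Longrightarrow> cyc_prefix n r b = {1..n}"
  using cyc_pos_less[of r n] by (force simp: cyc_prefix_def)

lemma cyc_prefix_complement:
  assumes "r \<in> {1..n}" "Suc b < n"
  obtains r' b' where "r' \<in> {1..n}" "cyc_prefix n r' b' = {1..n} - cyc_prefix n r b"
proof -
  have "Suc b \<in> cyc_pos n r ` {1..n}" using bij_betw_cyc_pos[OF assms(1)] assms(2) by (simp add: bij_betw_def)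
  then obtain r' where r': "r' \<in> {1..n}" "cyc_pos n r r' = Suc b" by auto
  have "cyc_pos n r' x \<le> n - 2 - b \<longleftrightarrow> \<not> cyc_pos n r x \<le> b" if "x \<in> {1..n}" for x
    using cyc_pos_change[OF assms(1) r'(1) that] r'(2) cyc_pos_less[OF assms(1) that] assms(2) by auto
  then have "cyc_prefix n r' (n - 2 - b) = {1..n} - cyc_prefix n r b" by (auto simp: cyc_prefix_def)
  then show thesis using that r'(1) by blast
qed

lemma cyc_prefix_separates:
  assumes r: "r \<in> {1..n}" and abcd: "a < b" "b < c" "c < d" "a \<in> {1..n}" "d \<in> {1..n}"
    and bd: "b \<in> cyc_prefix n r m" "d \<in> cyc_prefix n r m"
  shows "a \<in> cyc_prefix n r m \<or> c \<in> cyc_prefix n r m"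
proof -
  have mem: "b \<in> {1..n}" "c \<in> {1..n}" using abcd by auto
  show ?thesis
    using bd abcd mem unfolding mem_cyc_prefix_iff cyc_pos_eq[OF r abcd(4)] cyc_pos_eq[OF r abcd(5)]
      cyc_pos_eq[OF r mem(1)] cyc_pos_eq[OF r mem(2)] by (auto split: if_splits)
qed

lemma gale_le_iff:
  assumes r: "r \<in> {1..n}" and IJ: "I \<subseteq> {1..n}" "J \<subseteq> {1..n}"
  shows "gale_le n r I J \<longleftrightarrow> card I = card J \<and>
    (\<forall>b. card (J \<inter> cyc_prefix n r b) \<le> card (I \<inter> cyc_prefix n r b))"
proof -
  let ?f = "cyc_pos n r"
  have inj: "inj_on ?f K" if "K \<subseteq> {1..n}" for K
    using bij_betw_cyc_pos[OF r] that by (auto simp: bij_betw_def intro: inj_on_subset)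
  have fin: "finite I" "finite J" using IJ finite_subset by auto
  have count: "card {y \<in> ?f ` K. y \<le> b} = card (K \<inter> cyc_prefix n r b)" if "K \<subseteq> {1..n}" for K b
  proof -
    have "{y \<in> ?f ` K. y \<le> b} = ?f ` (K \<inter> cyc_prefix n r b)" using that by (auto simp: cyc_prefix_def)
    moreover have "inj_on ?f (K \<inter> cyc_prefix n r b)" using that by (intro inj) auto
    ultimately show ?thesis by (simp add: card_image)
  qed
  have "gale_le n r I J \<longleftrightarrow> list_all2 (\<le>) (sorted_list_of_set (?f ` I)) (sorted_list_of_set (?f ` J))"
    unfolding gale_le_def map_sorted_key_list_of_set[OF inj[OF IJ(1)] fin(1), symmetric]
      map_sorted_key_list_of_set[OF inj[OF IJ(2)] fin(2), symmetric]
    by (simp add: list_all2_map1 list_all2_map2)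
  also have "\<dots> \<longleftrightarrow> card I = card J \<and>
    (\<forall>b. card (J \<inter> cyc_prefix n r b) \<le> card (I \<inter> cyc_prefix n r b))"
    unfolding list_all2_le_sorted_list_of_set_iff[OF fin[THEN finite_imageI]] count[OF IJ(1)] count[OF IJ(2)]
      card_image[OF inj[OF IJ(1)]] card_image[OF inj[OF IJ(2)]] by (rule refl)
  finally show ?thesis .
qed

section \<open>Cyclic ranks\<close>

definition cyc_rank :: "nat \<Rightarrow> nat \<Rightarrow> nat set \<Rightarrow> nat \<Rightarrow> nat" where
  "cyc_rank n r B x = card {y \<in> B. cyc_pos n r y < cyc_pos n r x}"

lemma cyc_rank_less_card: "finite B \<Longrightarrow> x \<in> B \<Longrightarrow> cyc_rank n r B x < card B"
  unfolding cyc_rank_def by (intro psubset_card_mono) auto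

lemma cyc_rank_less_iff:
  assumes "finite B" "x \<in> B"
  shows "cyc_rank n r B x < cyc_rank n r B y \<longleftrightarrow> cyc_pos n r x < cyc_pos n r y"
proof (cases "cyc_pos n r x < cyc_pos n r y")
  case True
  then have "{z \<in> B. cyc_pos n r z < cyc_pos n r x} \<subset> {z \<in> B. cyc_pos n r z < cyc_pos n r y}"
    using assms(2) by auto
  then show ?thesis
    using True assms(1) unfolding cyc_rank_def by (auto intro: psubset_card_mono)
next
  case False
  then have "cyc_rank n r B y \<le> cyc_rank n r B x"
    unfolding cyc_rank_def using assms(1) by (intro card_mono) auto
  then show ?thesis using False by simp
qed

lemma bij_betw_cyc_rank:
  assumes r: "r \<in> {1..n}" and B: "B \<subseteq> {1..n}"
  shows "bij_betw (cyc_rank n r B) B {..<card B}"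
proof -
  have fin: "finite B" using B by (rule finite_subset) simp
  have "inj_on (cyc_rank n r B) B"
  proof (rule inj_onI)
    fix x y assume xy: "x \<in> B" "y \<in> B" "cyc_rank n r B x = cyc_rank n r B y"
    then have "\<not> cyc_pos n r x < cyc_pos n r y" "\<not> cyc_pos n r y < cyc_pos n r x"
      using cyc_rank_less_iff[OF fin] by (metis order_less_irrefl)+
    then have "cyc_pos n r x = cyc_pos n r y" by simp
    then show "x = y" using cyc_pos_eq_iff[OF r, of x y] xy B by blast
  qed
  moreover have "cyc_rank n r B ` B \<subseteq> {..<card B}" using cyc_rank_less_card[OF fin] by auto
  ultimately show ?thesis
    unfolding bij_betw_def using card_subset_eq[of "{..<card B}" "cyc_rank n r B ` B"] by (simp add: card_image)
qed

lemma cyc_rank_eq_iff: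
  "r \<in> {1..n} \<Longrightarrow> B \<subseteq> {1..n} \<Longrightarrow> x \<in> B \<Longrightarrow> y \<in> B \<Longrightarrow> cyc_rank n r B x = cyc_rank n r B y \<longleftrightarrow> x = y"
  using bij_betw_cyc_rank by (auto simp: bij_betw_def inj_on_def)

lemma card_cyc_rank_less:
  assumes "r \<in> {1..n}" "B \<subseteq> {1..n}" "k \<le> card B"
  shows "card {x \<in> B. cyc_rank n r B x < k} = k"
proof -
  have bij: "bij_betw (cyc_rank n r B) B {..<card B}" by (rule bij_betw_cyc_rank[OF assms(1,2)])
  then have "{..<k} \<subseteq> cyc_rank n r B ` B" using assms(3) by (auto simp: bij_betw_def)
  then have "cyc_rank n r B ` {x \<in> B. cyc_rank n r B x < k} = {..<k}" by auto
  moreover have "inj_on (cyc_rank n r B) {x \<in> B. cyc_rank n r B x < k}"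
    using bij by (auto simp: bij_betw_def intro: inj_on_subset)
  ultimately show ?thesis using card_image by fastforce
qed

lemma clockwise_cyc_rank:
  assumes "r \<in> {1..n}" "B \<subseteq> {1..n}" "x \<in> B" "y \<in> B" "z \<in> B"
  shows "clockwise (cyc_rank n r B x) (cyc_rank n r B y) (cyc_rank n r B z) \<longleftrightarrow> clockwise x y z"
proof -
  have "finite B" using assms(2) by (rule finite_subset) simp
  then have "clockwise (cyc_rank n r B x) (cyc_rank n r B y) (cyc_rank n r B z) \<longleftrightarrow>
      clockwise (cyc_pos n r x) (cyc_pos n r y) (cyc_pos n r z)"
    unfolding clockwise_def using assms(3-5) by (simp add: cyc_rank_less_iff)
  also have "\<dots> \<longleftrightarrow> clockwise x y z" using assms by (intro clockwise_cyc_pos) auto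
  finally show ?thesis .
qed

lemma cyc_rank_eq:
  assumes r: "r \<in> {1..n}" and B: "B \<subseteq> {1..n}" and x: "x \<in> B"
  shows "cyc_rank n r B x =
    (if r \<le> x then rank_in B x - rank_in B r else rank_in B x + card B - rank_in B r)"
proof -
  have fin: "finite B" using B by (rule finite_subset) simp
  have less_iff: "cyc_pos n r y < cyc_pos n r x \<longleftrightarrow> (if (r \<le> y) = (r \<le> x) then y < x else r \<le> y)"
    if "y \<in> B" for y
    using cyc_pos_less_iff[OF r, of y x] that B x by blast
  show ?thesis
  proof (cases "r \<le> x")
    case True
    then have "{y \<in> B. cyc_pos n r y < cyc_pos n r x} = {y \<in> B. y < x} - {y \<in> B. y < r}"
      using less_iff by (auto split: if_splits)
    moreover have "{y \<in> B. y < r} \<subseteq> {y \<in> B. y < x}" using True by auto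
    ultimately show ?thesis using True fin by (simp add: cyc_rank_def rank_in_def card_Diff_subset)
  next
    case False
    then have "{y \<in> B. cyc_pos n r y < cyc_pos n r x} = {y \<in> B. y < x} \<union> (B - {y \<in> B. y < r})"
      using less_iff by (auto split: if_splits)
    moreover have "{y \<in> B. y < x} \<inter> (B - {y \<in> B. y < r}) = {}" using False by auto
    ultimately have "cyc_rank n r B x = rank_in B x + (card B - rank_in B r)"
      using fin by (simp add: cyc_rank_def rank_in_def card_Un_disjoint card_Diff_subset)
    moreover have "rank_in B r \<le> card B" unfolding rank_in_def using fin by (intro card_mono) auto
    ultimately show ?thesis using False by simp
  qed
qed

lemma cyc_rank_eq_mod:
  assumes r: "r \<in> {1..n}" and B: "B \<subseteq> {1..n}" and x: "x \<in> B"
  shows "cyc_rank n r B x = (rank_in B x + (card B - rank_in B r)) mod card B"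
proof -
  have fin: "finite B" using B by (rule finite_subset) simp
  have r_le: "rank_in B r \<le> card B" unfolding rank_in_def using fin by (intro card_mono) auto
  have x_less: "rank_in B x < card B" by (rule rank_in_less_card[OF fin x])
  show ?thesis
  proof (cases "r \<le> x")
    case True
    then have "rank_in B r \<le> rank_in B x"
      unfolding rank_in_def using fin by (intro card_mono) auto
    then have "rank_in B x + (card B - rank_in B r) = (rank_in B x - rank_in B r) + card B"
      using r_le by linarith
    moreover have "rank_in B x - rank_in B r < card B" using x_less by linarith
    ultimately have "(rank_in B x + (card B - rank_in B r)) mod card B = rank_in B x - rank_in B r"
      by (simp only: mod_add_self2 mod_less)
    then show ?thesis using cyc_rank_eq[OF assms] True by (simp only: if_True)
  next
    case False
    then have "x < r" by simp
    then have "insert x {y \<in> B. y < x} \<subseteq> {y \<in> B. y < r}" using x by auto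
    then have "rank_in B x < rank_in B r"
      unfolding rank_in_def using fin by (intro psubset_card_mono) auto
    then have "(rank_in B x + (card B - rank_in B r)) mod card B = rank_in B x + (card B - rank_in B r)"
      using r_le by (intro mod_less) linarith
    then show ?thesis using cyc_rank_eq[OF assms] False r_le by (simp only: if_False Nat.add_diff_assoc)
  qed
qed

lemma cyc_rank_rotation:
  assumes r: "r \<in> {1..n}" and B: "B \<subseteq> {1..n}" and xy: "x \<in> B" "y \<in> B"
    and rotation: "rank_in B y = (rank_in B x + t) mod card B"
  shows "cyc_rank n r B y = (cyc_rank n r B x + t) mod card B"
proof -
  have "cyc_rank n r B y = (((rank_in B x + t) mod card B) + (card B - rank_in B r)) mod card B"
    using cyc_rank_eq_mod[OF r B xy(2)] rotation by simp
  also have "\<dots> = ((rank_in B x + (card B - rank_in B r)) + t) mod card B"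
    unfolding mod_add_left_eq by (simp only: ac_simps)
  also have "\<dots> = (cyc_rank n r B x + t) mod card B"
    unfolding cyc_rank_eq_mod[OF r B xy(1)] mod_add_left_eq by (rule refl)
  finally show ?thesis .
qed

lemma cyc_rank_cyc_succ_self:
  assumes "B \<subseteq> {1..n}" "r \<in> B"
  shows "cyc_rank n (cyc_succ n r) B r = card B - 1"
proof -
  have r: "r \<in> {1..n}" using assms by blast
  have "cyc_pos n (cyc_succ n r) y < n - 1" if "y \<in> B - {r}" for y
    using cyc_pos_cyc_succ[OF r, of y] cyc_pos_less[OF r, of y] that assms(1) by fastforce
  then have "{y \<in> B. cyc_pos n (cyc_succ n r) y < cyc_pos n (cyc_succ n r) r} = B - {r}"
    unfolding cyc_pos_cyc_succ_self[OF r] using cyc_pos_cyc_succ_self[OF r] by fastforce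
  then show ?thesis unfolding cyc_rank_def using assms(2) by simp
qed

lemma cyc_rank_cyc_succ:
  assumes B: "B \<subseteq> {1..n}" and rx: "r \<in> B" "x \<in> B" "x \<noteq> r"
  shows "cyc_rank n r B x = Suc (cyc_rank n (cyc_succ n r) B x)"
proof -
  let ?s = "cyc_succ n r"
  have mem: "r \<in> {1..n}" "x \<in> {1..n}" using B rx by blast+
  have "cyc_pos n ?s x < n" using cyc_pos_less[OF cyc_succ_mem[OF mem(1)] mem(2)] .
  then have notin: "r \<notin> {y \<in> B. cyc_pos n ?s y < cyc_pos n ?s x}" using cyc_pos_cyc_succ_self[OF mem(1)] by auto
  have "cyc_pos n r y < cyc_pos n r x \<longleftrightarrow> y = r \<or> cyc_pos n ?s y < cyc_pos n ?s x" if "y \<in> B" for y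
  proof (cases "y = r")
    case False
    then show ?thesis using cyc_pos_cyc_succ[OF mem(1) _ False] cyc_pos_cyc_succ[OF mem rx(3)] B that by auto
  qed (use cyc_pos_cyc_succ[OF mem rx(3)] cyc_pos_self[of n r] in simp)
  then have "{y \<in> B. cyc_pos n r y < cyc_pos n r x} = insert r {y \<in> B. cyc_pos n ?s y < cyc_pos n ?s x}"
    using rx(1) by blast
  moreover have "finite B" using B by (rule finite_subset) simp
  ultimately show ?thesis unfolding cyc_rank_def using card_insert_disjoint[OF _ notin] by simp
qed

lemma mem_iff_cyc_rank_less:
  assumes r: "r \<in> {1..n}" and B: "B \<subseteq> {1..n}"
    and initial: "\<And>x y. x \<in> B \<Longrightarrow> x \<in> K \<Longrightarrow> y \<in> B \<Longrightarrow> cyc_pos n r y < cyc_pos n r x \<Longrightarrow> y \<in> K"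
    and x: "x \<in> B"
  shows "x \<in> K \<longleftrightarrow> cyc_rank n r B x < card (K \<inter> B)"
proof
  have fin: "finite B" using B by (rule finite_subset) simp
  let ?before = "{y \<in> B. cyc_pos n r y < cyc_pos n r x}"
  show "cyc_rank n r B x < card (K \<inter> B)" if "x \<in> K"
    unfolding cyc_rank_def
  proof (rule psubset_card_mono)
    have "?before \<subseteq> K \<inter> B" using initial[OF x that] by blast
    then show "?before \<subset> K \<inter> B" using x that by blast
  qed (use fin in simp)
  show "x \<in> K" if rank: "cyc_rank n r B x < card (K \<inter> B)"
  proof (rule ccontr)
    assume notin: "x \<notin> K"
    have "cyc_pos n r y < cyc_pos n r x" if y: "y \<in> K \<inter> B" for y
    proof -
      have "x \<noteq> y" "x \<in> {1..n}" "y \<in> {1..n}" using y x notin B by blast+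
      then have "cyc_pos n r y \<noteq> cyc_pos n r x" using cyc_pos_eq_iff[OF r] by blast
      moreover have "\<not> cyc_pos n r x < cyc_pos n r y" using initial[of y x] y x notin by blast
      ultimately show ?thesis by linarith
    qed
    then have "card (K \<inter> B) \<le> cyc_rank n r B x" unfolding cyc_rank_def using fin by (intro card_mono) auto
    then show False using rank by simp
  qed
qed

section \<open>Blocked exchanges in a linear frame\<close>

lemma card_leaving_eq_card_entering:
  assumes fin: "finite V" and bij: "bij_betw w V V" and A: "A \<subseteq> V"
  shows "card {x \<in> A. w x \<notin> A} = card {x \<in> V - A. w x \<in> A}"
proof -
  let ?pre = "{x \<in> V. w x \<in> A}"
  have finA: "finite A" using A fin by (rule finite_subset)
  have "w ` ?pre = A" using A bij by (auto simp: bij_betw_def)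
  moreover have "inj_on w ?pre" using bij by (auto simp: bij_betw_def intro: inj_on_subset)
  ultimately have "card A = card ?pre" by (metis card_image)
  moreover have "card A = card (A \<inter> ?pre) + card (A - ?pre)" by (rule card_Int_Diff[OF finA])
  moreover have "card ?pre = card (?pre \<inter> A) + card (?pre - A)"
    using fin by (intro card_Int_Diff) simp
  moreover have "A - ?pre = {x \<in> A. w x \<notin> A}" "?pre - A = {x \<in> V - A. w x \<in> A}" using A by auto
  ultimately show ?thesis by (simp add: Int_commute)
qed

lemma ex_leaving_iff_ex_entering:
  assumes "finite V" "bij_betw w V V" "A \<subseteq> V"
  shows "(\<exists>x\<in>A. w x \<notin> A) \<longleftrightarrow> (\<exists>x\<in>V - A. w x \<in> A)"
proof -
  have "finite {x \<in> A. w x \<notin> A}" "finite {x \<in> V - A. w x \<in> A}"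
    using assms(1) finite_subset[OF assms(3,1)] by auto
  note empty_iff_card = this[THEN card_0_eq, symmetric]
  have "{x \<in> A. w x \<notin> A} = {} \<longleftrightarrow> {x \<in> V - A. w x \<in> A} = {}"
    unfolding empty_iff_card card_leaving_eq_card_entering[OF assms] by (rule refl)
  then show ?thesis by blast
qed

definition decreasing :: "(nat \<Rightarrow> nat) \<Rightarrow> nat set \<Rightarrow> (nat \<Rightarrow> nat) \<Rightarrow> nat \<Rightarrow> bool" where
  "decreasing w C p x \<longleftrightarrow> p (w x) < p x \<or> x \<in> C"

definition dec_inc_pairs :: "nat set \<Rightarrow> (nat \<Rightarrow> nat) \<Rightarrow> nat set \<Rightarrow> (nat \<Rightarrow> nat) \<Rightarrow> (nat \<times> nat) set" where
  "dec_inc_pairs V w C p = {(x, y) \<in> V \<times> V. decreasing w C p x \<and> \<not> decreasing w C p y}"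

definition nested_inc :: "nat set \<Rightarrow> (nat \<Rightarrow> nat) \<Rightarrow> nat set \<Rightarrow> (nat \<Rightarrow> nat) \<Rightarrow> (nat \<times> nat) set" where
  "nested_inc V w C p = {(x, y) \<in> V \<times> V. \<not> decreasing w C p x \<and> \<not> decreasing w C p y \<and>
     p x < p y \<and> p (w y) < p (w x)}"

definition nested_dec :: "nat set \<Rightarrow> (nat \<Rightarrow> nat) \<Rightarrow> nat set \<Rightarrow> (nat \<Rightarrow> nat) \<Rightarrow> (nat \<times> nat) set" where
  "nested_dec V w C p = {(x, y) \<in> V \<times> V. decreasing w C p x \<and> decreasing w C p y \<and>
     p y < p x \<and> p (w x) < p (w y)}"

definition disjoint_dec_inc :: "nat set \<Rightarrow> (nat \<Rightarrow> nat) \<Rightarrow> nat set \<Rightarrow> (nat \<Rightarrow> nat) \<Rightarrow> (nat \<times> nat) set" where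
  "disjoint_dec_inc V w C p = {(x, y) \<in> dec_inc_pairs V w C p. p x < p y \<or> p (w y) < p (w x)}"

definition aligned_pairs :: "nat set \<Rightarrow> (nat \<Rightarrow> nat) \<Rightarrow> nat set \<Rightarrow> (nat \<Rightarrow> nat) \<Rightarrow> (nat \<times> nat) set" where
  "aligned_pairs V w C p = nested_inc V w C p \<union> nested_dec V w C p \<union> disjoint_dec_inc V w C p"

text \<open>No arc enters the interval \<open>{a..v}\<close> from below, or the interval \<open>{u..b}\<close> from above.\<close>

definition left_separated :: "nat set \<Rightarrow> (nat \<Rightarrow> nat) \<Rightarrow> (nat \<Rightarrow> nat) \<Rightarrow> nat \<Rightarrow> nat \<Rightarrow> bool" where
  "left_separated V w p u v \<longleftrightarrow>
     (\<exists>a. u < a \<and> a \<le> v \<and> (\<forall>z\<in>V. p z < a \<longrightarrow> p (w z) \<notin> {a..v}))"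

definition right_separated :: "nat set \<Rightarrow> (nat \<Rightarrow> nat) \<Rightarrow> (nat \<Rightarrow> nat) \<Rightarrow> nat \<Rightarrow> nat \<Rightarrow> bool" where
  "right_separated V w p u v \<longleftrightarrow>
     (\<exists>b. u \<le> b \<and> b < v \<and> (\<forall>z\<in>V. b < p z \<longrightarrow> p (w z) \<notin> {u..b}))"

definition blocked_left :: "nat set \<Rightarrow> (nat \<Rightarrow> nat) \<Rightarrow> nat set \<Rightarrow> (nat \<Rightarrow> nat) \<Rightarrow> (nat \<times> nat) set" where
  "blocked_left V w C p = {(x, y) \<in> dec_inc_pairs V w C p.
     p (w y) < p (w x) \<or> left_separated V w p (p (w x)) (p (w y))}"

definition blocked_right :: "nat set \<Rightarrow> (nat \<Rightarrow> nat) \<Rightarrow> nat set \<Rightarrow> (nat \<Rightarrow> nat) \<Rightarrow> (nat \<times> nat) set" where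
  "blocked_right V w C p = {(x, y) \<in> dec_inc_pairs V w C p.
     p (w y) < p (w x) \<or> right_separated V w p (p (w x)) (p (w y))}"

definition blocked :: "nat set \<Rightarrow> (nat \<Rightarrow> nat) \<Rightarrow> nat set \<Rightarrow> (nat \<Rightarrow> nat) \<Rightarrow> (nat \<times> nat) set" where
  "blocked V w C p = blocked_left V w C p \<union> blocked_right V w C p"

definition separated_inc :: "nat set \<Rightarrow> (nat \<Rightarrow> nat) \<Rightarrow> nat set \<Rightarrow> (nat \<Rightarrow> nat) \<Rightarrow> (nat \<times> nat) set" where
  "separated_inc V w C p = {(x, y) \<in> nested_inc V w C p. left_separated V w p (p x) (p (w y))}"

definition separated_dec :: "nat set \<Rightarrow> (nat \<Rightarrow> nat) \<Rightarrow> nat set \<Rightarrow> (nat \<Rightarrow> nat) \<Rightarrow> (nat \<times> nat) set" where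
  "separated_dec V w C p = {(x, y) \<in> nested_dec V w C p. right_separated V w p (p (w y)) (p x)}"

definition left_separated_dec_inc :: "nat set \<Rightarrow> (nat \<Rightarrow> nat) \<Rightarrow> nat set \<Rightarrow> (nat \<Rightarrow> nat) \<Rightarrow> (nat \<times> nat) set" where
  "left_separated_dec_inc V w C p = {(x, y) \<in> dec_inc_pairs V w C p.
     p (w y) < p (w x) \<or> left_separated V w p (p x) (p (w y))}"

definition right_separated_dec_inc :: "nat set \<Rightarrow> (nat \<Rightarrow> nat) \<Rightarrow> nat set \<Rightarrow> (nat \<Rightarrow> nat) \<Rightarrow> (nat \<times> nat) set" where
  "right_separated_dec_inc V w C p = {(x, y) \<in> dec_inc_pairs V w C p.
     p (w y) < p (w x) \<or> right_separated V w p (p (w x)) (p y)}"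

definition separated_pairs :: "nat set \<Rightarrow> (nat \<Rightarrow> nat) \<Rightarrow> nat set \<Rightarrow> (nat \<Rightarrow> nat) \<Rightarrow> (nat \<times> nat) set" where
  "separated_pairs V w C p = separated_inc V w C p \<union> separated_dec V w C p \<union>
     (left_separated_dec_inc V w C p \<union> right_separated_dec_inc V w C p)"

text \<open>The admissible \<open>u\<close> form an initial segment, bounded by the largest witness \<open>a\<close> for \<open>u = 0\<close>.\<close>

lemma left_separated_threshold:
  obtains a where "a \<le> v" "\<And>z. z \<in> V \<Longrightarrow> p z < a \<Longrightarrow> p (w z) \<notin> {a..v}"
    "\<And>u. left_separated V w p u v \<longleftrightarrow> u < a"
proof -
  let ?P = "\<lambda>a. a \<le> v \<and> (\<forall>z\<in>V. p z < a \<longrightarrow> p (w z) \<notin> {a..v})"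
  define a where "a = (GREATEST a. ?P a)"
  have a: "?P a" unfolding a_def by (rule GreatestI_nat[where P = ?P and k = 0 and b = v]) auto
  have "c \<le> a" if "?P c" for c
    unfolding a_def by (rule Greatest_le_nat[where P = ?P and b = v, OF that]) auto
  then have "left_separated V w p u v \<longleftrightarrow> u < a" for u
    using a unfolding left_separated_def by (meson less_le_trans)
  then show thesis using that a by blast
qed

locale frame =
  fixes V :: "nat set" and w :: "nat \<Rightarrow> nat" and C :: "nat set" and p :: "nat \<Rightarrow> nat"
  assumes fin: "finite V" and bij: "bij_betw w V V" and inj: "inj_on p V"
    and loops: "C \<subseteq> {x \<in> V. w x = x}"
begin

lemma w_in: "x \<in> V \<Longrightarrow> w x \<in> V" using bij by (auto simp: bij_betw_def)

lemma p_eq: "x \<in> V \<Longrightarrow> y \<in> V \<Longrightarrow> p x = p y \<longleftrightarrow> x = y" using inj by (auto simp: inj_on_def)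

lemma decreasing_le: "x \<in> V \<Longrightarrow> decreasing w C p x \<Longrightarrow> p (w x) \<le> p x"
  using loops by (auto simp: decreasing_def)

lemma increasing_ge: "\<not> decreasing w C p x \<Longrightarrow> p x \<le> p (w x)"
  by (auto simp: decreasing_def)

lemma increasing_if_less: "p x < p (w x) \<Longrightarrow> \<not> decreasing w C p x"
  using loops by (auto simp: decreasing_def)

lemma left_separated_imp_less:
  assumes "y \<in> V" "left_separated V w p u (p (w y))" shows "u < p y"
proof -
  obtain a where a: "u < a" "a \<le> p (w y)" "\<forall>z\<in>V. p z < a \<longrightarrow> p (w z) \<notin> {a..p (w y)}"
    using assms(2) unfolding left_separated_def by blast
  then have "\<not> p y < a" using assms(1) by auto
  then show ?thesis using a(1) by simp
qed

lemma left_separated_dec_inc_subset: "left_separated_dec_inc V w C p \<subseteq> disjoint_dec_inc V w C p"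
  using left_separated_imp_less
  by (auto simp: left_separated_dec_inc_def disjoint_dec_inc_def dec_inc_pairs_def)

lemma left_separated_dec_inc_blocked: "left_separated_dec_inc V w C p \<subseteq> blocked_left V w C p"
proof
  fix e assume "e \<in> left_separated_dec_inc V w C p"
  then obtain x y where e: "e = (x, y)" "(x, y) \<in> dec_inc_pairs V w C p"
    "p (w y) < p (w x) \<or> left_separated V w p (p x) (p (w y))"
    by (auto simp: left_separated_dec_inc_def)
  then have "p (w x) \<le> p x" using decreasing_le by (auto simp: dec_inc_pairs_def)
  then have "left_separated V w p (p (w x)) (p (w y))" if "left_separated V w p (p x) (p (w y))"
    using that unfolding left_separated_def by (meson le_less_trans)
  then show "e \<in> blocked_left V w C p" using e by (auto simp: blocked_left_def)
qed

lemma card_fibers: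
  assumes "R \<subseteq> V \<times> V" shows "card R = (\<Sum>y\<in>V. card {x. (x, y) \<in> R})"
proof -
  have "prod.swap ` R = (SIGMA y:V. {x. (x, y) \<in> R})" using assms by force
  moreover have "inj_on prod.swap R" by (auto simp: inj_on_def prod_eq_iff)
  ultimately have "card R = card (SIGMA y:V. {x. (x, y) \<in> R})" by (metis card_image)
  moreover have "finite {x. (x, y) \<in> R}" for y
    using assms fin by (intro finite_subset[of "{x. (x, y) \<in> R}" V]) auto
  ultimately show ?thesis using fin by simp
qed

lemma fiber_separated_inc:
  assumes y: "y \<in> V" "\<not> decreasing w C p y"
    and a: "a \<le> p (w y)" "\<And>z. z \<in> V \<Longrightarrow> p z < a \<Longrightarrow> p (w z) \<notin> {a..p (w y)}"
      "\<And>u. left_separated V w p u (p (w y)) \<longleftrightarrow> u < a"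
  defines "low \<equiv> {x \<in> V. p x < a}"
  shows "{x. (x, y) \<in> separated_inc V w C p} = {x \<in> low. w x \<notin> low}"
proof (intro equalityI subsetI)
  fix x assume "x \<in> {x. (x, y) \<in> separated_inc V w C p}"
  then show "x \<in> {x \<in> low. w x \<notin> low}"
    using a(1,3) by (auto simp: separated_inc_def nested_inc_def low_def)
next
  fix x assume x: "x \<in> {x \<in> low. w x \<notin> low}"
  then have x: "x \<in> V" "p x < a" "a \<le> p (w x)" using w_in by (auto simp: low_def)
  then have "p (w y) < p (w x)" using a(2)[of x] by simp
  moreover have "a \<le> p y" using a(1) a(2)[OF y(1)] by (meson atLeastAtMost_iff not_le order_refl)
  moreover have "\<not> decreasing w C p x" using x by (intro increasing_if_less) simp
  ultimately show "x \<in> {x. (x, y) \<in> separated_inc V w C p}"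
    using x y a(3) by (simp add: separated_inc_def nested_inc_def)
qed

lemma fiber_blocked_left:
  assumes y: "y \<in> V" "\<not> decreasing w C p y"
    and a: "\<And>u. left_separated V w p u (p (w y)) \<longleftrightarrow> u < a"
  shows "{x. (x, y) \<in> blocked_left V w C p} =
    {x \<in> V. p x < a \<and> decreasing w C p x} \<union> {x \<in> V. a \<le> p x \<and> p (w x) < a} \<union>
    {x \<in> V. decreasing w C p x \<and> p (w y) < p (w x)}"
proof (intro equalityI subsetI)
  fix x assume "x \<in> {x. (x, y) \<in> blocked_left V w C p}"
  then have "x \<in> V" "decreasing w C p x" "p (w x) < a \<or> p (w y) < p (w x)"
    using w_in[of x] a by (auto simp: blocked_left_def dec_inc_pairs_def)
  then show "x \<in> {x \<in> V. p x < a \<and> decreasing w C p x} \<union> {x \<in> V. a \<le> p x \<and> p (w x) < a} \<union>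
      {x \<in> V. decreasing w C p x \<and> p (w y) < p (w x)}"
    by auto
next
  fix x assume x: "x \<in> {x \<in> V. p x < a \<and> decreasing w C p x} \<union> {x \<in> V. a \<le> p x \<and> p (w x) < a} \<union>
      {x \<in> V. decreasing w C p x \<and> p (w y) < p (w x)}"
  then have "x \<in> V" "decreasing w C p x" by (auto simp: decreasing_def)
  moreover have "p (w x) < a \<or> p (w y) < p (w x)" using x decreasing_le[of x] by auto
  ultimately show "x \<in> {x. (x, y) \<in> blocked_left V w C p}"
    using y a by (auto simp: blocked_left_def dec_inc_pairs_def)
qed

text \<open>Both sides count the decreasing arcs that end below the threshold \<open>a\<close>, except that a decreasing
  arc crossing \<open>a\<close> on the left-hand side is traded for an increasing arc crossing \<open>a\<close>.\<close>

lemma card_fiber_blocked_left: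
  assumes y: "y \<in> V"
  shows "card {x. (x, y) \<in> blocked_left V w C p} =
    card {x. (x, y) \<in> separated_inc V w C p} + card {x. (x, y) \<in> left_separated_dec_inc V w C p}"
proof (cases "decreasing w C p y")
  case True
  then have "{x. (x, y) \<in> blocked_left V w C p} = {}" "{x. (x, y) \<in> separated_inc V w C p} = {}"
    "{x. (x, y) \<in> left_separated_dec_inc V w C p} = {}"
    by (auto simp: blocked_left_def separated_inc_def left_separated_dec_inc_def nested_inc_def dec_inc_pairs_def)
  then show ?thesis by simp
next
  case False
  obtain a where a: "a \<le> p (w y)" "\<And>z. z \<in> V \<Longrightarrow> p z < a \<Longrightarrow> p (w z) \<notin> {a..p (w y)}"
      "\<And>u. left_separated V w p u (p (w y)) \<longleftrightarrow> u < a"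
    using left_separated_threshold[of "p (w y)" V p w] by metis
  define dec_low where "dec_low = {x \<in> V. p x < a \<and> decreasing w C p x}"
  define entering where "entering = {x \<in> V. a \<le> p x \<and> p (w x) < a}"
  define high where "high = {x \<in> V. decreasing w C p x \<and> p (w y) < p (w x)}"
  have "p (w x) < a" if "x \<in> dec_low \<union> entering" for x
    using that decreasing_le[of x] by (auto simp: dec_low_def entering_def)
  then have disjoint: "dec_low \<inter> entering = {}" "(dec_low \<union> entering) \<inter> high = {}" "dec_low \<inter> high = {}"
    using a(1) by (fastforce simp: dec_low_def entering_def high_def)+
  have finite: "finite dec_low" "finite entering" "finite high"
    using fin by (simp_all add: dec_low_def entering_def high_def)
  have "card {x. (x, y) \<in> blocked_left V w C p} = card dec_low + card entering + card high"
    using fiber_blocked_left[OF y False a(3)] disjoint finite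
    unfolding dec_low_def[symmetric] entering_def[symmetric] high_def[symmetric] by (simp add: card_Un_disjoint)
  moreover have "{x. (x, y) \<in> left_separated_dec_inc V w C p} = dec_low \<union> high"
    using y False a(3) by (auto simp: left_separated_dec_inc_def dec_inc_pairs_def dec_low_def high_def)
  then have "card {x. (x, y) \<in> left_separated_dec_inc V w C p} = card dec_low + card high"
    using disjoint finite by (simp add: card_Un_disjoint)
  moreover have "card {x. (x, y) \<in> separated_inc V w C p} = card entering"
  proof -
    have "entering = {x \<in> V - {x \<in> V. p x < a}. w x \<in> {x \<in> V. p x < a}}"
      using w_in by (auto simp: entering_def)
    then show ?thesis
      using fiber_separated_inc[OF y False a] card_leaving_eq_card_entering[OF fin bij, of "{x \<in> V. p x < a}"] by simp
  qed
  ultimately show ?thesis by simp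
qed

lemma card_blocked_left:
  "card (blocked_left V w C p) = card (separated_inc V w C p) + card (left_separated_dec_inc V w C p)"
proof -
  have "blocked_left V w C p \<subseteq> V \<times> V" "separated_inc V w C p \<subseteq> V \<times> V"
    "left_separated_dec_inc V w C p \<subseteq> V \<times> V"
    by (auto simp: blocked_left_def separated_inc_def nested_inc_def left_separated_dec_inc_def dec_inc_pairs_def)
  then show ?thesis by (simp add: card_fibers card_fiber_blocked_left sum.distrib)
qed

definition rev_pos :: "nat \<Rightarrow> nat" where "rev_pos x = Max (p ` V) - p x"

definition rev_loops :: "nat set" where "rev_loops = {x \<in> V. w x = x} - C"

lemma p_le_Max: "x \<in> V \<Longrightarrow> p x \<le> Max (p ` V)" using fin by simp

lemma rev_pos_less: "x \<in> V \<Longrightarrow> y \<in> V \<Longrightarrow> rev_pos x < rev_pos y \<longleftrightarrow> p y < p x"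
  using p_le_Max[of x] p_le_Max[of y] by (auto simp: rev_pos_def)

lemma frame_rev: "frame V w rev_loops rev_pos"
proof
  show "inj_on rev_pos V"
    using rev_pos_less p_eq by (metis inj_onI less_irrefl nat_neq_iff)
qed (use fin bij in \<open>auto simp: rev_loops_def\<close>)

lemma decreasing_rev: "x \<in> V \<Longrightarrow> decreasing w rev_loops rev_pos x \<longleftrightarrow> \<not> decreasing w C p x"
  using rev_pos_less[of "w x" x] w_in[of x] p_eq[of "w x" x] loops
  by (auto simp: decreasing_def rev_loops_def)

lemma dec_inc_pairs_rev: "(x, y) \<in> dec_inc_pairs V w rev_loops rev_pos \<longleftrightarrow> (y, x) \<in> dec_inc_pairs V w C p"
  by (auto simp: dec_inc_pairs_def decreasing_rev)

lemma left_separated_rev: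
  assumes "x \<in> V" "y \<in> V"
  shows "left_separated V w rev_pos (rev_pos y) (rev_pos x) \<longleftrightarrow> right_separated V w p (p x) (p y)"
proof
  let ?K = "Max (p ` V)"
  note bounds = p_le_Max[OF assms(1)] p_le_Max[OF assms(2)]
  have flip: "rev_pos z < a \<longleftrightarrow> ?K - a < p z" "rev_pos (w z) \<in> {a..rev_pos x} \<longleftrightarrow> p (w z) \<in> {p x..?K - a}"
    if "z \<in> V" "0 < a" "a \<le> ?K" for z a
    using that bounds p_le_Max[of z] p_le_Max[OF w_in, of z] unfolding rev_pos_def by auto
  show "right_separated V w p (p x) (p y)" if left: "left_separated V w rev_pos (rev_pos y) (rev_pos x)"
  proof -
    obtain a where a: "rev_pos y < a" "a \<le> rev_pos x"
      "\<forall>z\<in>V. rev_pos z < a \<longrightarrow> rev_pos (w z) \<notin> {a..rev_pos x}"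
      using left unfolding left_separated_def by blast
    have range: "0 < a" "a \<le> ?K" "p x \<le> ?K - a" "?K - a < p y"
      using a(1,2) bounds unfolding rev_pos_def by linarith+
    have "p (w z) \<notin> {p x..?K - a}" if "z \<in> V" "?K - a < p z" for z
      using a(3) flip[OF that(1) range(1,2)] that by blast
    then show ?thesis unfolding right_separated_def using range(3,4) by blast
  qed
  show "left_separated V w rev_pos (rev_pos y) (rev_pos x)" if right: "right_separated V w p (p x) (p y)"
  proof -
    obtain b where b: "p x \<le> b" "b < p y" "\<forall>z\<in>V. b < p z \<longrightarrow> p (w z) \<notin> {p x..b}"
      using right unfolding right_separated_def by blast
    have a: "0 < ?K - b" "?K - b \<le> ?K" "?K - (?K - b) = b" "rev_pos y < ?K - b" "?K - b \<le> rev_pos x"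
      using b(1,2) bounds unfolding rev_pos_def by linarith+
    have "rev_pos (w z) \<notin> {?K - b..rev_pos x}" if "z \<in> V" "rev_pos z < ?K - b" for z
      using b(3) flip[OF that(1) a(1,2)] that unfolding a(3) by blast
    then show ?thesis unfolding left_separated_def using a(4,5) by blast
  qed
qed

lemma blocked_rev: "blocked_left V w rev_loops rev_pos = prod.swap ` blocked_right V w C p"
proof -
  have "(y, x) \<in> blocked_left V w rev_loops rev_pos \<longleftrightarrow> (x, y) \<in> blocked_right V w C p" for x y
    unfolding blocked_left_def blocked_right_def
    using dec_inc_pairs_rev[of y x] rev_pos_less[of "w x" "w y"] w_in left_separated_rev[of "w x" "w y"]
    by (auto simp: dec_inc_pairs_def)
  then show ?thesis by force
qed

lemma left_separated_dec_inc_rev: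
  "left_separated_dec_inc V w rev_loops rev_pos = prod.swap ` right_separated_dec_inc V w C p"
proof -
  have "(y, x) \<in> left_separated_dec_inc V w rev_loops rev_pos \<longleftrightarrow> (x, y) \<in> right_separated_dec_inc V w C p" for x y
    unfolding left_separated_dec_inc_def right_separated_dec_inc_def
    using dec_inc_pairs_rev[of y x] rev_pos_less[of "w x" "w y"] w_in left_separated_rev[of "w x" y]
    by (auto simp: dec_inc_pairs_def)
  then show ?thesis by force
qed

lemma disjoint_dec_inc_rev:
  "disjoint_dec_inc V w rev_loops rev_pos = prod.swap ` disjoint_dec_inc V w C p"
proof -
  have "(x, y) \<in> disjoint_dec_inc V w rev_loops rev_pos \<longleftrightarrow> (y, x) \<in> disjoint_dec_inc V w C p" for x y
    unfolding disjoint_dec_inc_def using dec_inc_pairs_rev[of x y] rev_pos_less w_in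
    by (auto simp: dec_inc_pairs_def)
  then show ?thesis by force
qed

lemma separated_inc_rev: "separated_inc V w rev_loops rev_pos = separated_dec V w C p"
proof -
  have "(x, y) \<in> separated_inc V w rev_loops rev_pos \<longleftrightarrow> (x, y) \<in> separated_dec V w C p" for x y
    unfolding separated_inc_def separated_dec_def nested_inc_def nested_dec_def
    using decreasing_rev rev_pos_less w_in left_separated_rev[of "w y" x] by auto
  then show ?thesis by auto
qed

lemma finite_subset_pairs: "R \<subseteq> V \<times> V \<Longrightarrow> finite R"
  using fin by (auto intro: finite_subset)

lemma finite_pairs [simp]:
  "finite (nested_inc V w C p)" "finite (nested_dec V w C p)" "finite (disjoint_dec_inc V w C p)"
  "finite (blocked_left V w C p)" "finite (blocked_right V w C p)" "finite (separated_inc V w C p)"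
  "finite (separated_dec V w C p)"
  "finite (left_separated_dec_inc V w C p)" "finite (right_separated_dec_inc V w C p)"
  by (rule finite_subset_pairs; auto simp: nested_inc_def nested_dec_def disjoint_dec_inc_def
      blocked_left_def blocked_right_def separated_inc_def separated_dec_def
      left_separated_dec_inc_def right_separated_dec_inc_def dec_inc_pairs_def)+

lemma finite_blocked [simp]: "finite (blocked V w C p)"
  by (simp add: blocked_def)

lemma finite_aligned_pairs [simp]: "finite (aligned_pairs V w C p)"
  by (simp add: aligned_pairs_def)

lemma right_separated_dec_inc_subset: "right_separated_dec_inc V w C p \<subseteq> disjoint_dec_inc V w C p"
proof -
  interpret R: frame V w rev_loops rev_pos by (rule frame_rev)
  show ?thesis
    using R.left_separated_dec_inc_subset
    by (simp add: left_separated_dec_inc_rev disjoint_dec_inc_rev inj_image_subset_iff)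
qed

lemma right_separated_dec_inc_blocked: "right_separated_dec_inc V w C p \<subseteq> blocked_right V w C p"
proof -
  interpret R: frame V w rev_loops rev_pos by (rule frame_rev)
  show ?thesis
    using R.left_separated_dec_inc_blocked
    by (simp add: left_separated_dec_inc_rev blocked_rev inj_image_subset_iff)
qed

lemma card_blocked_right:
  "card (blocked_right V w C p) = card (separated_dec V w C p) + card (right_separated_dec_inc V w C p)"
proof -
  interpret R: frame V w rev_loops rev_pos by (rule frame_rev)
  have "card (prod.swap ` A) = card A" for A :: "(nat \<times> nat) set"
    by (rule card_image) (auto simp: inj_on_def prod_eq_iff)
  then show ?thesis
    using R.card_blocked_left by (simp add: blocked_rev separated_inc_rev left_separated_dec_inc_rev)
qed

lemma separated_pairs_subset: "separated_pairs V w C p \<subseteq> aligned_pairs V w C p"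
  using left_separated_dec_inc_subset right_separated_dec_inc_subset
  by (auto simp: separated_pairs_def aligned_pairs_def separated_inc_def separated_dec_def)

text \<open>A pair that is separated on both sides is blocked on both sides, so inclusion-exclusion turns the
  counts of left- and right-blocked pairs into a bound for their union.\<close>

lemma card_blocked_le: "card (blocked V w C p) \<le> card (separated_pairs V w C p)"
proof -
  let ?L = "blocked_left V w C p" and ?R = "blocked_right V w C p"
  let ?l = "left_separated_dec_inc V w C p" and ?r = "right_separated_dec_inc V w C p"
  have "card (?l \<inter> ?r) \<le> card (?L \<inter> ?R)"
    using left_separated_dec_inc_blocked right_separated_dec_inc_blocked by (intro card_mono) auto
  moreover have "card (?L \<union> ?R) + card (?L \<inter> ?R) = card ?L + card ?R"
    by (rule card_Un_Int[symmetric]) auto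
  moreover have "card (?l \<union> ?r) + card (?l \<inter> ?r) = card ?l + card ?r"
    by (rule card_Un_Int[symmetric]) auto
  moreover have "card (separated_pairs V w C p) =
      card (separated_inc V w C p) + card (separated_dec V w C p) + card (?l \<union> ?r)"
  proof -
    have "separated_inc V w C p \<inter> separated_dec V w C p = {}"
      "(separated_inc V w C p \<union> separated_dec V w C p) \<inter> (?l \<union> ?r) = {}"
      by (auto simp: separated_inc_def separated_dec_def nested_inc_def nested_dec_def
          left_separated_dec_inc_def right_separated_dec_inc_def dec_inc_pairs_def)
    then show ?thesis unfolding separated_pairs_def by (simp add: card_Un_disjoint)
  qed
  ultimately show ?thesis
    unfolding blocked_def using card_blocked_left card_blocked_right by linarith
qed

lemma card_blocked_less:
  assumes "e \<in> aligned_pairs V w C p" "e \<notin> separated_pairs V w C p"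
  shows "card (blocked V w C p) < card (aligned_pairs V w C p)"
proof -
  have "separated_pairs V w C p \<subset> aligned_pairs V w C p" using separated_pairs_subset assms by blast
  then have "card (separated_pairs V w C p) < card (aligned_pairs V w C p)"
    by (rule psubset_card_mono[OF finite_aligned_pairs])
  then show ?thesis using card_blocked_le by simp
qed

end

section \<open>Alignments and crossings in a linear frame\<close>

context frame
begin

lemma not_left_separated_if_crossed:
  assumes "h \<in> V" "y \<in> V" "p h \<le> u" "p y \<le> p (w h)" "p (w h) \<le> p (w y)"
  shows "\<not> left_separated V w p u (p (w y))"
proof -
  have "\<exists>z\<in>V. p z < a \<and> p (w z) \<in> {a..p (w y)}" if "u < a" "a \<le> p (w y)" for a
  proof (cases "a \<le> p (w h)")
    case True
    then show ?thesis using assms that by (intro bexI[of _ h]) auto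
  next
    case False
    then show ?thesis using assms that by (intro bexI[of _ y]) auto
  qed
  then show ?thesis unfolding left_separated_def by blast
qed

lemma not_right_separated_if_crossed:
  assumes "h \<in> V" "y \<in> V" "v \<le> p h" "p (w y) \<le> p (w h)" "p (w h) \<le> p y"
  shows "\<not> right_separated V w p (p (w y)) v"
proof -
  have "\<exists>z\<in>V. b < p z \<and> p (w z) \<in> {p (w y)..b}" if "p (w y) \<le> b" "b < v" for b
  proof (cases "p (w h) \<le> b")
    case True
    then show ?thesis using assms that by (intro bexI[of _ h]) auto
  next
    case False
    then show ?thesis using assms that by (intro bexI[of _ y]) auto
  qed
  then show ?thesis unfolding right_separated_def by blast
qed

lemma not_left_separated_if_last_head:
  assumes "x \<in> V" "h \<in> V" "p x \<le> p h" "p (w h) \<le> u" and last: "\<And>z. z \<in> V \<Longrightarrow> p z \<le> p (w x)"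
  shows "\<not> left_separated V w p u (p (w x))"
proof -
  have "\<exists>z\<in>V. p z < a \<and> p (w z) \<in> {a..p (w x)}" if a: "u < a" "a \<le> p (w x)" for a
  proof (cases "p x < a")
    case True
    then show ?thesis using assms(1) a by auto
  next
    case False
    let ?A = "{z \<in> V. p z < a}"
    have "h \<in> V - ?A" "w h \<in> ?A" using assms(2-4) w_in a False by auto
    then obtain z where "z \<in> ?A" "w z \<notin> ?A"
      using ex_leaving_iff_ex_entering[OF fin bij, of ?A] by blast
    then show ?thesis using w_in last by (intro bexI[of _ z]) auto
  qed
  then show ?thesis unfolding left_separated_def by blast
qed

lemma not_right_separated_if_first_head:
  assumes "x \<in> V" "h \<in> V" "p h \<le> p x" "v \<le> p (w h)" and first: "\<And>z. z \<in> V \<Longrightarrow> p (w x) \<le> p z"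
  shows "\<not> right_separated V w p (p (w x)) v"
proof -
  have "\<exists>z\<in>V. b < p z \<and> p (w z) \<in> {p (w x)..b}" if b: "p (w x) \<le> b" "b < v" for b
  proof (cases "b < p x")
    case True
    then show ?thesis using assms(1) b by auto
  next
    case False
    let ?A = "{z \<in> V. p z \<le> b}"
    have "h \<in> ?A" "w h \<notin> ?A" using assms(2-4) b False by auto
    then obtain z where "z \<in> V - ?A" "w z \<in> ?A"
      using ex_leaving_iff_ex_entering[OF fin bij, of ?A] by blast
    then show ?thesis using w_in first by (intro bexI[of _ z]) auto
  qed
  then show ?thesis unfolding right_separated_def by blast
qed

end

text \<open>In a linear frame, the points on the left of a chord from \<open>a\<close> to \<open>A\<close> are those between \<open>a\<close> and
  \<open>A\<close> if the chord increases, and those outside if it decreases.\<close>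

definition left_side :: "bool \<Rightarrow> nat \<Rightarrow> nat \<Rightarrow> nat \<Rightarrow> bool" where
  "left_side d a A x \<longleftrightarrow> (if d then x < A \<or> a < x else a < x \<and> x < A)"

lemma left_side_loop: "x \<noteq> a \<Longrightarrow> left_side d a a x \<longleftrightarrow> d"
  by (auto simp: left_side_def)

lemma left_side_chord: "a \<noteq> A \<Longrightarrow> left_side (A < a) a A x \<longleftrightarrow> clockwise a x A"
  by (auto simp: left_side_def clockwise_def)

lemma aligned_left_side_iff:
  fixes a A b B :: nat
  assumes "a \<noteq> b" "A \<noteq> B" "if da then A \<le> a else a \<le> A" "if db then B \<le> b else b \<le> B"
  shows "A \<noteq> b \<and> B \<noteq> a \<and> left_side da a A b = left_side da a A B \<and>
      left_side da a A b \<noteq> left_side db b B a \<longleftrightarrow>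
    (\<not> da \<and> \<not> db \<and> a < b \<and> B < A \<or> da \<and> db \<and> b < a \<and> A < B \<or> da \<and> \<not> db \<and> (a < b \<or> B < A)) \<or>
    (\<not> db \<and> \<not> da \<and> b < a \<and> A < B \<or> db \<and> da \<and> a < b \<and> B < A \<or> db \<and> \<not> da \<and> (b < a \<or> A < B))"
  using assms unfolding left_side_def by (cases da; cases db; simp; linarith)

locale decorated_perm =
  fixes n :: nat and w :: "nat \<Rightarrow> nat" and C :: "nat set"
  assumes perm: "w permutes {1..n}" and loops: "C \<subseteq> {i \<in> {1..n}. w i = i}"
begin

lemma w_mem: "x \<in> {1..n} \<Longrightarrow> w x \<in> {1..n}"
  using permutes_in_image[OF perm] by blast

lemma w_eq: "w x = w y \<longleftrightarrow> x = y"
  using permutes_inj[OF perm] by (auto dest: injD)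

lemma inj_on_w: "inj_on w A"
  using permutes_inj[OF perm] by (rule inj_on_subset) simp

lemma ex_preimage:
  assumes "x \<in> {1..n}" obtains y where "y \<in> {1..n}" "x = w y"
  using assms permutes_image[OF perm] by blast

lemma frame_cyc_pos: "r \<in> {1..n} \<Longrightarrow> frame {1..n} w C (cyc_pos n r)"
  using bij_betw_cyc_pos[of r n] loops permutes_imp_bij[OF perm] by unfold_locales (auto simp: bij_betw_def)

lemma arc_head_eq_iff:
  "i \<in> {1..n} \<Longrightarrow> j \<in> {1..n} \<Longrightarrow> arc_head w C i = 3 * j \<longleftrightarrow> w i \<noteq> i \<and> w i = j"
  by (auto simp: arc_head_def) presburger+

lemma left_of_tail_iff:
  assumes "i \<in> {1..n}" "j \<in> {1..n}" "i \<noteq> j"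
  shows "left_of w C i (arc_tail j) \<longleftrightarrow> (if w i = i then i \<in> C else clockwise i j (w i))"
  using assms by (auto simp: left_of_def arc_tail_def arc_head_def clockwise_def)

lemma left_of_head_iff:
  assumes "i \<in> {1..n}" "j \<in> {1..n}" "i \<noteq> j" "w j \<noteq> i" "w i \<noteq> j"
  shows "left_of w C i (arc_head w C j) \<longleftrightarrow> (if w i = i then i \<in> C else clockwise i (w j) (w i))"
proof (cases "w i = i")
  case True
  have "arc_head w C j \<noteq> 3 * i" using arc_head_eq_iff[OF assms(2,1)] assms(4) by simp
  moreover have "3 * m \<noteq> 3 * i - 1" "3 * m + 1 \<noteq> 3 * i - 1" "3 * j - 1 \<noteq> 3 * i - 1" for m
    using assms(1-3) unfolding atLeastAtMost_iff by presburger+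
  then have "arc_head w C j \<noteq> 3 * i - 1" unfolding arc_head_def by presburger
  ultimately show ?thesis
    using True assms(1) by (auto simp: left_of_def arc_tail_def arc_head_def[of w C i] clockwise_def)
next
  case False
  have "3 * a < arc_head w C j \<longleftrightarrow> a < w j" "arc_head w C j < 3 * a \<longleftrightarrow> w j < a" if "a \<noteq> j" for a
    using that assms(2) by (auto simp: arc_head_def)
  then show ?thesis
    using False assms(3,5) by (auto simp: left_of_def arc_tail_def arc_head_def[of w C i] clockwise_def)
qed

lemma crossing_iff:
  assumes "i \<in> {1..n}" "j \<in> {1..n}"
  shows "crossing w C i j \<longleftrightarrow> i \<noteq> j \<and> (w i = j \<or> w j = i \<or>
    (w i \<noteq> i \<and> clockwise i j (w i) \<noteq> clockwise i (w j) (w i)))"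
proof (cases "i = j \<or> w i = j \<or> w j = i")
  case True
  then show ?thesis using assms by (auto simp: crossing_def arc_head_def arc_tail_def)
next
  case False
  have "arc_head w C i \<noteq> arc_head w C j"
    using False w_eq[of i j] assms by (auto simp: arc_head_def)
  moreover have "arc_head w C i \<noteq> arc_tail j" "arc_head w C j \<noteq> arc_tail i" "arc_tail i \<noteq> arc_tail j"
    using arc_head_eq_iff[OF assms] arc_head_eq_iff[OF assms(2,1)] False by (auto simp: arc_tail_def)
  ultimately have "crossing w C i j \<longleftrightarrow> left_of w C i (arc_tail j) \<noteq> left_of w C i (arc_head w C j)"
    using False by (auto simp: crossing_def)
  then show ?thesis using left_of_tail_iff[OF assms] left_of_head_iff[OF assms] False by auto
qed

lemma no_fixed_point_if_crossing:
  assumes "i \<in> {1..n}" "j \<in> {1..n}" "crossing w C i j"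
  shows "w i \<noteq> i" "w j \<noteq> j"
  using assms(3) w_eq unfolding crossing_iff[OF assms(1,2)] by metis+

lemma decreasing_cyc_pos_iff:
  assumes "r \<in> {1..n}" "i \<in> {1..n}"
  shows "decreasing w C (cyc_pos n r) i \<longleftrightarrow>
    (if w i = i then i \<in> C else cyc_pos n r (w i) < cyc_pos n r i)"
  using loops by (auto simp: decreasing_def)

lemma left_side_cyc_pos_iff:
  assumes r: "r \<in> {1..n}" and mem: "i \<in> {1..n}" "x \<in> {1..n}" and ne: "x \<noteq> i"
  shows "left_side (decreasing w C (cyc_pos n r) i) (cyc_pos n r i) (cyc_pos n r (w i)) (cyc_pos n r x) \<longleftrightarrow>
    (if w i = i then i \<in> C else clockwise i x (w i))"
proof (cases "w i = i")
  case True
  have "cyc_pos n r x \<noteq> cyc_pos n r i" using cyc_pos_eq_iff[OF r mem(2,1)] ne by simp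
  then show ?thesis using True decreasing_cyc_pos_iff[OF r mem(1)] by (simp add: left_side_loop)
next
  case False
  have "cyc_pos n r i \<noteq> cyc_pos n r (w i)" using cyc_pos_eq_iff[OF r mem(1) w_mem[OF mem(1)]] False by auto
  then show ?thesis
    using False decreasing_cyc_pos_iff[OF r mem(1)] clockwise_cyc_pos[OF r mem w_mem[OF mem(1)]]
    by (simp add: left_side_chord)
qed

lemma crossing_left_side_iff:
  assumes r: "r \<in> {1..n}" and ij: "i \<in> {1..n}" "j \<in> {1..n}"
  shows "crossing w C i j \<longleftrightarrow> i \<noteq> j \<and> (w i = j \<or> w j = i \<or>
    left_side (decreasing w C (cyc_pos n r) i) (cyc_pos n r i) (cyc_pos n r (w i)) (cyc_pos n r j) \<noteq>
    left_side (decreasing w C (cyc_pos n r) i) (cyc_pos n r i) (cyc_pos n r (w i)) (cyc_pos n r (w j)))"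
proof (cases "i = j \<or> w i = j \<or> w j = i")
  case True
  then show ?thesis unfolding crossing_iff[OF ij] by blast
next
  case False
  then have "j \<noteq> i" "w j \<noteq> i" by auto
  then show ?thesis
    unfolding crossing_iff[OF ij] left_side_cyc_pos_iff[OF r ij \<open>j \<noteq> i\<close>]
      left_side_cyc_pos_iff[OF r ij(1) w_mem[OF ij(2)] \<open>w j \<noteq> i\<close>] by simp
qed

lemma alignment_iff:
  assumes r: "r \<in> {1..n}" and ij: "i \<in> {1..n}" "j \<in> {1..n}"
  shows "alignment w C i j \<longleftrightarrow>
    (i, j) \<in> aligned_pairs {1..n} w C (cyc_pos n r) \<or> (j, i) \<in> aligned_pairs {1..n} w C (cyc_pos n r)"
proof (cases "i = j")
  case True
  then show ?thesis
    by (auto simp: alignment_def aligned_pairs_def nested_inc_def nested_dec_def disjoint_dec_inc_def dec_inc_pairs_def)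
next
  case False
  interpret frame "{1..n}" w C "cyc_pos n r" by (rule frame_cyc_pos[OF r])
  let ?p = "cyc_pos n r" and ?d = "decreasing w C (cyc_pos n r)"
  have left_of: "left_of w C x (arc_tail y) \<longleftrightarrow> left_side (?d x) (?p x) (?p (w x)) (?p y)"
    if "x \<in> {1..n}" "y \<in> {1..n}" "x \<noteq> y" for x y
    using left_of_tail_iff[OF that] left_side_cyc_pos_iff[OF r that(1,2)] that(3) by auto
  have head_eq_iff: "?p (w i) \<noteq> ?p j \<longleftrightarrow> w i \<noteq> j" "?p (w j) \<noteq> ?p i \<longleftrightarrow> w j \<noteq> i"
    using p_eq w_in ij by auto
  have "alignment w C i j \<longleftrightarrow> ?p (w i) \<noteq> ?p j \<and> ?p (w j) \<noteq> ?p i \<and>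
      left_side (?d i) (?p i) (?p (w i)) (?p j) = left_side (?d i) (?p i) (?p (w i)) (?p (w j)) \<and>
      left_side (?d i) (?p i) (?p (w i)) (?p j) \<noteq> left_side (?d j) (?p j) (?p (w j)) (?p i)"
    unfolding alignment_def crossing_left_side_iff[OF r ij] left_of[OF ij False]
      left_of[OF ij(2,1) False[symmetric]] head_eq_iff using False by blast
  also have "\<dots> \<longleftrightarrow> (\<not> ?d i \<and> \<not> ?d j \<and> ?p i < ?p j \<and> ?p (w j) < ?p (w i) \<or>
      ?d i \<and> ?d j \<and> ?p j < ?p i \<and> ?p (w i) < ?p (w j) \<or> ?d i \<and> \<not> ?d j \<and> (?p i < ?p j \<or> ?p (w j) < ?p (w i))) \<or>
    (\<not> ?d j \<and> \<not> ?d i \<and> ?p j < ?p i \<and> ?p (w i) < ?p (w j) \<or>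
      ?d j \<and> ?d i \<and> ?p i < ?p j \<and> ?p (w j) < ?p (w i) \<or> ?d j \<and> \<not> ?d i \<and> (?p j < ?p i \<or> ?p (w i) < ?p (w j)))"
    by (rule aligned_left_side_iff)
      (use False ij p_eq w_in w_eq decreasing_le increasing_ge in auto)
  also have "\<dots> \<longleftrightarrow> (i, j) \<in> aligned_pairs {1..n} w C ?p \<or> (j, i) \<in> aligned_pairs {1..n} w C ?p"
    using ij by (simp add: aligned_pairs_def nested_inc_def nested_dec_def disjoint_dec_inc_def dec_inc_pairs_def)
  finally show ?thesis .
qed

lemma card_alignments_eq_card_orientation:
  assumes mem: "Q \<subseteq> {1..n} \<times> {1..n}" and asym: "\<And>i j. (i, j) \<in> Q \<Longrightarrow> (j, i) \<notin> Q"
    and orientation: "\<And>i j. i \<in> {1..n} \<Longrightarrow> j \<in> {1..n} \<Longrightarrow> alignment w C i j \<longleftrightarrow> (i, j) \<in> Q \<or> (j, i) \<in> Q"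
  shows "card (alignments n w C) = card Q"
proof -
  let ?f = "\<lambda>(i, j). {i, j} :: nat set"
  have "alignments n w C \<subseteq> ?f ` Q"
  proof
    fix e assume "e \<in> alignments n w C"
    then obtain i j where e: "e = {i, j}" "(i, j) \<in> Q \<or> (j, i) \<in> Q"
      using orientation by (auto simp: alignments_def)
    then have "e = ?f (i, j)" "e = ?f (j, i)" by auto
    then show "e \<in> ?f ` Q" using e(2) by blast
  qed
  moreover have "?f ` Q \<subseteq> alignments n w C"
  proof
    fix e assume "e \<in> ?f ` Q"
    then obtain i j where e: "e = {i, j}" "(i, j) \<in> Q" by auto
    then have "i \<in> {1..n}" "j \<in> {1..n}" using mem by auto
    then show "e \<in> alignments n w C" unfolding alignments_def using e orientation by blast
  qed
  ultimately have "alignments n w C = ?f ` Q" by (rule subset_antisym)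
  moreover have "inj_on ?f Q"
    using asym by (auto simp: inj_on_def doubleton_eq_iff)
  ultimately show ?thesis by (simp only: card_image)
qed

lemma card_alignments:
  assumes r: "r \<in> {1..n}"
  shows "card (alignments n w C) = card (aligned_pairs {1..n} w C (cyc_pos n r))"
proof (rule card_alignments_eq_card_orientation)
  show "aligned_pairs {1..n} w C (cyc_pos n r) \<subseteq> {1..n} \<times> {1..n}"
    by (auto simp: aligned_pairs_def nested_inc_def nested_dec_def disjoint_dec_inc_def dec_inc_pairs_def)
  show "(j, i) \<notin> aligned_pairs {1..n} w C (cyc_pos n r)"
    if "(i, j) \<in> aligned_pairs {1..n} w C (cyc_pos n r)" for i j
    using that by (auto simp: aligned_pairs_def nested_inc_def nested_dec_def disjoint_dec_inc_def dec_inc_pairs_def)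
qed (rule alignment_iff[OF r])

lemma crossing_at_origin:
  assumes h: "h \<in> {1..n}" and x: "x \<in> {1..n}" and crossing: "crossing w C h x"
  defines "p \<equiv> cyc_pos n h"
  shows "0 < p x" "p x \<le> p (w h) \<and> p (w h) < p (w x) \<or> p (w x) < p (w h) \<and> p (w h) \<le> p x \<or> w x = h"
proof -
  interpret frame "{1..n}" w C p unfolding p_def by (rule frame_cyc_pos[OF h])
  have p_h: "p h = 0" by (simp add: p_def cyc_pos_self)
  have ne: "h \<noteq> x" using crossing h x by (simp add: crossing_iff)
  then show "0 < p x" using p_eq[OF h x] p_h by simp
  have "w h \<noteq> h" by (rule no_fixed_point_if_crossing[OF h x crossing])
  then have "\<not> decreasing w C p h" using p_h loops by (auto simp: decreasing_def)
  then have "w h = x \<or> w x = h \<or> (p x < p (w h)) \<noteq> (p (w x) < p (w h) \<and> 0 < p (w x))"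
    using crossing \<open>0 < p x\<close> p_h unfolding crossing_left_side_iff[OF h h x] p_def[symmetric]
    by (auto simp: left_side_def)
  moreover have "p (w x) \<noteq> p (w h)" using p_eq[OF w_in[OF x] w_in[OF h]] w_eq ne by auto
  moreover have "w x = h \<or> 0 < p (w x)" using p_eq[OF w_in[OF x] h] p_h by auto
  ultimately show "p x \<le> p (w h) \<and> p (w h) < p (w x) \<or> p (w x) < p (w h) \<and> p (w h) \<le> p x \<or> w x = h"
    by auto
qed

context
  fixes h x y :: nat
  assumes mem: "h \<in> {1..n}" "x \<in> {1..n}" "y \<in> {1..n}"
    and crossings: "crossing w C h x" "crossing w C h y"
begin

lemma crossed_nested_inc_not_separated:
  assumes "(x, y) \<in> nested_inc {1..n} w C (cyc_pos n h)"
  shows "(x, y) \<notin> separated_pairs {1..n} w C (cyc_pos n h)"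
proof -
  define p where "p = cyc_pos n h"
  interpret frame "{1..n}" w C p unfolding p_def by (rule frame_cyc_pos[OF mem(1)])
  have nested: "\<not> decreasing w C p x" "\<not> decreasing w C p y"
    using assms by (auto simp: nested_inc_def p_def)
  have "p h = 0" by (simp add: p_def cyc_pos_self)
  then have "p y \<le> p (w h)" "p (w h) < p (w y)"
    using crossing_at_origin[OF mem(1,3) crossings(2), folded p_def] increasing_ge[OF nested(2)] by auto
  then have "\<not> left_separated {1..n} w p (p x) (p (w y))"
    using not_left_separated_if_crossed[OF mem(1,3)] \<open>p h = 0\<close> by simp
  then show ?thesis
    unfolding p_def[symmetric] using nested
    by (auto simp: separated_pairs_def separated_inc_def separated_dec_def nested_dec_def
        left_separated_dec_inc_def right_separated_dec_inc_def dec_inc_pairs_def)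
qed

lemma crossed_disjoint_dec_inc_not_separated:
  assumes "(x, y) \<in> disjoint_dec_inc {1..n} w C (cyc_pos n h)"
  shows "(x, y) \<notin> separated_pairs {1..n} w C (cyc_pos n h)"
proof -
  define p where "p = cyc_pos n h"
  interpret frame "{1..n}" w C p unfolding p_def by (rule frame_cyc_pos[OF mem(1)])
  have pair: "decreasing w C p x" "\<not> decreasing w C p y" "p x < p y \<or> p (w y) < p (w x)"
    using assms by (auto simp: disjoint_dec_inc_def dec_inc_pairs_def p_def)
  have p_h: "p h = 0" by (simp add: p_def cyc_pos_self)
  have y: "p y \<le> p (w h)" "p (w h) < p (w y)"
    using crossing_at_origin[OF mem(1,3) crossings(2), folded p_def] increasing_ge[OF pair(2)] p_h by auto
  have "w x = h"
    using crossing_at_origin[OF mem(1,2) crossings(1), folded p_def] decreasing_le[OF mem(2) pair(1)] pair(3) y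
    by auto
  then have head_x: "p (w x) = 0" using p_h by simp
  have "\<not> left_separated {1..n} w p (p x) (p (w y))"
    using not_left_separated_if_crossed[OF mem(1,3)] y p_h by simp
  moreover have "\<not> right_separated {1..n} w p (p (w x)) (p y)"
    by (rule not_right_separated_if_first_head[OF mem(2,1)]) (use y p_h head_x in auto)
  ultimately show ?thesis
    unfolding p_def[symmetric] using pair(1,2) head_x
    by (auto simp: separated_pairs_def separated_inc_def separated_dec_def nested_inc_def nested_dec_def
        left_separated_dec_inc_def right_separated_dec_inc_def)
qed

text \<open>For nested decreasing arcs, the frame is rotated by one step so that \<open>h\<close> becomes its last point.\<close>

lemma crossed_nested_dec_shift:
  assumes "(x, y) \<in> nested_dec {1..n} w C (cyc_pos n h)"
  defines "q \<equiv> cyc_pos n (cyc_succ n h)"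
  shows "q y < q x" "q x < q h" "decreasing w C q y" "w x \<noteq> h \<Longrightarrow> q (w x) < q (w y)"
    and "q (w y) < q (w h)" "q (w h) \<le> q y"
proof -
  define p where "p = cyc_pos n h"
  interpret P: frame "{1..n}" w C p unfolding p_def by (rule frame_cyc_pos[OF mem(1)])
  interpret Q: frame "{1..n}" w C q unfolding q_def by (rule frame_cyc_pos[OF cyc_succ_mem[OF mem(1)]])
  have pair: "decreasing w C p y" "p y < p x" "p (w x) < p (w y)"
    using assms(1) by (auto simp: nested_dec_def p_def)
  have p_h: "p h = 0" by (simp add: p_def cyc_pos_self)
  have y: "p (w y) < p (w h)" "p (w h) \<le> p y"
    using crossing_at_origin[OF mem(1,3) crossings(2), folded p_def] P.decreasing_le[OF mem(3) pair(1)] pair(3) p_h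
    by auto
  have ne: "x \<noteq> h" "y \<noteq> h" "w y \<noteq> h" "w h \<noteq> h" using pair y p_h by auto
  have step: "p z = Suc (q z)" if "z \<in> {1..n}" "z \<noteq> h" for z
    using cyc_pos_cyc_succ[OF mem(1) that] by (simp add: p_def q_def)
  note steps = step[OF mem(2) ne(1)] step[OF mem(3) ne(2)] step[OF w_mem[OF mem(3)] ne(3)] step[OF w_mem[OF mem(1)] ne(4)]
  show "q y < q x" "q (w y) < q (w h)" "q (w h) \<le> q y" using pair(2) y steps by auto
  then show "decreasing w C q y" by (simp add: decreasing_def)
  show "q (w x) < q (w y)" if "w x \<noteq> h" using pair(3) step[OF w_mem[OF mem(2)] that] steps by simp
  have "q x \<le> q h"
    using cyc_pos_less[OF cyc_succ_mem[OF mem(1)] mem(2)] cyc_pos_cyc_succ_self[OF mem(1)] by (simp add: q_def)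
  then show "q x < q h" using Q.p_eq[OF mem(2,1)] ne(1) by force
qed

lemma crossed_nested_dec_not_separated:
  assumes "(x, y) \<in> nested_dec {1..n} w C (cyc_pos n h)"
  defines "q \<equiv> cyc_pos n (cyc_succ n h)"
  shows "\<exists>e. e \<in> aligned_pairs {1..n} w C q \<and> e \<notin> separated_pairs {1..n} w C q"
proof -
  interpret Q: frame "{1..n}" w C q unfolding q_def by (rule frame_cyc_pos[OF cyc_succ_mem[OF mem(1)]])
  note shift = crossed_nested_dec_shift[OF assms(1), folded q_def]
  have right: "\<not> right_separated {1..n} w q (q (w y)) (q x)"
    using Q.not_right_separated_if_crossed[OF mem(1,3)] shift by simp
  show ?thesis
  proof (cases "w x = h")
    case False
    then have "(x, y) \<in> nested_dec {1..n} w C q"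
      using shift mem by (auto simp: nested_dec_def decreasing_def)
    moreover from this have "(x, y) \<notin> separated_pairs {1..n} w C q"
      using right by (auto simp: separated_pairs_def separated_inc_def separated_dec_def nested_inc_def
          nested_dec_def left_separated_dec_inc_def right_separated_dec_inc_def dec_inc_pairs_def)
    ultimately show ?thesis by (auto simp: aligned_pairs_def)
  next
    case True
    have last: "q z \<le> q h" if "z \<in> {1..n}" for z
      using cyc_pos_less[OF cyc_succ_mem[OF mem(1)] that] cyc_pos_cyc_succ_self[OF mem(1)] by (simp add: q_def)
    have inc_x: "\<not> decreasing w C q x" using True shift(2) by (intro Q.increasing_if_less) simp
    have "(y, x) \<in> disjoint_dec_inc {1..n} w C q"
      using inc_x shift True mem by (auto simp: disjoint_dec_inc_def dec_inc_pairs_def)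
    moreover have "\<not> left_separated {1..n} w q (q y) (q (w x))"
      by (rule Q.not_left_separated_if_last_head[OF mem(2,1)]) (use True shift last in auto)
    then have "(y, x) \<notin> separated_pairs {1..n} w C q"
      using right inc_x True last[OF w_mem[OF mem(3)]]
      by (auto simp: separated_pairs_def separated_inc_def separated_dec_def nested_inc_def nested_dec_def
          left_separated_dec_inc_def right_separated_dec_inc_def)
    ultimately show ?thesis by (auto simp: aligned_pairs_def)
  qed
qed

end

lemma crossed_alignment_blocked_less:
  assumes mem: "i \<in> {1..n}" "j \<in> {1..n}" and crossed: "crossed_alignment n w C i j"
  shows "\<exists>r\<in>{1..n}. card (blocked {1..n} w C (cyc_pos n r)) < card (alignments n w C)"
proof -
  obtain h where h: "h \<in> {1..n}" "crossing w C h i" "crossing w C h j" and "alignment w C i j"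
    using crossed by (auto simp: crossed_alignment_def)
  then obtain x y where xy: "(x, y) \<in> aligned_pairs {1..n} w C (cyc_pos n h)" "x \<in> {1..n}" "y \<in> {1..n}"
      "crossing w C h x" "crossing w C h y"
    using alignment_iff[OF h(1) mem] mem by blast
  have "\<exists>r\<in>{1..n}. \<exists>e. e \<in> aligned_pairs {1..n} w C (cyc_pos n r) \<and> e \<notin> separated_pairs {1..n} w C (cyc_pos n r)"
    using xy(1) crossed_nested_inc_not_separated[OF h(1) xy(2-5)]
      crossed_disjoint_dec_inc_not_separated[OF h(1) xy(2-5)]
      crossed_nested_dec_not_separated[OF h(1) xy(2-5)] h(1) cyc_succ_mem[OF h(1)]
    unfolding aligned_pairs_def by blast
  then show ?thesis
    using frame.card_blocked_less[OF frame_cyc_pos] card_alignments by metis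
qed

end

section \<open>Rotating a frame\<close>

definition inc_arcs_into :: "nat set \<Rightarrow> (nat \<Rightarrow> nat) \<Rightarrow> nat set \<Rightarrow> (nat \<Rightarrow> nat) \<Rightarrow> nat set \<Rightarrow> nat set" where
  "inc_arcs_into V w C p A = {y \<in> V. w y \<in> A \<and> \<not> decreasing w C p y}"

locale rotated_frame = frame V w C p for V w C p +
  fixes q :: "nat \<Rightarrow> nat" and \<rho> m :: nat
  assumes p_less: "x \<in> V \<Longrightarrow> p x < m" and \<rho>_less: "\<rho> < m"
    and q_eq: "x \<in> V \<Longrightarrow> q x = (if \<rho> \<le> p x then p x - \<rho> else p x + m - \<rho>)"
begin

definition prefix :: "nat \<Rightarrow> nat set" where
  "prefix b = {x \<in> V. q x \<le> b}"

lemma finite_inc_arcs_into [simp]: "finite (inc_arcs_into V w C f A)"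
  using fin by (simp add: inc_arcs_into_def)

lemma tail_in_prefix:
  "y \<in> inc_arcs_into V w C q (prefix b) \<Longrightarrow> y \<in> prefix b \<and> q y \<le> q (w y)"
  by (auto simp: inc_arcs_into_def prefix_def decreasing_def)

lemma mem_prefix_iff_interval:
  "\<rho> + b < m \<Longrightarrow> x \<in> prefix b \<longleftrightarrow> x \<in> V \<and> \<rho> \<le> p x \<and> p x \<le> \<rho> + b"
  using q_eq[of x] p_less[of x] by (auto simp: prefix_def split: if_splits)

lemma mem_prefix_iff_wrapping:
  "m \<le> \<rho> + b \<Longrightarrow> x \<in> prefix b \<longleftrightarrow> x \<in> V \<and> (\<rho> \<le> p x \<or> p x + m \<le> \<rho> + b)"
  using q_eq[of x] p_less[of x] \<rho>_less by (auto simp: prefix_def split: if_splits)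

lemma inc_arcs_into_interval_subset:
  assumes "\<rho> + b < m"
  shows "inc_arcs_into V w C q (prefix b) \<subseteq> inc_arcs_into V w C p (prefix b)"
proof
  fix y assume y: "y \<in> inc_arcs_into V w C q (prefix b)"
  then have arc: "y \<in> V" "w y \<in> prefix b" "y \<notin> C" by (auto simp: inc_arcs_into_def decreasing_def)
  have "\<rho> \<le> p y" "\<rho> \<le> p (w y)" "q y \<le> q (w y)"
    using tail_in_prefix[OF y] arc(2) mem_prefix_iff_interval[OF assms] by auto
  then have "p y \<le> p (w y)" using q_eq[OF arc(1)] q_eq[OF w_in[OF arc(1)]] by simp
  then show "y \<in> inc_arcs_into V w C p (prefix b)"
    using arc by (auto simp: inc_arcs_into_def decreasing_def)
qed

lemma left_separated_if_inc_arcs_into_eq: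
  assumes b: "\<rho> + b < m"
    and arcs_eq: "inc_arcs_into V w C q (prefix b) = inc_arcs_into V w C p (prefix b)"
    and ij: "i \<in> V" "i \<notin> prefix b" "j \<in> prefix b"
  shows "p j < p i \<or> left_separated V w p (p i) (p j)"
proof (cases "p i < \<rho>")
  case True
  have j: "\<rho> \<le> p j" "p j \<le> \<rho> + b" using ij(3) mem_prefix_iff_interval[OF b] by auto
  have "p (w z) \<notin> {\<rho>..p j}" if z: "z \<in> V" "p z < \<rho>" for z
  proof
    assume head: "p (w z) \<in> {\<rho>..p j}"
    then have "\<not> decreasing w C p z" using z by (intro increasing_if_less) simp
    moreover have "w z \<in> prefix b" using head j w_in[OF z(1)] mem_prefix_iff_interval[OF b] by auto
    ultimately have "z \<in> inc_arcs_into V w C p (prefix b)" using z(1) by (simp add: inc_arcs_into_def)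
    then have "z \<in> prefix b" unfolding arcs_eq[symmetric] using tail_in_prefix by blast
    then show False using z(2) mem_prefix_iff_interval[OF b] by auto
  qed
  then show ?thesis unfolding left_separated_def using True j(1) by blast
next
  case False
  then show ?thesis using ij mem_prefix_iff_interval[OF b] by auto
qed

definition low :: "nat set" where
  "low = {y \<in> V. p y < \<rho>}"

lemma mem_low_iff: "y \<in> V \<Longrightarrow> y \<in> low \<longleftrightarrow> p y < \<rho>"
  by (simp add: low_def)

lemma card_leaving_low: "card {y \<in> low. w y \<notin> low} = card {y \<in> V - low. w y \<in> low}"
  by (rule card_leaving_eq_card_entering[OF fin bij]) (auto simp: low_def)

lemma lost_arcs_enter_low:
  "inc_arcs_into V w C q (prefix b) - inc_arcs_into V w C p (prefix b) \<subseteq>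
     {y \<in> V - low. w y \<in> low \<inter> prefix b}"
proof
  fix y assume "y \<in> inc_arcs_into V w C q (prefix b) - inc_arcs_into V w C p (prefix b)"
  then have y: "y \<in> V" "w y \<in> prefix b" "q y \<le> q (w y)" "p (w y) < p y"
    by (auto simp: inc_arcs_into_def decreasing_def)
  note wy = w_in[OF y(1)]
  have "p (w y) < \<rho>" "\<rho> \<le> p y"
    using y(3,4) q_eq[OF y(1)] q_eq[OF wy] p_less[OF y(1)] p_less[OF wy] \<rho>_less
    by (auto split: if_splits)
  then show "y \<in> {y \<in> V - low. w y \<in> low \<inter> prefix b}"
    using y(1,2) wy by (simp add: mem_low_iff)
qed

lemma arcs_leaving_low_are_gained:
  assumes b: "m \<le> \<rho> + b"
  shows "{y \<in> low. w y \<notin> low} \<subseteq> inc_arcs_into V w C p (prefix b) - inc_arcs_into V w C q (prefix b)"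
proof
  fix y assume "y \<in> {y \<in> low. w y \<notin> low}"
  then have y: "y \<in> V" "w y \<in> V" "p y < \<rho>" "\<rho> \<le> p (w y)" using w_in by (auto simp: low_def)
  have "q (w y) < q y" using q_eq[OF y(1)] q_eq[OF y(2)] y(3,4) p_less[OF y(2)] by simp
  moreover have "w y \<in> prefix b" using y mem_prefix_iff_wrapping[OF b] by blast
  moreover have "\<not> decreasing w C p y" using y by (intro increasing_if_less) simp
  ultimately show "y \<in> inc_arcs_into V w C p (prefix b) - inc_arcs_into V w C q (prefix b)"
    using y(1) by (simp add: inc_arcs_into_def decreasing_def)
qed

lemma card_inc_arcs_into_wrapping:
  assumes b: "m \<le> \<rho> + b"
  shows "card (inc_arcs_into V w C q (prefix b)) + card {y \<in> V - low. w y \<in> low} \<le>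
    card (inc_arcs_into V w C p (prefix b)) + card {y \<in> V - low. w y \<in> low \<inter> prefix b}"
proof -
  let ?X = "inc_arcs_into V w C q (prefix b)" and ?Y = "inc_arcs_into V w C p (prefix b)"
  have "card (?X - ?Y) \<le> card {y \<in> V - low. w y \<in> low \<inter> prefix b}"
    using fin by (intro card_mono lost_arcs_enter_low) simp
  moreover have "card {y \<in> V - low. w y \<in> low} \<le> card (?Y - ?X)"
    unfolding card_leaving_low[symmetric] by (intro card_mono arcs_leaving_low_are_gained[OF b]) simp
  moreover have "card ?X = card (?X \<inter> ?Y) + card (?X - ?Y)" "card ?Y = card (?X \<inter> ?Y) + card (?Y - ?X)"
    using card_Int_Diff[of ?X ?Y] card_Int_Diff[of ?Y ?X] by (simp_all add: Int_commute)
  ultimately show ?thesis by linarith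
qed

lemma card_entering_prefix_le:
  "card {y \<in> V - low. w y \<in> low \<inter> prefix b} \<le> card {y \<in> V - low. w y \<in> low}"
  using fin by (intro card_mono) auto

lemma right_separated_if_card_inc_arcs_into_eq:
  assumes b: "m \<le> \<rho> + b"
    and card_eq: "card (inc_arcs_into V w C q (prefix b)) = card (inc_arcs_into V w C p (prefix b))"
    and ij: "i \<in> V" "i \<notin> prefix b" "j \<in> prefix b"
  shows "p j < p i \<or> right_separated V w p (p i) (p j)"
proof -
  have "card {y \<in> V - low. w y \<in> low \<inter> prefix b} = card {y \<in> V - low. w y \<in> low}"
    using card_inc_arcs_into_wrapping[OF b] card_entering_prefix_le[of b] card_eq by linarith
  then have all_in_prefix: "{y \<in> V - low. w y \<in> low \<inter> prefix b} = {y \<in> V - low. w y \<in> low}"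
    using fin by (intro card_subset_eq) auto
  have i: "p i < \<rho>" "\<rho> + b < p i + m" using ij(1,2) mem_prefix_iff_wrapping[OF b] by auto
  show ?thesis
  proof (cases "\<rho> \<le> p j")
    case True
    have "p (w z) \<notin> {p i..\<rho> - 1}" if z: "z \<in> V" "\<rho> - 1 < p z" for z
    proof
      assume head: "p (w z) \<in> {p i..\<rho> - 1}"
      then have "z \<in> {y \<in> V - low. w y \<in> low}"
        using z i(1) w_in[OF z(1)] by (auto simp: low_def)
      then have "w z \<in> prefix b" using all_in_prefix by blast
      then show False using head i mem_prefix_iff_wrapping[OF b] by auto
    qed
    moreover have "p i \<le> \<rho> - 1" "\<rho> - 1 < p j" using i True by auto
    ultimately show ?thesis unfolding right_separated_def by blast
  next
    case False
    then show ?thesis using ij(3) i mem_prefix_iff_wrapping[OF b] by auto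
  qed
qed

lemma card_inc_arcs_into_le:
  "card (inc_arcs_into V w C q (prefix b)) \<le> card (inc_arcs_into V w C p (prefix b))"
proof (cases "\<rho> + b < m")
  case True
  then show ?thesis by (intro card_mono inc_arcs_into_interval_subset) simp
next
  case False
  then show ?thesis using card_inc_arcs_into_wrapping[of b] card_entering_prefix_le[of b] by simp
qed

lemma separated_if_card_inc_arcs_into_eq:
  assumes card_eq: "card (inc_arcs_into V w C q (prefix b)) = card (inc_arcs_into V w C p (prefix b))"
    and ij: "i \<in> V" "i \<notin> prefix b" "j \<in> prefix b"
  shows "p j < p i \<or> left_separated V w p (p i) (p j) \<or> right_separated V w p (p i) (p j)"
proof (cases "\<rho> + b < m")
  case True
  then have "inc_arcs_into V w C q (prefix b) = inc_arcs_into V w C p (prefix b)"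
    using card_eq inc_arcs_into_interval_subset by (intro card_subset_eq) auto
  then show ?thesis using left_separated_if_inc_arcs_into_eq[OF True _ ij] by blast
next
  case False
  then have "m \<le> \<rho> + b" by simp
  then show ?thesis using right_separated_if_card_inc_arcs_into_eq[OF _ card_eq ij] by blast
qed

end

section \<open>Positroids and their necklace bases\<close>

lemma card_johnson_neighbours:
  assumes M: "M \<subseteq> ksubsets n k" and J: "J \<in> ksubsets n k"
  shows "card {I \<in> M. card (I \<inter> J) + 1 = k} = card (exchange_edges n M J)"
proof (rule bij_betw_same_card[symmetric])
  let ?f = "\<lambda>(i, j). insert j (J - {i})"
  note J' = ksubsetsD[OF J]
  have "inj_on ?f (exchange_edges n M J)"
    by (rule inj_onI) (clarsimp simp: exchange_edges_def chart_index_def set_eq_iff, metis)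
  moreover have "?f ` exchange_edges n M J = {I \<in> M. card (I \<inter> J) + 1 = k}"
  proof (intro equalityI subsetI)
    fix I assume "I \<in> ?f ` exchange_edges n M J"
    then obtain i j where ij: "i \<in> J" "j \<notin> J" "I = insert j (J - {i})" "I \<in> M"
      by (auto simp: exchange_edges_def chart_index_def)
    then have "I \<inter> J = J - {i}" by auto
    then have "card (I \<inter> J) + 1 = k" using card_Suc_Diff1[OF J'(3) ij(1)] J'(2) by simp
    then show "I \<in> {I \<in> M. card (I \<inter> J) + 1 = k}" using ij(4) by simp
  next
    fix I assume I: "I \<in> {I \<in> M. card (I \<inter> J) + 1 = k}"
    then have I': "I \<subseteq> {1..n}" "card I = k" "finite I" using M ksubsetsD by blast+
    have "card (J - I) = 1" "card (I - J) = 1"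
      using I I' J' by (auto simp: card_Diff_subset_Int Int_commute)
    then obtain i j where ij: "J - I = {i}" "I - J = {j}" by (auto simp: card_1_singleton_iff)
    then have "I = ?f (i, j)" by auto
    moreover have "(i, j) \<in> exchange_edges n M J"
      using ij I I'(1) calculation by (intro exchange_edgesI) auto
    ultimately show "I \<in> ?f ` exchange_edges n M J" by (rule image_eqI)
  qed
  ultimately show "bij_betw ?f (exchange_edges n M J) {I \<in> M. card (I \<inter> J) + 1 = k}"
    by (simp add: bij_betw_def)
qed

lemma card_Diff_exchange_less:
  assumes A: "finite A" and ij: "i \<in> K" "j \<notin> K"
    and less: "card (A - insert j (K - {i})) < card (A - K)"
  shows "j \<in> A" "i \<notin> A" "card (A - K) = Suc (card (A - insert j (K - {i})))"
proof -
  let ?K = "insert j (K - {i})"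
  show "j \<in> A"
  proof (rule ccontr)
    assume "j \<notin> A"
    then have "card (A - K) \<le> card (A - ?K)" using A by (intro card_mono) auto
    then show False using less by simp
  qed
  show "i \<notin> A"
  proof
    assume "i \<in> A"
    have "card (A - K) \<le> card (insert j ((A - ?K) - {i}))" using A ij by (intro card_mono) auto
    also have "\<dots> \<le> Suc (card ((A - ?K) - {i}))" using A by (intro card_insert_le_m1) auto
    also have "\<dots> = card (A - ?K)" using \<open>i \<in> A\<close> A ij by (intro card_Suc_Diff1) auto
    finally show False using less by simp
  qed
  then have "A - K = insert j (A - ?K)" using \<open>j \<in> A\<close> ij by auto
  then show "card (A - K) = Suc (card (A - ?K))" using A by simp
qed

context decorated_perm
begin

abbreviation "necklace r \<equiv> shifted_anti_exceedances n w C r"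

abbreviation "uncrossed \<equiv> \<not> (\<exists>i\<in>{1..n}. \<exists>j\<in>{1..n}. crossed_alignment n w C i j)"

lemma necklace_subset: "necklace r \<subseteq> {1..n}"
  by (auto simp: shifted_anti_exceedances_def)

lemma finite_necklace [simp]: "finite (necklace r)"
  by (rule finite_subset[OF necklace_subset]) simp

lemma w_mem_necklace_iff:
  assumes "x \<in> {1..n}"
  shows "w x \<in> necklace r \<longleftrightarrow> decreasing w C (cyc_pos n r) x"
proof -
  have "inv_into UNIV w (w x) = x" using permutes_inj[OF perm] by (rule inv_f_f)
  moreover have "w y = y" if "y \<in> C" for y using loops that by auto
  then have "w x \<in> C \<longleftrightarrow> x \<in> C" using w_eq by metis
  ultimately show ?thesis using w_mem[OF assms] by (simp add: shifted_anti_exceedances_def decreasing_def)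
qed

lemma w_mem_necklace_cyc_succ_iff:
  assumes r: "r \<in> {1..n}" and y: "y \<in> {1..n}" "y \<noteq> r" "w y \<noteq> r"
  shows "w y \<in> necklace (cyc_succ n r) \<longleftrightarrow> w y \<in> necklace r"
  unfolding w_mem_necklace_iff[OF y(1)] decreasing_def
  using cyc_pos_cyc_succ[OF r y(1,2)] cyc_pos_cyc_succ[OF r w_mem[OF y(1)] y(3)] by simp

lemma necklace_cyc_succ_if_fixed:
  assumes r: "r \<in> {1..n}" and fixed: "w r = r"
  shows "necklace (cyc_succ n r) = necklace r"
proof -
  have "w y \<in> necklace (cyc_succ n r) \<longleftrightarrow> w y \<in> necklace r" if y: "y \<in> {1..n}" for y
  proof (cases "y = r")
    case True
    then show ?thesis unfolding w_mem_necklace_iff[OF y] decreasing_def using fixed by simp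
  next
    case False
    then show ?thesis using w_mem_necklace_cyc_succ_iff[OF r y] w_eq[of y r] fixed by simp
  qed
  then have "x \<in> necklace (cyc_succ n r) \<longleftrightarrow> x \<in> necklace r" if "x \<in> {1..n}" for x
    using ex_preimage[OF that] by metis
  then show ?thesis using necklace_subset by blast
qed

lemma necklace_at_moved:
  assumes r: "r \<in> {1..n}" and moved: "w r \<noteq> r"
  shows "r \<in> necklace r" "w r \<in> {1..n} - necklace r"
proof -
  obtain z where z: "z \<in> {1..n}" "r = w z" using ex_preimage[OF r] .
  then have "z \<noteq> r" using moved by auto
  then have "cyc_pos n r z \<noteq> 0" using cyc_pos_eq_iff[OF r z(1) r] cyc_pos_self[of n r] by simp
  then have "w z \<in> necklace r"
    unfolding w_mem_necklace_iff[OF z(1)] decreasing_def using z(2) cyc_pos_self[of n r] by simp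
  then show "r \<in> necklace r" using z(2) by simp
  have "r \<notin> C" using loops moved by auto
  then have "w r \<notin> necklace r" unfolding w_mem_necklace_iff[OF r] decreasing_def using cyc_pos_self[of n r] by simp
  then show "w r \<in> {1..n} - necklace r" using w_mem[OF r] by blast
qed

lemma necklace_cyc_succ:
  assumes r: "r \<in> {1..n}" and moved: "w r \<noteq> r"
  shows "necklace (cyc_succ n r) = insert (w r) (necklace r - {r})"
proof -
  let ?s = "cyc_succ n r"
  have last: "cyc_pos n ?s x < n - 1" if "x \<in> {1..n}" "x \<noteq> r" for x
    using cyc_pos_cyc_succ[OF r that] cyc_pos_less[OF r that(1)] by simp
  have "w y \<in> necklace ?s \<longleftrightarrow> w y \<in> insert (w r) (necklace r - {r})" if y: "y \<in> {1..n}" for y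
  proof -
    consider (tail) "y = r" | (head) "w y = r" "y \<noteq> r" | (other) "y \<noteq> r" "w y \<noteq> r" by blast
    then show ?thesis
    proof cases
      case tail
      then show ?thesis
        using last[OF w_mem[OF r] moved] cyc_pos_cyc_succ_self[OF r]
        by (simp add: w_mem_necklace_iff[OF r] decreasing_def)
    next
      case head
      then have "y \<notin> C" "w y \<noteq> w r" using loops w_eq[of y r] by auto
      moreover have "w y \<notin> necklace ?s"
        unfolding w_mem_necklace_iff[OF y] decreasing_def
        using head last[OF y head(2)] cyc_pos_cyc_succ_self[OF r] \<open>y \<notin> C\<close> by simp
      ultimately show ?thesis using head(1) by simp
    next
      case other
      then show ?thesis using w_mem_necklace_cyc_succ_iff[OF r y other] w_eq[of y r] by simp
    qed
  qed
  then have "x \<in> necklace ?s \<longleftrightarrow> x \<in> insert (w r) (necklace r - {r})" if "x \<in> {1..n}" for x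
    using ex_preimage[OF that] by metis
  moreover have "insert (w r) (necklace r - {r}) \<subseteq> {1..n}" using necklace_subset[of r] w_mem[OF r] by blast
  ultimately show ?thesis using necklace_subset[of ?s] by blast
qed

lemma necklace_induct [consumes 1, case_names first exchange]:
  assumes "r \<in> {1..n}" and first: "Q (necklace 1)"
    and exchange: "\<And>r. r \<in> {1..n} \<Longrightarrow> w r \<noteq> r \<Longrightarrow> Q (necklace r) \<Longrightarrow> Q (insert (w r) (necklace r - {r}))"
  shows "Q (necklace r)"
  using assms(1)
proof (induction r)
  case (Suc r)
  show ?case
  proof (cases "r = 0")
    case True
    then show ?thesis using first by simp
  next
    case False
    then have r: "r \<in> {1..n}" "cyc_succ n r = Suc r" using Suc.prems by (auto simp: cyc_succ_def)
    then have "Q (necklace r)" using Suc.IH by simp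
    then show ?thesis
      using necklace_cyc_succ_if_fixed[OF r(1)] necklace_cyc_succ[OF r(1)] exchange[OF r(1)] unfolding r(2) by metis
  qed
qed simp

lemma card_Diff_necklace:
  assumes "A \<subseteq> {1..n}"
  shows "card (A - necklace r) = card (inc_arcs_into {1..n} w C (cyc_pos n r) A)"
proof -
  have "w ` inc_arcs_into {1..n} w C (cyc_pos n r) A = A - necklace r"
  proof (intro equalityI subsetI)
    fix x assume x: "x \<in> A - necklace r"
    then obtain y where "y \<in> {1..n}" "x = w y" using assms ex_preimage by blast
    then show "x \<in> w ` inc_arcs_into {1..n} w C (cyc_pos n r) A"
      using x w_mem_necklace_iff by (auto simp: inc_arcs_into_def)
  qed (auto simp: inc_arcs_into_def w_mem_necklace_iff)
  then show ?thesis using card_image[OF inj_on_w] by metis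
qed

lemma rotated_frame_cyc_pos:
  assumes "r \<in> {1..n}" "r' \<in> {1..n}"
  shows "rotated_frame {1..n} w C (cyc_pos n r) (cyc_pos n r') (cyc_pos n r r') n"
proof -
  interpret frame "{1..n}" w C "cyc_pos n r" by (rule frame_cyc_pos[OF assms(1)])
  show ?thesis
    by unfold_locales (simp_all only: cyc_pos_less[OF assms(1)] assms cyc_pos_change[OF assms])
qed

lemma card_prefix_Diff_necklace_le:
  assumes r: "r \<in> {1..n}" "r' \<in> {1..n}"
  shows "card (cyc_prefix n r' b - necklace r') \<le> card (cyc_prefix n r' b - necklace r)"
proof -
  interpret rotated_frame "{1..n}" w C "cyc_pos n r" "cyc_pos n r'" "cyc_pos n r r'" n
    by (rule rotated_frame_cyc_pos[OF r])
  have prefix: "cyc_prefix n r' b = prefix b" unfolding prefix_def cyc_prefix_def by (rule refl)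
  show ?thesis
    using card_inc_arcs_into_le[of b]
    unfolding prefix[symmetric] card_Diff_necklace[OF cyc_prefix_subset, symmetric] .
qed

lemma separated_if_card_prefix_eq:
  assumes r: "r \<in> {1..n}" "r' \<in> {1..n}"
    and "card (cyc_prefix n r' b - necklace r') = card (cyc_prefix n r' b - necklace r)"
    and "i \<in> {1..n}" "i \<notin> cyc_prefix n r' b" "j \<in> cyc_prefix n r' b"
  defines "p \<equiv> cyc_pos n r"
  shows "p j < p i \<or> left_separated {1..n} w p (p i) (p j) \<or> right_separated {1..n} w p (p i) (p j)"
proof -
  interpret rotated_frame "{1..n}" w C p "cyc_pos n r'" "p r'" n
    unfolding p_def by (rule rotated_frame_cyc_pos[OF r])
  have prefix: "cyc_prefix n r' b = prefix b" unfolding prefix_def cyc_prefix_def by (rule refl)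
  show ?thesis
    using separated_if_card_inc_arcs_into_eq[of b i j] assms(3-6)
    unfolding prefix[symmetric] card_Diff_necklace[OF cyc_prefix_subset] p_def by blast
qed

lemma card_necklace:
  assumes "r \<in> {1..n}" shows "card (necklace r) = card (anti_exceedances n w C)"
proof -
  have "1 \<in> {1..n}" using assms by auto
  have "card ({1..n} - necklace r') \<le> card ({1..n} - necklace r)"
    if "r \<in> {1..n}" "r' \<in> {1..n}" for r r'
    using card_prefix_Diff_necklace_le[OF that, of n] cyc_prefix_eq_all[OF that(2), of n] by simp
  then have "card ({1..n} - necklace r) = card ({1..n} - necklace 1)"
    using assms \<open>1 \<in> {1..n}\<close> by (intro antisym) auto
  moreover have "card ({1..n} - necklace r) = n - card (necklace r)" for r
    using card_Diff_subset[OF finite_necklace necklace_subset] by simp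
  moreover have "card (necklace r) \<le> n" for r
    using card_mono[OF _ necklace_subset[of r]] by simp
  ultimately have "card (necklace r) = card (necklace 1)" by (metis diff_diff_cancel)
  moreover have "inv_into UNIV w i \<in> {1..n}" if "i \<in> {1..n}" for i
    using permutes_in_image[OF permutes_inv[OF perm]] that by blast
  then have "necklace 1 = anti_exceedances n w C"
    using cyc_pos_less_iff[OF \<open>1 \<in> {1..n}\<close>]
    by (auto simp: shifted_anti_exceedances_def anti_exceedances_def)
  ultimately show ?thesis by simp
qed

end

locale positroid_data = decorated_perm +
  fixes k :: nat
  assumes card_anti_exceedances: "card (anti_exceedances n w C) = k"
begin

abbreviation "M \<equiv> positroid n k w C"

lemma M_subset: "M \<subseteq> ksubsets n k"
  by (auto simp: positroid_def)

lemmas M_D = ksubsetsD[OF subsetD[OF M_subset]]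

lemma k_le_n: "k \<le> n"
proof -
  have "anti_exceedances n w C \<subseteq> {1..n}" by (auto simp: anti_exceedances_def)
  from card_mono[OF _ this] show ?thesis using card_anti_exceedances by simp
qed

lemma mem_M_iff:
  "I \<in> M \<longleftrightarrow> I \<in> ksubsets n k \<and>
    (\<forall>r\<in>{1..n}. \<forall>b. card (I \<inter> cyc_prefix n r b) \<le> card (necklace r \<inter> cyc_prefix n r b))"
proof (cases "I \<in> ksubsets n k")
  case True
  have "gale_le n r (necklace r) I \<longleftrightarrow>
      (\<forall>b. card (I \<inter> cyc_prefix n r b) \<le> card (necklace r \<inter> cyc_prefix n r b))"
    if "r \<in> {1..n}" for r
    using gale_le_iff[OF that necklace_subset ksubsetsD(1)[OF True]] card_necklace[OF that]
      card_anti_exceedances ksubsetsD(2)[OF True] by simp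
  then show ?thesis using True by (simp add: positroid_def)
qed (simp add: positroid_def)

lemma mem_M_iff_Diff:
  "I \<in> M \<longleftrightarrow> I \<in> ksubsets n k \<and>
    (\<forall>r\<in>{1..n}. \<forall>b. card (cyc_prefix n r b - necklace r) \<le> card (cyc_prefix n r b - I))"
proof -
  have split: "card (cyc_prefix n r b) = card (K \<inter> cyc_prefix n r b) + card (cyc_prefix n r b - K)" for K r b
    using card_Int_Diff[OF finite_cyc_prefix, of n r b K] by (simp add: Int_commute)
  have "card (I \<inter> cyc_prefix n r b) \<le> card (necklace r \<inter> cyc_prefix n r b) \<longleftrightarrow>
      card (cyc_prefix n r b - necklace r) \<le> card (cyc_prefix n r b - I)" for r b
    using split[of r b I] split[of r b "necklace r"] by linarith
  then show ?thesis by (simp add: mem_M_iff)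
qed

lemma necklace_in_M:
  assumes "r \<in> {1..n}" shows "necklace r \<in> M"
  unfolding mem_M_iff_Diff
  using necklace_subset card_necklace[OF assms] card_anti_exceedances card_prefix_Diff_necklace_le[OF assms]
  by (simp add: ksubsets_def)

lemma blocked_if_exchange_notin:
  assumes r: "r \<in> {1..n}" and ij: "i \<in> necklace r" "j \<in> {1..n} - necklace r"
    and notin: "insert j (necklace r - {i}) \<notin> M"
  shows "(i, j) \<in> map_prod w w ` blocked {1..n} w C (cyc_pos n r)"
proof -
  let ?I = "insert j (necklace r - {i})"
  have "?I \<in> ksubsets n k" using exchange_in_ksubsets M_subset necklace_in_M[OF r] ij by blast
  then obtain r' b where r': "r' \<in> {1..n}"
    and less: "card (cyc_prefix n r' b - ?I) < card (cyc_prefix n r' b - necklace r')"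
    using notin unfolding mem_M_iff_Diff by (auto simp: not_le)
  have necklace_le: "card (cyc_prefix n r' b - necklace r') \<le> card (cyc_prefix n r' b - necklace r)"
    by (rule card_prefix_Diff_necklace_le[OF r r'])
  have i: "i \<in> {1..n}" and j: "j \<in> {1..n}" "j \<notin> necklace r" using ij necklace_subset[of r] by auto
  note exchange = card_Diff_exchange_less[OF finite_cyc_prefix ij(1) j(2) less_le_trans[OF less necklace_le]]
  have "card (cyc_prefix n r' b - necklace r') = card (cyc_prefix n r' b - necklace r)"
    using less necklace_le exchange(3) by linarith
  then have separated: "cyc_pos n r j < cyc_pos n r i \<or>
      left_separated {1..n} w (cyc_pos n r) (cyc_pos n r i) (cyc_pos n r j) \<or>
      right_separated {1..n} w (cyc_pos n r) (cyc_pos n r i) (cyc_pos n r j)"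
    by (rule separated_if_card_prefix_eq[OF r r' _ i exchange(2,1)])
  obtain x where x: "x \<in> {1..n}" "i = w x" by (rule ex_preimage[OF i])
  obtain y where y: "y \<in> {1..n}" "j = w y" by (rule ex_preimage[OF j(1)])
  have "(x, y) \<in> dec_inc_pairs {1..n} w C (cyc_pos n r)"
    using ij x y w_mem_necklace_iff by (auto simp: dec_inc_pairs_def)
  then have "(x, y) \<in> blocked {1..n} w C (cyc_pos n r)"
    using separated x y by (auto simp: blocked_def blocked_left_def blocked_right_def)
  then show ?thesis using x y by (intro image_eqI[of _ _ "(x, y)"]) auto
qed

lemma card_neighbours_necklace_ge:
  assumes r: "r \<in> {1..n}"
  shows "k * (n - k) \<le> card {I \<in> M. card (I \<inter> necklace r) + 1 = k} +
    card (blocked {1..n} w C (cyc_pos n r))"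
proof -
  interpret frame "{1..n}" w C "cyc_pos n r" by (rule frame_cyc_pos[OF r])
  let ?B = "blocked {1..n} w C (cyc_pos n r)" and ?E = "exchange_edges n M (necklace r)"
  have J: "necklace r \<in> ksubsets n k" using necklace_in_M[OF r] M_subset by auto
  have "chart_index n (necklace r) \<subseteq> ?E \<union> map_prod w w ` ?B"
    using blocked_if_exchange_notin[OF r] unfolding exchange_edges_def chart_index_def by blast
  then have "card (chart_index n (necklace r)) \<le> card (?E \<union> map_prod w w ` ?B)"
    using finite_chart_index[OF J] exchange_edges_subset[of n M "necklace r"]
    by (intro card_mono finite_UnI finite_imageI finite_blocked) (auto intro: finite_subset)
  also have "\<dots> \<le> card ?E + card (map_prod w w ` ?B)" by (rule card_Un_le)
  also have "card (map_prod w w ` ?B) \<le> card ?B" by (intro card_image_le finite_blocked)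
  finally show ?thesis using card_chart_index[OF J] card_johnson_neighbours[OF M_subset J] by simp
qed

lemma uncrossed_if_degree:
  assumes degree: "\<And>J. J \<in> M \<Longrightarrow> card {I \<in> M. card (I \<inter> J) + 1 = k} + card (alignments n w C) = k * (n - k)"
  shows uncrossed
proof clarify
  fix i j assume "i \<in> {1..n}" "j \<in> {1..n}" "crossed_alignment n w C i j"
  then obtain r where r: "r \<in> {1..n}"
    and "card (blocked {1..n} w C (cyc_pos n r)) < card (alignments n w C)"
    using crossed_alignment_blocked_less by blast
  then show False using card_neighbours_necklace_ge[OF r] degree[OF necklace_in_M[OF r]] by linarith
qed

end

section \<open>Chords with adjacent heads\<close>

definition chord_crossing :: "(nat \<Rightarrow> nat) \<Rightarrow> nat \<Rightarrow> nat \<Rightarrow> bool" where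
  "chord_crossing u i j \<longleftrightarrow> i \<noteq> j \<and> (u i = j \<or> u j = i \<or> clockwise i j (u i) \<noteq> clockwise i (u j) (u i))"

definition chord_alignment :: "(nat \<Rightarrow> nat) \<Rightarrow> nat \<Rightarrow> nat \<Rightarrow> bool" where
  "chord_alignment u i j \<longleftrightarrow> i \<noteq> j \<and> \<not> chord_crossing u i j \<and> clockwise i j (u i) \<noteq> clockwise j i (u j)"

lemma chord_crossing_if_endpoints_separated:
  assumes "z \<noteq> x" "u z \<noteq> u x" "z = c \<and> u z = e \<or> z = e \<and> u z = c"
    and "min x (u x) \<le> c" "c \<le> max x (u x)" "e \<le> min x (u x) \<or> max x (u x) \<le> e"
  shows "chord_crossing u z x"
proof (cases "u z = x \<or> u x = z")
  case True
  then show ?thesis using assms(1) by (auto simp: chord_crossing_def)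
next
  case False
  then have ne: "c \<noteq> x" "c \<noteq> u x" "e \<noteq> x" "e \<noteq> u x" using assms(1-3) by auto
  have "clockwise z x (u z) \<noteq> clockwise z (u x) (u z)"
  proof (cases "x < u x")
    case True
    then have "x < c" "c < u x" "e < x \<or> u x < e" using assms(4-6) ne by auto
    then show ?thesis using assms(3) True by (auto simp: clockwise_def)
  next
    case False
    then have "u x < c" "c < x" "e < u x \<or> x < e" using assms(4-6) ne by auto
    then show ?thesis using assms(3) False by (auto simp: clockwise_def)
  qed
  then show ?thesis using assms(1) by (simp add: chord_crossing_def)
qed

lemma chord_alignment_nested:
  "x < y \<Longrightarrow> y < u y \<Longrightarrow> u y < u x \<Longrightarrow> chord_alignment u x y"
  by (auto simp: chord_alignment_def chord_crossing_def clockwise_def)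

text \<open>The chords \<open>0 \<mapsto> B + 1\<close> and \<open>b \<mapsto> B\<close> are aligned, so no chord crosses both. Let \<open>c\<close> be
  the last point of the gap between the tails \<open>0\<close> and \<open>b\<close> that is joined to the outside of the outer
  chord. A chord entering the interval from \<open>c + 1\<close> to \<open>B\<close> starts in the gap and passes over \<open>c\<close>, so the
  chord at \<open>c\<close> crosses it and the outer chord, although these two are aligned.\<close>

locale adjacent_heads =
  fixes u :: "nat \<Rightarrow> nat" and m b B :: nat
  assumes bij: "bij_betw u {..<m} {..<m}"
    and not_crossed: "i < m \<Longrightarrow> j < m \<Longrightarrow> h < m \<Longrightarrow> chord_alignment u i j \<Longrightarrow>
      chord_crossing u h i \<Longrightarrow> \<not> chord_crossing u h j"
    and b: "0 < b" "b < B" "u b = B" "u 0 = Suc B" "Suc B < m"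
begin

lemma u_less: "x < m \<Longrightarrow> u x < m"
  using bij by (auto simp: bij_betw_def)

lemma u_eq_iff: "x < m \<Longrightarrow> y < m \<Longrightarrow> u x = u y \<longleftrightarrow> x = y"
  using bij by (auto simp: bij_betw_def inj_on_def)

lemma tails_less: "b < m" "0 < m"
  using b by auto

definition inner :: "nat set" where "inner = {b..B}"

definition outer :: "nat set" where "outer = insert 0 {Suc B..<m}"

definition gap :: "nat set" where "gap = {0<..<b}"

lemma regions_cover: "x < m \<Longrightarrow> x \<in> inner \<or> x \<in> outer \<or> x \<in> gap"
  by (auto simp: inner_def outer_def gap_def)

lemma regions_disjoint:
  "x \<in> inner \<Longrightarrow> x \<notin> outer" "x \<in> gap \<Longrightarrow> x \<notin> inner" "x \<in> gap \<Longrightarrow> x \<notin> outer"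
  using b by (auto simp: inner_def outer_def gap_def)

lemma gap_less: "x \<in> gap \<Longrightarrow> x < m"
  using b by (auto simp: gap_def)

definition joins :: "nat \<Rightarrow> nat \<Rightarrow> nat \<Rightarrow> bool" where
  "joins x c e \<longleftrightarrow> x < m \<and> (x = c \<and> u x = e \<or> x = e \<and> u x = c)"

lemma joins_head: "x < m \<Longrightarrow> joins x (u x) x"
  by (simp add: joins_def)

lemma joins_less: "joins x c e \<Longrightarrow> x < m"
  by (simp add: joins_def)

lemma crossing_inner_chord:
  assumes "joins x c e" "c \<in> inner" "e \<notin> inner"
  shows "chord_crossing u x b"
proof (rule chord_crossing_if_endpoints_separated[where c = c and e = e])
  show "x \<noteq> b" "u x \<noteq> u b"
    using assms b u_eq_iff[of x b] tails_less by (auto simp: joins_def inner_def)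
qed (use assms b in \<open>auto simp: joins_def inner_def\<close>)

lemma crossing_outer_chord:
  assumes "joins x c e" "c \<notin> outer" "e \<in> outer"
  shows "chord_crossing u x 0"
proof (rule chord_crossing_if_endpoints_separated[where c = c and e = e])
  have "x \<noteq> 0" using assms b by (auto simp: joins_def outer_def)
  then show "x \<noteq> 0" "u x \<noteq> u 0" using assms u_eq_iff[of x 0] tails_less by (auto simp: joins_def)
  have "c < m" using assms u_less by (auto simp: joins_def)
  then show "min 0 (u 0) \<le> c" "c \<le> max 0 (u 0)" using assms b by (auto simp: outer_def)
qed (use assms b in \<open>auto simp: joins_def outer_def\<close>)

lemma not_joins_inner_outer:
  assumes "joins x c e" "c \<in> inner" shows "e \<notin> outer"
proof
  assume "e \<in> outer"
  then have "chord_crossing u x b" "chord_crossing u x 0"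
    using crossing_inner_chord[OF assms] crossing_outer_chord[OF assms(1)] regions_disjoint assms(2) by blast+
  moreover have "chord_alignment u 0 b" by (rule chord_alignment_nested) (use b in auto)
  ultimately show False using not_crossed tails_less joins_less[OF assms(1)] by blast
qed

definition gap_to_outer :: "nat set" where
  "gap_to_outer = {c \<in> gap. \<exists>x e. joins x c e \<and> e \<in> outer}"

lemma no_chord_over_gap_to_outer:
  assumes c: "c \<in> gap_to_outer" and y: "y \<in> gap" "y \<le> c" "c < u y"
  shows "B < u y"
proof (rule ccontr)
  assume "\<not> B < u y"
  obtain x e where x: "joins x c e" "e \<in> outer" "c \<in> gap" using c by (auto simp: gap_to_outer_def)
  have ord: "0 < y" "y \<le> c" "c < u y" "u y < u 0" "e = 0 \<or> B < e"
    using y \<open>\<not> B < u y\<close> x(2) b by (auto simp: gap_def outer_def)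
  have "x \<noteq> y" using x y(1) ord \<open>\<not> B < u y\<close> b by (auto simp: joins_def gap_def)
  then have "chord_crossing u x y"
    by (intro chord_crossing_if_endpoints_separated[where c = c and e = e])
      (use x(1) ord u_eq_iff joins_less gap_less[OF y(1)] b(4) in \<open>auto simp: joins_def\<close>)
  moreover have "chord_crossing u x 0" using crossing_outer_chord[OF x(1) _ x(2)] x(3) regions_disjoint(3) by blast
  moreover have "chord_alignment u 0 y" by (rule chord_alignment_nested) (use ord in auto)
  ultimately show False using not_crossed tails_less gap_less[OF y(1)] joins_less[OF x(1)] by blast
qed

lemma ex_invariant_interval: "\<exists>c\<in>{1..B}. u ` {c..B} \<subseteq> {c..B}"
proof -
  define c where "c = Max (insert 0 gap_to_outer)"
  have fin: "finite (insert 0 gap_to_outer)" by (auto simp: gap_to_outer_def gap_def)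
  have c: "c = 0 \<or> c \<in> gap_to_outer" using Max_in[OF fin] by (auto simp: c_def)
  have c_max: "c' \<le> c" if "c' \<in> gap_to_outer" for c' using Max_ge[OF fin] that by (simp add: c_def)
  have c_less: "c < b" using c b by (auto simp: gap_to_outer_def gap_def)
  have "u y \<notin> {Suc c..B}" if y: "y < m" "y \<notin> {Suc c..B}" for y
  proof
    assume head: "u y \<in> {Suc c..B}"
    show False
    proof (cases "y \<in> outer")
      case True
      then have "u y \<in> gap"
        using head regions_cover[OF u_less[OF y(1)]] not_joins_inner_outer[OF joins_head[OF y(1)]]
        by (auto simp: outer_def)
      then have "u y \<in> gap_to_outer" using joins_head[OF y(1)] True by (auto simp: gap_to_outer_def)
      then show False using c_max[of "u y"] head by simp
    next
      case False
      then have "y \<in> gap" "y \<le> c" using y c_less b by (auto simp: outer_def gap_def)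
      then show False using no_chord_over_gap_to_outer[of c y] c head by (auto simp: gap_def)
    qed
  qed
  then have "\<not> (\<exists>y\<in>{..<m} - {Suc c..B}. u y \<in> {Suc c..B})" by blast
  moreover have "{Suc c..B} \<subseteq> {..<m}" using b by auto
  ultimately have "u ` {Suc c..B} \<subseteq> {Suc c..B}"
    using ex_leaving_iff_ex_entering[OF finite_lessThan bij] by blast
  moreover have "Suc c \<in> {1..B}" using c_less b by auto
  ultimately show ?thesis by blast
qed

end

section \<open>Permutations without crossed alignments\<close>

lemma spirograph_on_iff:
  assumes "finite S" "w ` S = S"
  shows "spirograph_on w S \<longleftrightarrow> (\<exists>t\<in>{1..card S}. \<forall>x\<in>S. rank_in S (w x) = (rank_in S x + t) mod card S)"
proof -
  have "(\<forall>i<card S. w (sorted_list_of_set S ! i) = sorted_list_of_set S ! ((i + t) mod card S)) \<longleftrightarrow>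
    (\<forall>x\<in>S. rank_in S (w x) = (rank_in S x + t) mod card S)" (is "?L \<longleftrightarrow> ?R") for t
  proof
    assume ?L
    show ?R
    proof
      fix x assume x: "x \<in> S"
      note less = rank_in_less_card[OF assms(1) x]
      then have "(rank_in S x + t) mod card S < card S" by (intro mod_less_divisor) auto
      moreover have "w x = sorted_list_of_set S ! ((rank_in S x + t) mod card S)"
        using \<open>?L\<close> less nth_rank_in[OF assms(1) x] by metis
      ultimately show "rank_in S (w x) = (rank_in S x + t) mod card S" using rank_in_nth[OF assms(1)] by simp
    qed
  next
    assume ?R
    show ?L
    proof (intro allI impI)
      fix i assume i: "i < card S"
      let ?x = "sorted_list_of_set S ! i"
      have x: "?x \<in> S" by (rule sorted_list_of_set_nth_in[OF assms(1) i])
      then have "w ?x \<in> S" using assms(2) by blast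
      then have "w ?x = sorted_list_of_set S ! rank_in S (w ?x)" using nth_rank_in[OF assms(1)] by simp
      also have "rank_in S (w ?x) = (i + t) mod card S" using \<open>?R\<close> x rank_in_nth[OF assms(1) i] by simp
      finally show "w ?x = sorted_list_of_set S ! ((i + t) mod card S)" .
    qed
  qed
  then show ?thesis by (simp add: spirograph_on_def)
qed

definition proper_spirograph :: "(nat \<Rightarrow> nat) \<Rightarrow> nat set \<Rightarrow> bool" where
  "proper_spirograph w B \<longleftrightarrow> w ` B = B \<and> spirograph_on w B \<and> (card B = 1 \<or> (\<forall>x\<in>B. w x \<noteq> x))"

lemma proper_spirograph_singleton: "w ` {x} = {x} \<Longrightarrow> proper_spirograph w {x}"
  by (simp add: proper_spirograph_def spirograph_on_def)

lemma rank_in_rotation_less_card: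
  assumes B: "finite B" "w ` B = B" and spirograph: "spirograph_on w B" and moved: "x \<in> B" "w x \<noteq> x"
  obtains t where "0 < t" "t < card B" "\<And>y. y \<in> B \<Longrightarrow> rank_in B (w y) = (rank_in B y + t) mod card B"
proof -
  obtain t where t: "t \<in> {1..card B}" "\<And>y. y \<in> B \<Longrightarrow> rank_in B (w y) = (rank_in B y + t) mod card B"
    using spirograph unfolding spirograph_on_iff[OF B] by blast
  have "w x \<in> B" using B(2) moved(1) by auto
  then have "rank_in B (w x) \<noteq> rank_in B x" using rank_in_eq_iff[OF B(1) _ moved(1)] moved(2) by simp
  then have "t \<noteq> card B" using t(2)[OF moved(1)] rank_in_less_card[OF B(1) moved(1)] by auto
  then show thesis using that[of t] t by auto
qed

lemma rank_in_eq_cyc_rank_shift: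
  assumes "S \<subseteq> {1..n}" "x \<in> S" "y \<in> S"
  shows "rank_in S y = (rank_in S x + cyc_rank n x S y) mod card S"
proof -
  have fin: "finite S" using assms(1) by (rule finite_subset) simp
  have "x \<in> {1..n}" using assms(1,2) by blast
  note eq = cyc_rank_eq[OF this assms(1,3)]
  have less: "rank_in S x < card S" "rank_in S y < card S" using rank_in_less_card[OF fin] assms(2,3) by auto
  have order: "x \<le> y \<longleftrightarrow> rank_in S x \<le> rank_in S y"
    using rank_in_less_iff[OF fin assms(3,2)] by (simp add: not_less[symmetric])
  show ?thesis
  proof (cases "x \<le> y")
    case True
    then have "rank_in S x + cyc_rank n x S y = rank_in S y" using eq order by simp
    then show ?thesis using less(2) by simp
  next
    case False
    then have "rank_in S x + cyc_rank n x S y = rank_in S y + card S" using eq less by simp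
    then show ?thesis using less(2) by simp
  qed
qed

lemma mod_add_right_cancel_less:
  fixes x y c m :: nat
  assumes "(x + c) mod m = (y + c) mod m" "x < m" "y < m"
  shows "x = y"
proof -
  obtain a b where "x + c + m * a = y + c + m * b" using assms(1) nat_mod_eq_iff[of "x + c" m "y + c"] by auto
  then have "x + m * a = y + m * b" by simp
  then have "x mod m = y mod m" using nat_mod_eq_iff[of x m y] by blast
  then show ?thesis using assms(2,3) by simp
qed

lemma cyclically_decreasing_const:
  fixes f :: "nat \<Rightarrow> nat"
  assumes step: "\<And>y. y < m \<Longrightarrow> f (Suc y mod m) \<le> f y" and "y < m"
  shows "f y = f 0"
proof (rule antisym)
  have mono: "f z \<le> f y" if "y \<le> z" "z < m" for y z
    using that
  proof (induction z rule: dec_induct)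
    case (step z)
    then show ?case using assms(1)[of z] by simp
  qed simp
  show "f y \<le> f 0" using mono[of 0 y] assms(2) by simp
  have "f 0 \<le> f (m - 1)" using step[of "m - 1"] assms(2) by simp
  also have "\<dots> \<le> f y" using mono[of y "m - 1"] assms(2) by simp
  finally show "f 0 \<le> f y" .
qed

definition arc_span :: "nat \<Rightarrow> (nat \<Rightarrow> nat) \<Rightarrow> nat set \<Rightarrow> nat \<Rightarrow> nat" where
  "arc_span n w S x = cyc_rank n x S (w x)"

lemma rank_in_w_eq_shift:
  assumes "S \<subseteq> {1..n}" "w ` S = S" "x \<in> S"
  shows "rank_in S (w x) = (rank_in S x + arc_span n w S x) mod card S"
  unfolding arc_span_def by (rule rank_in_eq_cyc_rank_shift[OF assms(1,3)]) (use assms(2,3) in blast)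

text \<open>Two arcs whose heads are consecutive cannot have spans differing by exactly one, since they would
  have the same tail.\<close>

lemma arc_span_le_if_consecutive_heads:
  assumes S: "S \<subseteq> {1..n}" "w ` S = S" and ab: "a \<in> S" "b \<in> S"
    and consecutive: "rank_in S (w a) = Suc (rank_in S (w b)) mod card S"
    and span_le: "arc_span n w S a \<le> Suc (arc_span n w S b)"
  shows "arc_span n w S a \<le> arc_span n w S b"
proof (rule ccontr)
  have fin: "finite S" using S(1) by (rule finite_subset) simp
  assume "\<not> ?thesis"
  then have span: "arc_span n w S a = Suc (arc_span n w S b)" using span_le by simp
  then have "(rank_in S a + Suc (arc_span n w S b)) mod card S = (rank_in S b + Suc (arc_span n w S b)) mod card S"
    using rank_in_w_eq_shift[OF S ab(1)] rank_in_w_eq_shift[OF S ab(2)] consecutive by (simp add: mod_Suc_eq)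
  then have "rank_in S a = rank_in S b"
    by (rule mod_add_right_cancel_less) (use rank_in_less_card[OF fin] ab in auto)
  then have "a = b" using rank_in_eq_iff[OF fin ab] by simp
  then show False using span by simp
qed

lemma arc_span_const_if_decreasing:
  assumes S: "finite S" "w ` S = S" "inj_on w S"
    and decreasing: "\<And>a b. a \<in> S \<Longrightarrow> b \<in> S \<Longrightarrow> rank_in S (w a) = Suc (rank_in S (w b)) mod card S \<Longrightarrow>
      arc_span n w S a \<le> arc_span n w S b"
  obtains t where "\<And>x. x \<in> S \<Longrightarrow> arc_span n w S x = t"
proof -
  have wS: "w x \<in> S" if "x \<in> S" for x using S(2) that by blast
  have "\<exists>x\<in>S. rank_in S (w x) = y" if y: "y < card S" for y
  proof -
    have "sorted_list_of_set S ! y \<in> w ` S" using sorted_list_of_set_nth_in[OF S(1) y] S(2) by simp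
    then show ?thesis using rank_in_nth[OF S(1) y] by auto
  qed
  then obtain tail where tail: "\<And>y. y < card S \<Longrightarrow> tail y \<in> S" "\<And>y. y < card S \<Longrightarrow> rank_in S (w (tail y)) = y"
    by metis
  have "arc_span n w S (tail (Suc y mod card S)) \<le> arc_span n w S (tail y)" if y: "y < card S" for y
    by (rule decreasing) (use tail y in auto)
  then have const: "arc_span n w S (tail y) = arc_span n w S (tail 0)" if "y < card S" for y
    using cyclically_decreasing_const[where f = "\<lambda>y. arc_span n w S (tail y)", OF _ that] by blast
  have "arc_span n w S x = arc_span n w S (tail 0)" if x: "x \<in> S" for x
  proof -
    note less = rank_in_less_card[OF S(1) wS[OF x]]
    have "w (tail (rank_in S (w x))) = w x"
      using rank_in_eq_iff[OF S(1) wS[OF tail(1)[OF less]] wS[OF x]] tail(2)[OF less] by simp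
    then have "tail (rank_in S (w x)) = x" using S(3) tail(1)[OF less] x by (auto simp: inj_on_def)
    then show ?thesis using const[OF less] by simp
  qed
  then show thesis by (rule that)
qed

lemma spirograph_if_arc_span_le_Suc:
  assumes S: "S \<subseteq> {1..n}" "w ` S = S" "S \<noteq> {}" "inj_on w S" and no_fix: "\<And>x. x \<in> S \<Longrightarrow> w x \<noteq> x"
    and span_le: "\<And>a b. a \<in> S \<Longrightarrow> b \<in> S \<Longrightarrow> rank_in S (w a) = Suc (rank_in S (w b)) mod card S \<Longrightarrow>
      arc_span n w S a \<le> Suc (arc_span n w S b)"
  shows "spirograph_on w S"
proof -
  have fin: "finite S" using S(1) by (rule finite_subset) simp
  have wS: "w x \<in> S" if "x \<in> S" for x using S(2) that by blast
  have "arc_span n w S a \<le> arc_span n w S b"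
    if "a \<in> S" "b \<in> S" "rank_in S (w a) = Suc (rank_in S (w b)) mod card S" for a b
    by (rule arc_span_le_if_consecutive_heads[OF S(1,2) that span_le[OF that]])
  from arc_span_const_if_decreasing[OF fin S(2,4) this]
  obtain t where t: "\<And>x. x \<in> S \<Longrightarrow> arc_span n w S x = t" by blast
  obtain x where x: "x \<in> S" using S(3) by blast
  then have x_mem: "x \<in> {1..n}" using S(1) by blast
  have "cyc_rank n x S x = 0" using cyc_rank_eq[OF x_mem S(1) x] by simp
  then have "t \<noteq> 0"
    using cyc_rank_eq_iff[OF x_mem S(1) wS[OF x] x] no_fix[OF x] t[OF x] by (auto simp: arc_span_def)
  moreover have "t < card S" using cyc_rank_less_card[OF fin wS[OF x]] t[OF x] by (auto simp: arc_span_def)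
  moreover have "rank_in S (w x) = (rank_in S x + t) mod card S" if "x \<in> S" for x
    using rank_in_w_eq_shift[OF S(1,2) that] t[OF that] by simp
  ultimately show ?thesis unfolding spirograph_on_iff[OF fin S(2)] by (intro bexI[of _ t]) auto
qed

definition linked :: "nat set \<Rightarrow> nat set \<Rightarrow> bool" where
  "linked A B \<longleftrightarrow> (\<exists>a\<in>A. \<exists>c\<in>A. \<exists>b\<in>B. \<exists>d\<in>B. clockwise a b c \<and> clockwise a c d)"

lemma linked_sym:
  assumes "linked A B" shows "linked B A"
proof -
  obtain a c b d where chords: "a \<in> A" "c \<in> A" "b \<in> B" "d \<in> B" "clockwise a b c" "clockwise a c d"
    using assms unfolding linked_def by blast
  then have "clockwise b c d" "clockwise b d a" by (auto simp: clockwise_def)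
  then show ?thesis using chords unfolding linked_def by blast
qed

lemma linked_mono: "linked A B \<Longrightarrow> A \<subseteq> A' \<Longrightarrow> B \<subseteq> B' \<Longrightarrow> linked A' B'"
  unfolding linked_def by blast

lemma noncrossing_iff_not_linked: "noncrossing P \<longleftrightarrow> (\<forall>A\<in>P. \<forall>B\<in>P. A \<noteq> B \<longrightarrow> \<not> linked A B)"
proof
  assume noncrossing: "noncrossing P"
  have "\<not> (\<exists>a b c d. a < b \<and> b < c \<and> c < d \<and> a \<in> A \<and> c \<in> A \<and> b \<in> B \<and> d \<in> B)"
    if "A \<in> P" "B \<in> P" "A \<noteq> B" for A B
    using noncrossing[unfolded noncrossing_def, THEN bspec, OF that(1), THEN bspec, OF that(2)] that(3) by simp
  then have not_interleaved: "\<not> (a < b \<and> b < c \<and> c < d)"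
    if "A \<in> P" "B \<in> P" "A \<noteq> B" "a \<in> A" "c \<in> A" "b \<in> B" "d \<in> B" for A B a b c d
    using that by metis
  show "\<forall>A\<in>P. \<forall>B\<in>P. A \<noteq> B \<longrightarrow> \<not> linked A B"
  proof (intro ballI impI notI)
    fix A B assume AB: "A \<in> P" "B \<in> P" "A \<noteq> B" "linked A B"
    then obtain a c b d where chords: "a \<in> A" "c \<in> A" "b \<in> B" "d \<in> B" "clockwise a b c" "clockwise a c d"
      unfolding linked_def by blast
    from chords(5,6) have "a < b \<and> b < c \<and> c < d \<or> b < c \<and> c < d \<and> d < a \<or> c < d \<and> d < a \<and> a < b \<or> d < a \<and> a < b \<and> b < c"
      by (auto simp: clockwise_def)
    then show False
      using not_interleaved[OF AB(1-3) chords(1,2,3,4)] not_interleaved[OF AB(2,1) AB(3)[symmetric] chords(3,4,2,1)]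
        not_interleaved[OF AB(1-3) chords(2,1,4,3)] not_interleaved[OF AB(2,1) AB(3)[symmetric] chords(4,3,1,2)] by blast
  qed
next
  assume not_interleaved: "\<forall>A\<in>P. \<forall>B\<in>P. A \<noteq> B \<longrightarrow> \<not> linked A B"
  have "linked A B" if "a < b" "b < c" "c < d" "a \<in> A" "c \<in> A" "b \<in> B" "d \<in> B" for A B a b c d
  proof -
    have "clockwise a b c" "clockwise a c d" using that(1-3) by (auto simp: clockwise_def)
    then show ?thesis using that(4-7) unfolding linked_def by blast
  qed
  then show "noncrossing P" using not_interleaved unfolding noncrossing_def by metis
qed

lemma noncrossing_Un:
  assumes "noncrossing P" "noncrossing Q" "\<not> linked (\<Union>P) (\<Union>Q)"
  shows "noncrossing (P \<union> Q)"
proof -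
  have PQ: "\<not> linked A B" if "A \<in> P" "B \<in> Q" for A B
    using linked_mono[of A B "\<Union>P" "\<Union>Q"] that assms(3) by blast
  then have "\<not> linked B A" if "A \<in> P" "B \<in> Q" for A B using that linked_sym by blast
  then show ?thesis using PQ assms(1,2) unfolding noncrossing_iff_not_linked by blast
qed

lemma partition_on_Un:
  assumes "partition_on T P" "partition_on U Q" "T \<inter> U = {}"
  shows "partition_on (T \<union> U) (P \<union> Q)"
proof -
  have "disjoint (P \<union> Q)"
    by (rule disjoint_union) (use assms in \<open>auto simp: partition_on_def\<close>)
  then show ?thesis using assms(1,2) by (auto simp: partition_on_def)
qed

context decorated_perm
begin

text \<open>The permutation of \<open>S\<close>, read in the cyclic positions counted from \<open>a\<close>.\<close>

definition chord_map :: "nat set \<Rightarrow> nat \<Rightarrow> nat \<Rightarrow> nat" where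
  "chord_map S a i = cyc_rank n a S (w (inv_into S (cyc_rank n a S) i))"

context
  fixes S :: "nat set" and a :: nat
  assumes S: "S \<subseteq> {1..n}" "w ` S = S" and a: "a \<in> S"
    and no_fix: "x \<in> S \<Longrightarrow> w x \<noteq> x"
begin

lemma a_mem: "a \<in> {1..n}" and finite_S: "finite S" and w_in_S: "x \<in> S \<Longrightarrow> w x \<in> S"
  using S a finite_subset[OF S(1)] by auto

lemmas position_bij = bij_betw_cyc_rank[OF a_mem S(1)]
lemmas position_eq_iff = cyc_rank_eq_iff[OF a_mem S(1)]

lemma position_cases:
  assumes "i < card S" obtains x where "x \<in> S" "i = cyc_rank n a S x"
  using assms position_bij by (auto simp: bij_betw_def image_iff)

lemma chord_map_position: "x \<in> S \<Longrightarrow> chord_map S a (cyc_rank n a S x) = cyc_rank n a S (w x)"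
  using position_bij by (simp add: chord_map_def bij_betw_def)

lemma bij_betw_chord_map: "bij_betw (chord_map S a) {..<card S} {..<card S}"
proof -
  have "bij_betw w S S" using S(2) inj_on_w by (simp add: bij_betw_def)
  then have "bij_betw (cyc_rank n a S \<circ> (w \<circ> inv_into S (cyc_rank n a S))) {..<card S} {..<card S}"
    using position_bij bij_betw_inv_into[OF position_bij] by (blast intro: bij_betw_trans)
  then show ?thesis by (simp add: chord_map_def[abs_def] comp_def)
qed

lemma chord_crossing_position_iff:
  assumes "x \<in> S" "y \<in> S"
  shows "chord_crossing (chord_map S a) (cyc_rank n a S x) (cyc_rank n a S y) \<longleftrightarrow> crossing w C x y"
proof -
  have mem: "x \<in> {1..n}" "y \<in> {1..n}" using S(1) assms by auto
  show ?thesis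
    using assms w_in_S no_fix[OF assms(1)] unfolding chord_crossing_def crossing_iff[OF mem]
    by (simp add: chord_map_position position_eq_iff clockwise_cyc_rank[OF a_mem S(1)])
qed

lemma chord_alignment_position_iff:
  assumes "x \<in> S" "y \<in> S"
  shows "chord_alignment (chord_map S a) (cyc_rank n a S x) (cyc_rank n a S y) \<longleftrightarrow> alignment w C x y"
proof (cases "x = y")
  case False
  have mem: "x \<in> {1..n}" "y \<in> {1..n}" using S(1) assms by auto
  show ?thesis
    using False assms w_in_S no_fix left_of_tail_iff[OF mem] left_of_tail_iff[OF mem(2,1)]
    unfolding chord_alignment_def alignment_def chord_crossing_position_iff[OF assms]
    by (simp add: chord_map_position position_eq_iff clockwise_cyc_rank[OF a_mem S(1)])
qed (simp add: chord_alignment_def alignment_def)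

lemma not_chord_crossing_if_uncrossed:
  assumes uncrossed and less: "i < card S" "j < card S" "h < card S"
    and chords: "chord_alignment (chord_map S a) i j" "chord_crossing (chord_map S a) h i"
  shows "\<not> chord_crossing (chord_map S a) h j"
proof -
  obtain x where x: "x \<in> S" "i = cyc_rank n a S x" by (rule position_cases[OF less(1)])
  obtain y where y: "y \<in> S" "j = cyc_rank n a S y" by (rule position_cases[OF less(2)])
  obtain z where z: "z \<in> S" "h = cyc_rank n a S z" by (rule position_cases[OF less(3)])
  have "alignment w C x y" "crossing w C z x"
    using chords x y z chord_alignment_position_iff chord_crossing_position_iff by auto
  then have "\<not> crossing w C z y"
    using assms(1) x(1) y(1) z(1) S(1) unfolding crossed_alignment_def by blast
  then show ?thesis using chord_crossing_position_iff[OF z(1) y(1)] y(2) z(2) by simp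
qed

lemma adjacent_heads_chord_map:
  assumes uncrossed and b: "b \<in> S" and adjacent: "rank_in S (w a) = Suc (rank_in S (w b)) mod card S"
    and span: "Suc (arc_span n w S b) < arc_span n w S a"
  shows "adjacent_heads (chord_map S a) (card S) (cyc_rank n a S b) (cyc_rank n a S (w b))"
proof
  let ?p = "cyc_rank n a S" and ?u = "chord_map S a"
  show "bij_betw ?u {..<card S} {..<card S}" by (rule bij_betw_chord_map)
  show "\<not> chord_crossing ?u h j" if "i < card S" "j < card S" "h < card S"
      "chord_alignment ?u i j" "chord_crossing ?u h i" for i j h
    by (rule not_chord_crossing_if_uncrossed[OF \<open>uncrossed\<close> that])
  have rank: "?p x < card S" if "x \<in> S" for x using cyc_rank_less_card[OF finite_S that] .
  have p_a: "?p a = 0" using cyc_rank_eq[OF a_mem S(1) a] by simp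
  have "?p (w a) = (?p (w b) + 1) mod card S"
    using cyc_rank_rotation[OF a_mem S(1) w_in_S[OF b] w_in_S[OF a], of 1] adjacent by simp
  then have head_a: "?p (w a) = Suc (?p (w b))"
    using span rank[OF w_in_S[OF b]] by (auto simp: arc_span_def mod_Suc split: if_splits)
  let ?s = "arc_span n w S b"
  have "?p (w b) = (?p b + ?s) mod card S"
    by (rule cyc_rank_rotation[OF a_mem S(1) b w_in_S[OF b] rank_in_w_eq_shift[OF S b]])
  moreover have less: "?s < ?p (w b)" using span head_a by (simp add: arc_span_def)
  moreover have "?s < card S" unfolding arc_span_def by (rule cyc_rank_less_card[OF finite_S w_in_S[OF b]])
  ultimately have head_b: "?p (w b) = ?p b + ?s" using rank[OF b]
    by (cases "?p b + ?s < card S") (simp_all add: le_mod_geq)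
  then show "0 < ?p b" using less by simp
  have "?p b \<noteq> ?p (w b)" using position_eq_iff[OF b w_in_S[OF b]] no_fix[OF b] by auto
  then show "?p b < ?p (w b)" using head_b by simp
  show "?u (?p b) = ?p (w b)" "?u 0 = Suc (?p (w b))" "Suc (?p (w b)) < card S"
    using chord_map_position[OF b] chord_map_position[OF a] p_a head_a rank[OF w_in_S[OF a]] by auto
qed

end

definition unsplittable :: "nat set \<Rightarrow> bool" where
  "unsplittable S \<longleftrightarrow> (\<forall>T. T \<subseteq> S \<and> T \<noteq> {} \<and> T \<noteq> S \<and> w ` T = T \<longrightarrow> linked T (S - T))"

lemma no_fixed_point_if_unsplittable:
  assumes "unsplittable S" "card S \<noteq> 1" "x \<in> S"
  shows "w x \<noteq> x"
proof
  assume "w x = x"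
  moreover have "{x} \<noteq> S" using assms(2) by auto
  ultimately have "linked {x} (S - {x})" using assms(1,3) unfolding unsplittable_def by simp
  then show False by (auto simp: linked_def clockwise_def)
qed

lemma not_linked_cyclic_interval:
  fixes c d :: nat
  assumes "r \<in> {1..n}" "S \<subseteq> {1..n}"
  defines "T \<equiv> {x \<in> S. cyc_rank n r S x \<in> {c..d}}"
  shows "\<not> linked T (S - T)"
proof
  assume "linked T (S - T)"
  then obtain x1 x2 y1 y2 where chords: "x1 \<in> T" "x2 \<in> T" "y1 \<in> S - T" "y2 \<in> S - T"
    "clockwise x1 y1 x2" "clockwise x1 x2 y2" unfolding linked_def by blast
  then have "clockwise (cyc_rank n r S x1) (cyc_rank n r S y1) (cyc_rank n r S x2)"
    "clockwise (cyc_rank n r S x1) (cyc_rank n r S x2) (cyc_rank n r S y2)"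
    using clockwise_cyc_rank[OF assms(1,2)] by (auto simp: T_def)
  then show False using chords(1-4) by (auto simp: T_def clockwise_def)
qed

lemma arc_span_le_Suc_if_unsplittable:
  assumes S: "S \<subseteq> {1..n}" "w ` S = S" and unsplittable: "unsplittable S" "card S \<noteq> 1" and uncrossed
    and ab: "a \<in> S" "b \<in> S" "rank_in S (w a) = Suc (rank_in S (w b)) mod card S"
  shows "arc_span n w S a \<le> Suc (arc_span n w S b)"
proof (rule ccontr)
  let ?p = "cyc_rank n a S"
  note no_fix = no_fixed_point_if_unsplittable[OF unsplittable]
  note chords = S ab(1) no_fix
  assume "\<not> arc_span n w S a \<le> Suc (arc_span n w S b)"
  then interpret adjacent_heads "chord_map S a" "card S" "?p b" "?p (w b)"
    using adjacent_heads_chord_map[OF chords \<open>uncrossed\<close> ab(2,3)] by simp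
  obtain c where c: "c \<in> {1..?p (w b)}" "chord_map S a ` {c..?p (w b)} \<subseteq> {c..?p (w b)}"
    using ex_invariant_interval by blast
  define T where "T = {x \<in> S. ?p x \<in> {c..?p (w b)}}"
  have "w ` T \<subseteq> T"
  proof
    fix y assume "y \<in> w ` T"
    then obtain x where x: "x \<in> S" "?p x \<in> {c..?p (w b)}" "y = w x" by (auto simp: T_def)
    then have "chord_map S a (?p x) \<in> {c..?p (w b)}" using c(2) by blast
    then show "y \<in> T" using x S(2) chord_map_position[OF chords x(1)] by (auto simp: T_def)
  qed
  moreover have "finite T" using finite_subset[OF S(1)] by (simp add: T_def)
  ultimately have "w ` T = T" by (intro card_subset_eq card_image inj_on_w)
  moreover have "w b \<in> T" using S(2) ab(2) c(1) by (auto simp: T_def)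
  moreover have "?p a = 0" using cyc_rank_eq[OF _ S(1) ab(1), of a] S(1) ab(1) by auto
  then have "a \<notin> T" using c(1) by (simp add: T_def)
  moreover have "T \<subseteq> S" by (auto simp: T_def)
  ultimately have "linked T (S - T)" using unsplittable(1) ab(1) unfolding unsplittable_def by blast
  then show False using not_linked_cyclic_interval[OF _ S(1), of a] S(1) ab(1) unfolding T_def by blast
qed

lemma proper_spirograph_if_unsplittable:
  assumes S: "S \<subseteq> {1..n}" "w ` S = S" "S \<noteq> {}" and "unsplittable S" uncrossed
  shows "proper_spirograph w S"
proof (cases "card S = 1")
  case True
  then show ?thesis using S(2) proper_spirograph_singleton by (auto simp: card_1_singleton_iff)
next
  case False
  note no_fix = no_fixed_point_if_unsplittable[OF \<open>unsplittable S\<close> False]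
  have "spirograph_on w S"
    by (rule spirograph_if_arc_span_le_Suc[OF S inj_on_w])
      (use no_fix arc_span_le_Suc_if_unsplittable[OF S(1,2) \<open>unsplittable S\<close> False \<open>uncrossed\<close>] in auto)
  then show ?thesis using S(2) no_fix by (simp add: proper_spirograph_def)
qed

lemma ex_proper_spirograph_partition:
  assumes "S \<subseteq> {1..n}" "w ` S = S" uncrossed
  shows "\<exists>P. partition_on S P \<and> noncrossing P \<and> (\<forall>B\<in>P. proper_spirograph w B)"
  using assms(1,2)
proof (induction "card S" arbitrary: S rule: less_induct)
  case less
  have fin: "finite S" using less.prems(1) by (rule finite_subset) simp
  consider (empty) "S = {}" | (unsplittable) "S \<noteq> {}" "unsplittable S"
    | (split) T where "T \<subseteq> S" "T \<noteq> {}" "T \<noteq> S" "w ` T = T" "\<not> linked T (S - T)"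
    unfolding unsplittable_def by blast
  then show ?case
  proof cases
    case empty
    then show ?thesis by (intro exI[of _ "{}"]) (auto simp: partition_on_def noncrossing_def)
  next
    case unsplittable
    then show ?thesis
      using proper_spirograph_if_unsplittable[OF less.prems _ _ \<open>uncrossed\<close>] partition_on_space[of S]
      by (intro exI[of _ "{S}"]) (auto simp: noncrossing_def)
  next
    case split
    have "w ` (S - T) = S - T"
      using image_set_diff[OF permutes_inj[OF perm], of S T] split(4) less.prems(2) by simp
    moreover have "card (S - T) < card S" "card T < card S"
      using split(1-3) fin by (auto intro: psubset_card_mono)
    ultimately obtain P Q where P: "partition_on T P" "noncrossing P" "\<forall>B\<in>P. proper_spirograph w B"
      and Q: "partition_on (S - T) Q" "noncrossing Q" "\<forall>B\<in>Q. proper_spirograph w B"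
      using less.hyps[of T] less.hyps[of "S - T"] less.prems split(1,4) by blast
    have "partition_on S (P \<union> Q)" using partition_on_Un[OF P(1) Q(1)] split(1) by (simp add: Un_absorb1)
    moreover have "noncrossing (P \<union> Q)"
      using split(5) P Q by (intro noncrossing_Un) (simp_all add: partition_on_def)
    ultimately show ?thesis using P(3) Q(3) by blast
  qed
qed

lemma union_of_spirographs_if_uncrossed:
  assumes uncrossed
  shows "union_of_spirographs n w"
proof -
  obtain P where "partition_on {1..n} P" "noncrossing P" "\<forall>B\<in>P. proper_spirograph w B"
    using ex_proper_spirograph_partition[OF order_refl permutes_image[OF perm] assms]
    by (elim exE conjE) (rule that)
  then show ?thesis
    unfolding union_of_spirographs_def proper_spirograph_def by (intro exI[of _ P] conjI) simp_all
qed

end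

section \<open>Arcs of spirographs\<close>

lemma clockwise_eq_if_not_linked:
  assumes "\<not> linked A B" "A \<inter> B = {}" "x \<in> A" "x' \<in> A" "y \<in> B" "y' \<in> B"
  shows "clockwise x y x' = clockwise x y' x'"
proof -
  have "clockwise x z' x'" if z: "clockwise x z x'" "z \<in> B" "z' \<in> B" for z z'
  proof (rule ccontr)
    assume "\<not> clockwise x z' x'"
    moreover have "z' \<noteq> x" "z' \<noteq> x'" "x \<noteq> x'" using assms(2-4) z by (auto simp: clockwise_def)
    ultimately have "clockwise x x' z'" by (auto simp: clockwise_def)
    then show False using assms(1,3,4) z unfolding linked_def by blast
  qed
  then show ?thesis using assms(5,6) by blast
qed

lemma rotation_wraps_iff:
  fixes a t m :: nat
  assumes "a < m" "t < m"
  shows "(a + t) mod m < a \<longleftrightarrow> (a + t) mod m < t"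
proof (cases "a + t < m")
  case False
  then have "(a + t) mod m = a + t - m" using assms by (simp add: le_mod_geq)
  then show ?thesis using False assms by linarith
qed simp

context decorated_perm
begin

lemma no_alignment_in_spirograph:
  assumes B: "B \<subseteq> {1..n}" "w ` B = B" and spirograph: "spirograph_on w B"
    and ij: "i \<in> B" "j \<in> B" and moved: "w i \<noteq> i" "w j \<noteq> j"
  shows "\<not> alignment w C i j"
proof
  assume aligned: "alignment w C i j"
  have fin: "finite B" using B(1) by (rule finite_subset) simp
  have mem: "i \<in> {1..n}" "j \<in> {1..n}" and wB: "w i \<in> B" "w j \<in> B" using B ij by auto
  let ?p = "cyc_rank n i B" and ?m = "card B"
  obtain t where t: "0 < t" "t < ?m" "\<And>x. x \<in> B \<Longrightarrow> rank_in B (w x) = (rank_in B x + t) mod ?m"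
    by (rule rank_in_rotation_less_card[OF fin B(2) spirograph ij(1) moved(1)]) blast
  have p_i: "?p i = 0" using cyc_rank_eq[OF mem(1) B(1) ij(1)] by simp
  have p_wi: "?p (w i) = t"
    using cyc_rank_rotation[OF mem(1) B(1) ij(1) wB(1) t(3)[OF ij(1)]] p_i t(2) by simp
  have p_wj: "?p (w j) = (?p j + t) mod ?m"
    by (rule cyc_rank_rotation[OF mem(1) B(1) ij(2) wB(2) t(3)[OF ij(2)]])
  have p_j: "?p j < ?m" by (rule cyc_rank_less_card[OF fin ij(2)])
  have ne: "i \<noteq> j" and uncrossed_pair: "w i \<noteq> j" "w j \<noteq> i" "clockwise i j (w i) = clockwise i (w j) (w i)"
    and opposite: "clockwise i j (w i) \<noteq> clockwise j i (w j)"
    using aligned moved left_of_tail_iff[OF mem] left_of_tail_iff[OF mem(2,1)] crossing_iff[OF mem]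
    unfolding alignment_def by auto
  note eq_iff = cyc_rank_eq_iff[OF mem(1) B(1)]
  have distinct: "0 < ?p j" "?p j \<noteq> t" "0 < ?p (w j)"
    using eq_iff[OF ij(2,1)] eq_iff[OF ij(2) wB(1)] eq_iff[OF wB(2) ij(1)] ne uncrossed_pair(1,2) p_i p_wi by auto
  note turn = clockwise_cyc_rank[OF mem(1) B(1), symmetric]
  have "clockwise i j (w i) \<longleftrightarrow> ?p j < t" "clockwise i (w j) (w i) \<longleftrightarrow> ?p (w j) < t"
    "clockwise j i (w j) \<longleftrightarrow> ?p (w j) < ?p j"
    unfolding turn[OF ij(1,2) wB(1)] turn[OF ij(1) wB(2,1)] turn[OF ij(2,1) wB(2)] p_i p_wi
    using distinct by (simp_all add: clockwise_def)
  then have "?p (w j) < ?p j \<longleftrightarrow> \<not> ?p (w j) < t" using uncrossed_pair(3) opposite by blast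
  then show False using rotation_wraps_iff[OF p_j t(2)] unfolding p_wj by blast
qed

lemma same_block_if_crossing:
  assumes P: "partition_on {1..n} P" "noncrossing P" "\<And>B. B \<in> P \<Longrightarrow> w ` B = B"
    and crossing: "crossing w C i j" and A: "A \<in> P" "i \<in> A" and B: "B \<in> P" "j \<in> B"
  shows "A = B"
proof (rule ccontr)
  assume ne: "A \<noteq> B"
  have disjoint: "A \<inter> B = {}" using P(1) A(1) B(1) ne by (auto simp: partition_on_def disjoint_def)
  have mem: "i \<in> {1..n}" "j \<in> {1..n}" using P(1) A B by (auto simp: partition_on_def)
  have w: "w i \<in> A" "w j \<in> B" using P(3) A B by auto
  have "\<not> linked A B" using P(2) A(1) B(1) ne unfolding noncrossing_iff_not_linked by blast
  then have "clockwise i j (w i) = clockwise i (w j) (w i)"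
    by (rule clockwise_eq_if_not_linked[OF _ disjoint A(2) w(1) B(2) w(2)])
  then show False using crossing disjoint A(2) B(2) w unfolding crossing_iff[OF mem] by blast
qed

lemma uncrossed_if_union_of_spirographs:
  assumes "union_of_spirographs n w"
  shows uncrossed
proof clarify
  obtain P where P: "partition_on {1..n} P" "noncrossing P" and blocks: "\<And>B. B \<in> P \<Longrightarrow> w ` B = B"
      "\<And>B. B \<in> P \<Longrightarrow> spirograph_on w B"
    using assms unfolding union_of_spirographs_def by (elim exE conjE) (rule that, auto)
  fix i j assume ij: "i \<in> {1..n}" "j \<in> {1..n}" and "crossed_alignment n w C i j"
  then obtain h where aligned: "alignment w C i j" and h: "h \<in> {1..n}" "crossing w C h i" "crossing w C h j"
    by (auto simp: crossed_alignment_def)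
  have block: "\<exists>B\<in>P. x \<in> B" if "x \<in> {1..n}" for x using P(1) that unfolding partition_on_def by blast
  obtain A where A: "A \<in> P" "h \<in> A" using block h(1) by blast
  have "i \<in> A" "j \<in> A"
    using block ij same_block_if_crossing[OF P blocks(1) h(2) A] same_block_if_crossing[OF P blocks(1) h(3) A]
    by blast+
  moreover have "w i \<noteq> i" "w j \<noteq> j"
    using no_fixed_point_if_crossing h ij by blast+
  moreover have "A \<subseteq> {1..n}" using P(1) A(1) by (auto simp: partition_on_def)
  ultimately show False
    using no_alignment_in_spirograph[OF _ blocks(1)[OF A(1)] blocks(2)[OF A(1)]] aligned by blast
qed

lemma mem_necklace_iff_if_rotation:
  assumes B: "B \<subseteq> {1..n}" "w ` B = B" and moved: "\<And>x. x \<in> B \<Longrightarrow> w x \<noteq> x" and t: "t < card B"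
    and rotation: "\<And>x. x \<in> B \<Longrightarrow> rank_in B (w x) = (rank_in B x + t) mod card B"
    and r: "r \<in> {1..n}" and x: "x \<in> B"
  shows "x \<in> necklace r \<longleftrightarrow> cyc_rank n r B x < t"
proof -
  have fin: "finite B" using B(1) by (rule finite_subset) simp
  obtain y where y: "y \<in> B" "x = w y" using B(2) x by blast
  have yC: "y \<notin> C" "y \<in> {1..n}" using moved[OF y(1)] loops B(1) y by auto
  have rotated: "cyc_rank n r B x = (cyc_rank n r B y + t) mod card B"
    using cyc_rank_rotation[OF r B(1) y(1) x] rotation[OF y(1)] y(2) by simp
  have "x \<in> necklace r \<longleftrightarrow> cyc_pos n r x < cyc_pos n r y"
    using w_mem_necklace_iff[OF yC(2), of r] yC(1) y(2) by (simp add: decreasing_def)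
  also have "\<dots> \<longleftrightarrow> cyc_rank n r B x < cyc_rank n r B y" using cyc_rank_less_iff[OF fin x] by simp
  also have "\<dots> \<longleftrightarrow> cyc_rank n r B x < t"
    unfolding rotated by (rule rotation_wraps_iff[OF cyc_rank_less_card[OF fin y(1)] t])
  finally show ?thesis .
qed

lemma necklace_initial_on_proper_spirograph:
  assumes B: "B \<subseteq> {1..n}" "B \<noteq> {}" and spirograph: "proper_spirograph w B"
  obtains c where "c \<le> card B" "\<And>r x. r \<in> {1..n} \<Longrightarrow> x \<in> B \<Longrightarrow> x \<in> necklace r \<longleftrightarrow> cyc_rank n r B x < c"
proof (cases "card B = 1")
  case True
  then obtain x where x: "B = {x}" by (auto simp: card_1_singleton_iff)
  then have wx: "w x = x" "x \<in> {1..n}" using B spirograph by (auto simp: proper_spirograph_def)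
  have "x \<in> necklace r \<longleftrightarrow> x \<in> C" for r
    using w_mem_necklace_iff[OF wx(2), of r] wx(1) by (simp add: decreasing_def)
  then show thesis using x by (intro that[of "if x \<in> C then 1 else 0"]) (auto simp: cyc_rank_def)
next
  case False
  then have invariant: "w ` B = B" "spirograph_on w B" and moved: "\<And>x. x \<in> B \<Longrightarrow> w x \<noteq> x"
    using spirograph by (auto simp: proper_spirograph_def)
  have fin: "finite B" using B(1) by (rule finite_subset) simp
  obtain x where x: "x \<in> B" using B(2) by blast
  obtain t where t: "t < card B" "\<And>x. x \<in> B \<Longrightarrow> rank_in B (w x) = (rank_in B x + t) mod card B"
    by (rule rank_in_rotation_less_card[OF fin invariant x moved[OF x]]) blast
  show thesis
    using mem_necklace_iff_if_rotation[OF B(1) invariant(1) moved t] t(1) by (intro that[of t]) auto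
qed

lemma left_of_iff_necklace:
  assumes "x \<in> {1..n}" "y \<in> {1..n}" "x \<noteq> y" "w x \<noteq> y"
  shows "left_of w C x (arc_tail y) \<longleftrightarrow> w x \<in> necklace y"
proof -
  note wx = w_mem[OF assms(1)]
  have "clockwise x y (w x) \<longleftrightarrow> clockwise (cyc_pos n y x) 0 (cyc_pos n y (w x))"
    using clockwise_cyc_pos[OF assms(2,1,2) wx] cyc_pos_self[of n y] by simp
  moreover have "cyc_pos n y x \<noteq> 0" "cyc_pos n y (w x) \<noteq> 0"
    using cyc_pos_eq_iff[OF assms(2,1,2)] cyc_pos_eq_iff[OF assms(2) wx assms(2)] assms(3,4)
      cyc_pos_self[of n y] by auto
  ultimately have "clockwise x y (w x) \<longleftrightarrow> cyc_pos n y (w x) < cyc_pos n y x" by (auto simp: clockwise_def)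
  then show ?thesis
    unfolding left_of_tail_iff[OF assms(1-3)] w_mem_necklace_iff[OF assms(1)] decreasing_def using loops by auto
qed

end

section \<open>Direct sums of uniform matroids\<close>

lemma card_exchange_Int_eq:
  assumes "finite J" "i \<in> J" "j \<notin> J" "i \<in> B \<longleftrightarrow> j \<in> B"
  shows "card (insert j (J - {i}) \<inter> B) = card (J \<inter> B)"
proof (cases "i \<in> B")
  case True
  then have "insert j (J - {i}) \<inter> B = insert j (J \<inter> B - {i})" using assms(4) by auto
  also have "card \<dots> = Suc (card (J \<inter> B - {i}))" using assms by (intro card_insert_disjoint) auto
  also have "\<dots> = card (J \<inter> B)" using assms True by (intro card_Suc_Diff1) auto
  finally show ?thesis .
next
  case False
  then have "insert j (J - {i}) \<inter> B = J \<inter> B" using assms(4) by auto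
  then show ?thesis by simp
qed

lemma card_Int_eq_if_matching:
  assumes fin: "finite J" "finite I" and \<sigma>: "bij_betw \<sigma> (J - I) (I - J)"
    and preserves: "\<And>i. i \<in> J - I \<Longrightarrow> i \<in> B \<longleftrightarrow> \<sigma> i \<in> B"
  shows "card (I \<inter> B) = card (J \<inter> B)"
proof -
  have "\<sigma> ` {i \<in> J - I. i \<in> B} = {j \<in> I - J. j \<in> B}"
  proof
    show "\<sigma> ` {i \<in> J - I. i \<in> B} \<subseteq> {j \<in> I - J. j \<in> B}"
    proof (rule image_subsetI)
      fix i assume "i \<in> {i \<in> J - I. i \<in> B}"
      then show "\<sigma> i \<in> {j \<in> I - J. j \<in> B}" using bij_betwE[OF \<sigma>] preserves[of i] by simp
    qed
    show "{j \<in> I - J. j \<in> B} \<subseteq> \<sigma> ` {i \<in> J - I. i \<in> B}"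
    proof
      fix j assume j: "j \<in> {j \<in> I - J. j \<in> B}"
      then obtain i where "i \<in> J - I" "j = \<sigma> i" using bij_betw_imp_surj_on[OF \<sigma>] by blast
      then show "j \<in> \<sigma> ` {i \<in> J - I. i \<in> B}" using j preserves[of i] by simp
    qed
  qed
  moreover have "inj_on \<sigma> {i \<in> J - I. i \<in> B}" using bij_betw_imp_inj_on[OF \<sigma>] by (rule inj_on_subset) blast
  ultimately have matched: "card {j \<in> I - J. j \<in> B} = card {i \<in> J - I. i \<in> B}"
    using card_image[of \<sigma> "{i \<in> J - I. i \<in> B}"] by simp
  have split: "card (K \<inter> B) = card (K \<inter> K' \<inter> B) + card {x \<in> K - K'. x \<in> B}" if "finite K" for K K'
  proof -
    have "K \<inter> B \<inter> K' = K \<inter> K' \<inter> B" "K \<inter> B - K' = {x \<in> K - K'. x \<in> B}" by auto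
    then show ?thesis using card_Int_Diff[of "K \<inter> B" K'] that by simp
  qed
  show ?thesis using split[OF fin(2), of J] split[OF fin(1), of I] matched by (simp add: Int_commute)
qed

locale block_positroid = positroid_data +
  fixes P :: "nat set set" and \<kappa> :: "nat set \<Rightarrow> nat"
  assumes part: "partition_on {1..n} P"
    and invariant: "\<And>B. B \<in> P \<Longrightarrow> w ` B = B"
    and \<kappa>_le: "\<And>B. B \<in> P \<Longrightarrow> \<kappa> B \<le> card B"
    and initial: "\<And>r B x. r \<in> {1..n} \<Longrightarrow> B \<in> P \<Longrightarrow> x \<in> B \<Longrightarrow> x \<in> necklace r \<longleftrightarrow> cyc_rank n r B x < \<kappa> B"
begin

lemma block_subset: "B \<in> P \<Longrightarrow> B \<subseteq> {1..n}"
  using part by (auto simp: partition_on_def)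

lemma block_nonempty: "B \<in> P \<Longrightarrow> B \<noteq> {}"
  using part by (auto simp: partition_on_def)

lemma block_finite: "B \<in> P \<Longrightarrow> finite B"
  using block_subset finite_subset by blast

lemma blocks_finite: "finite P"
  using part finite_elements[of "{1..n}" P] by simp

lemma block_eq: "A \<in> P \<Longrightarrow> B \<in> P \<Longrightarrow> x \<in> A \<Longrightarrow> x \<in> B \<Longrightarrow> A = B"
  using part by (auto simp: partition_on_def disjoint_def)

lemma w_in_block: "B \<in> P \<Longrightarrow> x \<in> B \<Longrightarrow> w x \<in> B"
  using invariant by blast

definition block_of :: "nat \<Rightarrow> nat set" where
  "block_of x = (THE B. B \<in> P \<and> x \<in> B)"

lemma block_of_eq: "B \<in> P \<Longrightarrow> x \<in> B \<Longrightarrow> block_of x = B"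
  unfolding block_of_def using block_eq by (intro the_equality) auto

lemma block_of: "x \<in> {1..n} \<Longrightarrow> block_of x \<in> P \<and> x \<in> block_of x"
  using part block_of_eq unfolding partition_on_def by blast

lemma mem_block_iff: "B \<in> P \<Longrightarrow> x \<in> {1..n} \<Longrightarrow> x \<in> B \<longleftrightarrow> block_of x = B"
  using block_of block_of_eq by blast

lemma card_blocks:
  assumes "A \<subseteq> {1..n}" shows "card A = (\<Sum>B\<in>P. card (A \<inter> B))"
proof -
  have "A = (\<Union>B\<in>P. A \<inter> B)" using assms part by (auto simp: partition_on_def)
  then have "card A = card (\<Union>B\<in>P. A \<inter> B)" by simp
  also have "\<dots> = (\<Sum>B\<in>P. card (A \<inter> B))"
    using blocks_finite block_finite block_eq by (intro card_UN_disjoint) auto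
  finally show ?thesis .
qed

lemma card_necklace_block:
  assumes "r \<in> {1..n}" "B \<in> P" shows "card (necklace r \<inter> B) = \<kappa> B"
proof -
  have "necklace r \<inter> B = {x \<in> B. cyc_rank n r B x < \<kappa> B}" using initial[OF assms] by auto
  then show ?thesis using card_cyc_rank_less[OF assms(1) block_subset[OF assms(2)] \<kappa>_le[OF assms(2)]] by simp
qed

lemma card_necklace_prefix_block:
  assumes r: "r \<in> {1..n}" and B: "B \<in> P"
  shows "card (necklace r \<inter> cyc_prefix n r b \<inter> B) = min (\<kappa> B) (card (cyc_prefix n r b \<inter> B))"
proof (cases "cyc_prefix n r b \<inter> B \<subseteq> necklace r")
  case True
  then have Int_eq: "necklace r \<inter> cyc_prefix n r b \<inter> B = cyc_prefix n r b \<inter> B" by auto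
  have "card (cyc_prefix n r b \<inter> B) \<le> \<kappa> B"
    unfolding card_necklace_block[OF assms, symmetric] using True by (intro card_mono) auto
  then show ?thesis using Int_eq by simp
next
  case False
  then obtain x where x: "x \<in> B" "x \<in> cyc_prefix n r b" "x \<notin> necklace r" by auto
  have "y \<in> cyc_prefix n r b" if y: "y \<in> necklace r" "y \<in> B" for y
  proof -
    have "cyc_rank n r B y < cyc_rank n r B x" using initial[OF r B] x y by auto
    then have "cyc_pos n r y < cyc_pos n r x" using cyc_rank_less_iff[OF block_finite[OF B]] y by auto
    then show ?thesis using x(2) y(1) necklace_subset[of r] by (auto simp: mem_cyc_prefix_iff)
  qed
  then have Int_eq: "necklace r \<inter> cyc_prefix n r b \<inter> B = necklace r \<inter> B" by auto
  have "card (necklace r \<inter> cyc_prefix n r b \<inter> B) \<le> card (cyc_prefix n r b \<inter> B)"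
    by (intro card_mono) auto
  then show ?thesis using Int_eq card_necklace_block[OF assms] by simp
qed

lemma card_prefix_block_le:
  assumes "r \<in> {1..n}" "B \<in> P" "card (I \<inter> B) \<le> \<kappa> B"
  shows "card (I \<inter> cyc_prefix n r b \<inter> B) \<le> card (necklace r \<inter> cyc_prefix n r b \<inter> B)"
proof -
  have "card (I \<inter> cyc_prefix n r b \<inter> B) \<le> card (I \<inter> B)" "card (I \<inter> cyc_prefix n r b \<inter> B) \<le> card (cyc_prefix n r b \<inter> B)"
    using block_finite[OF assms(2)] by (auto intro: card_mono)
  then show ?thesis using assms(3) unfolding card_necklace_prefix_block[OF assms(1,2)] by simp
qed

lemma in_M_if_block_cards:
  assumes I: "I \<in> ksubsets n k" and cards: "\<And>B. B \<in> P \<Longrightarrow> card (I \<inter> B) = \<kappa> B"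
  shows "I \<in> M"
  unfolding mem_M_iff
proof (intro conjI I ballI allI)
  fix r b assume r: "r \<in> {1..n}"
  have subset: "K \<inter> cyc_prefix n r b \<subseteq> {1..n}" for K using cyc_prefix_subset by blast
  show "card (I \<inter> cyc_prefix n r b) \<le> card (necklace r \<inter> cyc_prefix n r b)"
    unfolding card_blocks[OF subset] using cards by (intro sum_mono card_prefix_block_le[OF r]) auto
qed

definition saturated :: "nat set \<Rightarrow> bool" where
  "saturated A \<longleftrightarrow> (\<forall>B\<in>P. B \<subseteq> A \<or> B \<inter> A = {})"

lemma card_Int_saturated:
  assumes "saturated A" "K \<subseteq> {1..n}"
  shows "card (K \<inter> A) = (\<Sum>B\<in>{B \<in> P. B \<subseteq> A}. card (K \<inter> B))"
proof -
  have "card (K \<inter> A) = (\<Sum>B\<in>P. card (K \<inter> A \<inter> B))" using assms(2) by (intro card_blocks) auto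
  also have "\<dots> = (\<Sum>B\<in>P. if B \<subseteq> A then card (K \<inter> B) else 0)"
  proof (rule sum.cong[OF refl])
    fix B assume "B \<in> P"
    then have "B \<subseteq> A \<or> B \<inter> A = {}" using assms(1) by (simp add: saturated_def)
    then have "K \<inter> A \<inter> B = (if B \<subseteq> A then K \<inter> B else {})" by auto
    then show "card (K \<inter> A \<inter> B) = (if B \<subseteq> A then card (K \<inter> B) else 0)" by simp
  qed
  also have "\<dots> = (\<Sum>B\<in>{B \<in> P. B \<subseteq> A}. card (K \<inter> B))"
    using blocks_finite by (simp add: sum.inter_filter)
  finally show ?thesis .
qed

lemma card_necklace_saturated_eq:
  assumes "saturated A" "r \<in> {1..n}" "r' \<in> {1..n}"
  shows "card (necklace r \<inter> A) = card (necklace r' \<inter> A)"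
  using assms by (simp add: card_Int_saturated[OF _ necklace_subset] card_necklace_block)

text \<open>The complement of a cyclic prefix is again a cyclic prefix, which turns the inequality that defines
  the positroid into an equality.\<close>

lemma card_saturated_prefix_eq:
  assumes I: "I \<in> M" and r: "r \<in> {1..n}" and saturated: "saturated (cyc_prefix n r b)"
  shows "card (I \<inter> cyc_prefix n r b) = card (necklace r \<inter> cyc_prefix n r b)"
proof -
  note I' = M_D[OF I]
  have card_eq: "card I = card (necklace r)" using I'(2) card_necklace[OF r] card_anti_exceedances by simp
  show ?thesis
  proof (cases "Suc b < n")
    case False
    then have "cyc_prefix n r b = {1..n}" using r by (intro cyc_prefix_eq_all) auto
    then show ?thesis using card_eq I'(1) necklace_subset[of r] by (simp add: Int_absorb2)
  next
    case True
    obtain r' b' where r': "r' \<in> {1..n}" and complement: "cyc_prefix n r' b' = {1..n} - cyc_prefix n r b"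
      using cyc_prefix_complement[OF r True] .
    have "saturated (cyc_prefix n r' b')"
      using saturated block_subset unfolding complement saturated_def by blast
    then have "card (I \<inter> cyc_prefix n r' b') \<le> card (necklace r \<inter> cyc_prefix n r' b')"
      using I r' card_necklace_saturated_eq[OF _ r' r] unfolding mem_M_iff by metis
    moreover have "card (I \<inter> cyc_prefix n r b) \<le> card (necklace r \<inter> cyc_prefix n r b)"
      using I r unfolding mem_M_iff by blast
    moreover have "card K = card (K \<inter> cyc_prefix n r b) + card (K \<inter> cyc_prefix n r' b')"
      if "K \<subseteq> {1..n}" for K
    proof -
      have "K \<inter> cyc_prefix n r' b' = K - cyc_prefix n r b" using that unfolding complement by auto
      then show ?thesis using card_Int_Diff[of K "cyc_prefix n r b"] that finite_subset by fastforce
    qed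
    ultimately show ?thesis using card_eq I'(1) necklace_subset[of r] by fastforce
  qed
qed

lemma sum_block_ranks: "(\<Sum>B\<in>P. \<kappa> B) = k"
proof (cases "n = 0")
  case True
  then have "P = {}" using part by (simp add: partition_on_empty)
  then show ?thesis using k_le_n True by simp
next
  case False
  then have first: "1 \<in> {1..n}" by simp
  have "k = card (necklace 1)" using card_necklace[OF first] card_anti_exceedances by simp
  also have "\<dots> = (\<Sum>B\<in>P. \<kappa> B)"
    unfolding card_blocks[OF necklace_subset] by (intro sum.cong refl card_necklace_block[OF first])
  finally show ?thesis by simp
qed

lemma Union_block_subsets:
  assumes S: "\<And>B. B \<in> P \<Longrightarrow> S B \<subseteq> B" "\<And>B. B \<in> P \<Longrightarrow> card (S B) = \<kappa> B"
  shows "B \<in> P \<Longrightarrow> \<Union>(S ` P) \<inter> B = S B" "\<Union>(S ` P) \<in> ksubsets n k"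
proof -
  show Int: "\<Union>(S ` P) \<inter> B = S B" if B: "B \<in> P" for B
  proof
    show "\<Union>(S ` P) \<inter> B \<subseteq> S B"
    proof
      fix x assume x: "x \<in> \<Union>(S ` P) \<inter> B"
      then obtain A where A: "A \<in> P" "x \<in> S A" by blast
      then have "A = B" using S(1)[OF A(1)] x B by (intro block_eq[of A B x]) auto
      then show "x \<in> S B" using A(2) by simp
    qed
    show "S B \<subseteq> \<Union>(S ` P) \<inter> B" using S(1)[OF B] B by blast
  qed
  have subset: "\<Union>(S ` P) \<subseteq> {1..n}" using S(1) block_subset by blast
  have "card (\<Union>(S ` P)) = k"
    unfolding card_blocks[OF subset] sum_block_ranks[symmetric] using Int S(2) by (intro sum.cong refl) simp
  then show "\<Union>(S ` P) \<in> ksubsets n k" using subset by (simp add: ksubsets_def)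
qed

lemma card_crossing_exchange_le:
  fixes r m defines "X \<equiv> cyc_prefix n r m"
  assumes r: "r \<in> {1..n}" and AB: "A \<in> P" "B \<in> P" "A \<noteq> B"
    and cards: "card (J \<inter> A) = \<kappa> A" "card (J \<inter> B) = \<kappa> B"
    and order: "a < b" "b < c" "c < d"
    and a: "a \<in> A" "a \<in> J" and b: "b \<in> B" "b \<notin> J" and c: "c \<in> A" "c \<notin> J" and d: "d \<in> B" "d \<in> J"
  defines "I \<equiv> insert b (J - {a})"
  shows "card (I \<inter> X \<inter> A) + card (I \<inter> X \<inter> B) \<le>
    card (necklace r \<inter> X \<inter> A) + card (necklace r \<inter> X \<inter> B)"
proof -
  have disjoint: "A \<inter> B = {}" using block_eq[OF AB(1,2)] AB(3) by blast
  have finAB: "finite A" "finite B" using block_finite AB by blast+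
  have IA: "I \<inter> A = J \<inter> A - {a}" and IB: "I \<inter> B = insert b (J \<inter> B)" using disjoint a b by (auto simp: I_def)
  have card_IA: "Suc (card (I \<inter> A)) = \<kappa> A" unfolding IA cards(1)[symmetric] using a finAB by (intro card_Suc_Diff1) auto
  have card_IB: "card (I \<inter> B) = Suc (\<kappa> B)" unfolding IB cards(2)[symmetric] using b finAB by (intro card_insert_disjoint) auto
  have "card (I \<inter> X \<inter> A) \<le> card (I \<inter> A)" "card (I \<inter> X \<inter> B) \<le> card (I \<inter> B)"
    using finAB by (auto intro: card_mono)
  then have rank: "card (I \<inter> X \<inter> A) < \<kappa> A" "card (I \<inter> X \<inter> B) \<le> Suc (\<kappa> B)" using card_IA card_IB by linarith+
  have size: "card (I \<inter> X \<inter> A) \<le> card (X \<inter> A)" "card (I \<inter> X \<inter> B) \<le> card (X \<inter> B)"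
    using finAB by (auto intro: card_mono)
  have "card (I \<inter> X \<inter> A) < card (X \<inter> A) \<or> card (I \<inter> X \<inter> B) < card (I \<inter> B)"
  proof (cases "b \<in> X \<and> d \<in> X")
    case True
    have "a \<in> {1..n}" "d \<in> {1..n}" using block_subset AB a d by blast+
    then have "a \<in> X \<or> c \<in> X" using cyc_prefix_separates[OF r order] True unfolding X_def by blast
    moreover have "a \<notin> I" "c \<notin> I" using a c disjoint b order by (auto simp: I_def)
    ultimately have "I \<inter> X \<inter> A \<subset> X \<inter> A" using a(1) c(1) by blast
    then show ?thesis using psubset_card_mono[of "X \<inter> A"] finAB by blast
  next
    case False
    have "b \<in> I \<inter> B" "d \<in> I \<inter> B" using b d a disjoint by (auto simp: I_def)
    then have "I \<inter> X \<inter> B \<subset> I \<inter> B" using False by blast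
    then show ?thesis using psubset_card_mono[of "I \<inter> B"] finAB by blast
  qed
  then show ?thesis
    unfolding X_def card_necklace_prefix_block[OF r AB(1)] card_necklace_prefix_block[OF r AB(2)]
    using rank size card_IB unfolding X_def by linarith
qed

lemma crossing_exchange_in_M:
  assumes J: "J \<in> ksubsets n k" and cards: "\<And>B. B \<in> P \<Longrightarrow> card (J \<inter> B) = \<kappa> B"
    and AB: "A \<in> P" "B \<in> P" "A \<noteq> B" and order: "a < b" "b < c" "c < d"
    and a: "a \<in> A" "a \<in> J" and b: "b \<in> B" "b \<notin> J" and c: "c \<in> A" "c \<notin> J" and d: "d \<in> B" "d \<in> J"
  shows "insert b (J - {a}) \<in> M"
  unfolding mem_M_iff
proof (intro conjI ballI allI)
  let ?I = "insert b (J - {a})"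
  have "b \<in> {1..n} - J" using block_subset[OF AB(2)] b by blast
  then show "?I \<in> ksubsets n k" by (rule exchange_in_ksubsets[OF J a(2)])
  fix r m assume r: "r \<in> {1..n}"
  let ?X = "cyc_prefix n r m"
  have "card (?I \<inter> ?X \<inter> D) \<le> card (necklace r \<inter> ?X \<inter> D)" if D: "D \<in> P - {A, B}" for D
  proof -
    have "a \<notin> D" "b \<notin> D" using block_eq[of D A a] block_eq[of D B b] D AB a b by blast+
    then have "?I \<inter> ?X \<inter> D = J \<inter> ?X \<inter> D" by auto
    then show ?thesis using card_prefix_block_le[OF r, of D J] cards[of D] D by simp
  qed
  then have "(\<Sum>D\<in>P - {A, B}. card (?I \<inter> ?X \<inter> D)) \<le> (\<Sum>D\<in>P - {A, B}. card (necklace r \<inter> ?X \<inter> D))"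
    by (rule sum_mono)
  moreover have "(\<Sum>D\<in>{A, B}. card (?I \<inter> ?X \<inter> D)) \<le> (\<Sum>D\<in>{A, B}. card (necklace r \<inter> ?X \<inter> D))"
    using card_crossing_exchange_le[OF r AB cards[OF AB(1)] cards[OF AB(2)] order a b c d] AB(3)
    by simp
  moreover have "K \<inter> ?X \<subseteq> {1..n}" for K using cyc_prefix_subset by blast
  then have "card (K \<inter> ?X) = (\<Sum>D\<in>P - {A, B}. card (K \<inter> ?X \<inter> D)) + (\<Sum>D\<in>{A, B}. card (K \<inter> ?X \<inter> D))" for K
    using card_blocks[of "K \<inter> ?X"] sum.subset_diff[of "{A, B}" P] blocks_finite AB by simp
  ultimately show "card (?I \<inter> ?X) \<le> card (necklace r \<inter> ?X)" by (simp only: add_mono)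
qed

end

locale noncrossing_block_positroid = block_positroid +
  assumes nc: "noncrossing P"
begin

lemma block_strictly_inside:
  assumes "B \<in> P" "B' \<in> P" "B' \<noteq> B" "x \<in> B'" "x \<in> {Min B..Max B}" and y: "y \<in> B'"
  shows "Min B < y \<and> y < Max B"
proof -
  have ends: "Min B \<in> B" "Max B \<in> B" using block_finite[OF assms(1)] block_nonempty[OF assms(1)] by auto
  then have "Min B \<notin> B'" "Max B \<notin> B'" using block_eq[OF assms(1,2)] assms(3) by auto
  then have "x \<noteq> Min B" "x \<noteq> Max B" using assms(4) by auto
  then have x: "Min B < x" "x < Max B" using assms(5) by auto
  have "\<not> linked B B'" using nc assms(1-3) unfolding noncrossing_iff_not_linked by blast
  moreover have "B \<inter> B' = {}" using block_eq[OF assms(1,2)] assms(3) by blast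
  ultimately have "clockwise (Min B) x (Max B) = clockwise (Min B) y (Max B)"
    by (rule clockwise_eq_if_not_linked[OF _ _ ends assms(4) y])
  then show ?thesis using x by (auto simp: clockwise_def)
qed

lemma saturated_hull:
  assumes "B \<in> P" shows "saturated {Min B..Max B}"
  unfolding saturated_def
proof
  fix B' assume B': "B' \<in> P"
  show "B' \<subseteq> {Min B..Max B} \<or> B' \<inter> {Min B..Max B} = {}"
  proof (cases "B' = B")
    case True
    then show ?thesis using block_finite[OF assms] by auto
  next
    case False
    then show ?thesis using block_strictly_inside[OF assms B'] by force
  qed
qed

lemma hull_less:
  assumes "B \<in> P" "B' \<in> P" "B' \<noteq> B" "B' \<subseteq> {Min B..Max B}"
  shows "Max B' - Min B' < Max B - Min B"
proof -
  have ends: "Min B' \<in> B'" "Max B' \<in> B'" using block_finite[OF assms(2)] block_nonempty[OF assms(2)] by auto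
  then have "Min B < Min B'" "Max B' < Max B"
    using block_strictly_inside[OF assms(1-3)] assms(4) by blast+
  moreover have "Min B' \<le> Max B'" using block_finite[OF assms(2)] ends(1) by simp
  ultimately show ?thesis by linarith
qed

lemma hull_eq_cyc_prefix:
  assumes "B \<in> P" shows "{Min B..Max B} = cyc_prefix n (Min B) (Max B - Min B)"
proof -
  have ends: "Min B \<in> B" "Max B \<in> B" "Min B \<le> Max B"
    using block_finite[OF assms] block_nonempty[OF assms] by auto
  then have mem: "Min B \<in> {1..n}" "Max B \<in> {1..n}" using block_subset[OF assms] by auto
  have "x \<in> {Min B..Max B} \<longleftrightarrow> x \<in> cyc_prefix n (Min B) (Max B - Min B)" if "x \<in> {1..n}" for x
    using cyc_pos_eq[OF mem(1) that] that mem ends(3) by (auto simp: mem_cyc_prefix_iff)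
  moreover have "{Min B..Max B} \<subseteq> {1..n}" using mem by (auto simp: atLeastAtMost_iff)
  ultimately show ?thesis using cyc_prefix_subset[of n "Min B" "Max B - Min B"] by blast
qed

lemma card_block:
  assumes I: "I \<in> M" and B: "B \<in> P"
  shows "card (I \<inter> B) = \<kappa> B"
  using B
proof (induction "Max B - Min B" arbitrary: B rule: less_induct)
  case less
  let ?A = "{Min B..Max B}" and ?Q = "{B' \<in> P. B' \<subseteq> {Min B..Max B}}"
  have "Min B \<in> B" using block_finite[OF less.prems] block_nonempty[OF less.prems] by auto
  then have r: "Min B \<in> {1..n}" using block_subset[OF less.prems] by blast
  note saturated = saturated_hull[OF less.prems]
  have "(\<Sum>B'\<in>?Q. card (I \<inter> B')) = card (I \<inter> ?A)"
    by (rule card_Int_saturated[OF saturated M_D(1)[OF I], symmetric])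
  also have "\<dots> = card (necklace (Min B) \<inter> ?A)"
    using card_saturated_prefix_eq[OF I r] saturated unfolding hull_eq_cyc_prefix[OF less.prems] by blast
  also have "\<dots> = (\<Sum>B'\<in>?Q. \<kappa> B')"
    unfolding card_Int_saturated[OF saturated necklace_subset] using card_necklace_block[OF r] by (intro sum.cong) auto
  finally have total: "(\<Sum>B'\<in>?Q. card (I \<inter> B')) = (\<Sum>B'\<in>?Q. \<kappa> B')" .
  have "(\<Sum>B'\<in>?Q - {B}. card (I \<inter> B')) = (\<Sum>B'\<in>?Q - {B}. \<kappa> B')"
    using less.hyps hull_less[OF less.prems] by (intro sum.cong) auto
  moreover have "finite ?Q" "B \<in> ?Q" using blocks_finite block_finite[OF less.prems] less.prems by auto
  ultimately show ?case
    using total sum.remove[of ?Q B "\<lambda>B'. card (I \<inter> B')"] sum.remove[of ?Q B \<kappa>] by simp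
qed

lemma M_iff_block_cards: "I \<in> M \<longleftrightarrow> I \<in> ksubsets n k \<and> (\<forall>B\<in>P. card (I \<inter> B) = \<kappa> B)"
  using card_block in_M_if_block_cards M_subset by blast

lemma exchange_in_M_iff:
  assumes J: "J \<in> M" and ij: "i \<in> J" "j \<in> {1..n} - J"
  shows "insert j (J - {i}) \<in> M \<longleftrightarrow> block_of i = block_of j"
proof
  let ?I = "insert j (J - {i})"
  note J' = M_D[OF J]
  have mem: "i \<in> {1..n}" "j \<in> {1..n}" "j \<notin> J" using J'(1) ij by auto
  show "block_of i = block_of j" if "?I \<in> M"
  proof (rule ccontr)
    assume "block_of i \<noteq> block_of j"
    then have "j \<notin> block_of i" using mem_block_iff[of "block_of i"] block_of[OF mem(1)] mem(2) by blast
    then have "?I \<inter> block_of i = (J \<inter> block_of i) - {i}" by auto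
    then have "card (?I \<inter> block_of i) < card (J \<inter> block_of i)"
      using ij(1) block_of[OF mem(1)] J'(3) by (metis IntI card_Diff1_less finite_Int)
    then show False using card_block[OF that] card_block[OF J] block_of[OF mem(1)] by simp
  qed
  show "?I \<in> M" if "block_of i = block_of j"
  proof (rule in_M_if_block_cards)
    show "?I \<in> ksubsets n k" using exchange_in_ksubsets[OF _ ij] J M_subset by blast
    show "card (?I \<inter> B) = \<kappa> B" if "B \<in> P" for B
      using card_exchange_Int_eq[OF J'(3) ij(1) mem(3), of B] mem_block_iff[OF that] mem
        \<open>block_of i = block_of j\<close> card_block[OF J that] by simp
  qed
qed

lemma smooth: "smooth_in_grassmannian n k (positroid_variety n k M)"
proof (rule smooth_if_matching_closed)
  fix J I \<sigma>
  assume J: "J \<in> M" and I: "I \<in> ksubsets n k" and \<sigma>: "bij_betw \<sigma> (J - I) (I - J)"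
    and exchange: "\<And>i. i \<in> J - I \<Longrightarrow> insert (\<sigma> i) (J - {i}) \<in> M"
  note J' = M_D[OF J] and I' = ksubsetsD[OF I]
  have same: "block_of i = block_of (\<sigma> i)" if "i \<in> J - I" for i
    using exchange_in_M_iff[OF J, of i "\<sigma> i"] exchange[OF that] bij_betwE[OF \<sigma>] that I'(1) by auto
  have "card (I \<inter> B) = \<kappa> B" if B: "B \<in> P" for B
  proof -
    have "i \<in> B \<longleftrightarrow> \<sigma> i \<in> B" if "i \<in> J - I" for i
    proof -
      have "i \<in> {1..n}" "\<sigma> i \<in> {1..n}" using bij_betwE[OF \<sigma>] that J'(1) I'(1) by blast+
      then show ?thesis using mem_block_iff[OF B] same[OF that] by simp
    qed
    then have "card (I \<inter> B) = card (J \<inter> B)" by (rule card_Int_eq_if_matching[OF J'(3) I'(3) \<sigma>])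
    then show ?thesis using card_block[OF J B] by simp
  qed
  then show "I \<in> M" using M_iff_block_cards I by blast
qed

lemma left_of_iff_necklace_blocks:
  assumes "x \<in> {1..n}" "y \<in> {1..n}" "block_of x \<noteq> block_of y"
  shows "left_of w C x (arc_tail y) \<longleftrightarrow> w x \<in> necklace y"
proof (rule left_of_iff_necklace[OF assms(1,2)])
  show "x \<noteq> y" using assms(3) by auto
  show "w x \<noteq> y" using assms block_of[OF assms(1)] w_in_block block_of_eq by metis
qed

lemma necklace_constant_on_block:
  assumes A: "A \<in> P" "x \<in> A" and B: "B \<in> P" "y \<in> B" "y' \<in> B" and ne: "A \<noteq> B"
  shows "w x \<in> necklace y \<longleftrightarrow> w x \<in> necklace y'"
proof -
  have mem: "x \<in> {1..n}" "y \<in> {1..n}" "y' \<in> {1..n}" using block_subset A B by blast+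
  have blocks: "block_of x \<noteq> block_of y" "block_of x \<noteq> block_of y'"
    using block_of_eq[OF A] block_of_eq[OF B(1,2)] block_of_eq[OF B(1,3)] ne by auto
  then have xy: "x \<noteq> y" "x \<noteq> y'" by auto
  have "\<not> linked A B" using nc A(1) B(1) ne unfolding noncrossing_iff_not_linked by blast
  moreover have "A \<inter> B = {}" using block_eq[OF A(1) B(1)] ne by blast
  ultimately have "clockwise x y (w x) = clockwise x y' (w x)"
    by (rule clockwise_eq_if_not_linked[OF _ _ A(2) w_in_block[OF A] B(2,3)])
  then show ?thesis
    unfolding left_of_iff_necklace_blocks[OF mem(1,2) blocks(1), symmetric]
      left_of_iff_necklace_blocks[OF mem(1,3) blocks(2), symmetric]
      left_of_tail_iff[OF mem(1,2) xy(1)] left_of_tail_iff[OF mem(1,3) xy(2)] by simp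
qed

lemma card_heads_in_necklace:
  assumes "B \<in> P" "y \<in> {1..n}"
  shows "card {x \<in> B. w x \<in> necklace y} = \<kappa> B"
proof -
  have "w ` {x \<in> B. w x \<in> necklace y} = necklace y \<inter> w ` B" by blast
  then show ?thesis
    using card_image[OF inj_on_w, of "{x \<in> B. w x \<in> necklace y}"] card_necklace_block[OF assms(2,1)]
    by (simp only: invariant[OF assms(1)])
qed

lemma card_pairs_blocks:
  assumes X: "X \<subseteq> {1..n} \<times> {1..n}"
  shows "card X = (\<Sum>(A, B)\<in>P \<times> P. card (X \<inter> A \<times> B))"
proof -
  let ?g = "map_prod block_of block_of"
  have fin: "finite X" using X by (rule finite_subset) simp
  have "?g ` X \<subseteq> P \<times> P" using X block_of by auto
  then have "card X = (\<Sum>e\<in>P \<times> P. card {x \<in> X. ?g x = e})"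
    using sum.group[OF fin, of "P \<times> P" ?g "\<lambda>_. 1 :: nat"] blocks_finite by simp
  also have "\<dots> = (\<Sum>(A, B)\<in>P \<times> P. card (X \<inter> A \<times> B))"
  proof (rule sum.cong[OF refl], clarify)
    fix A B assume "A \<in> P" "B \<in> P"
    then have "{x \<in> X. ?g x = (A, B)} = X \<inter> A \<times> B" using X mem_block_iff by auto
    then show "card {x \<in> X. ?g x = (A, B)} = card (X \<inter> A \<times> B)" by simp
  qed
  finally show ?thesis .
qed

definition aligned_across :: "(nat \<times> nat) set" where
  "aligned_across = {(x, y) \<in> {1..n} \<times> {1..n}.
     block_of x \<noteq> block_of y \<and> w x \<in> necklace y \<and> w y \<notin> necklace x}"

definition across :: "nat set \<Rightarrow> (nat \<times> nat) set" where
  "across J = {(i, j) \<in> J \<times> ({1..n} - J). block_of i \<noteq> block_of j}"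

lemma alignment_across_iff:
  assumes "x \<in> {1..n}" "y \<in> {1..n}" "block_of x \<noteq> block_of y"
  shows "alignment w C x y \<longleftrightarrow> (w x \<in> necklace y \<longleftrightarrow> w y \<notin> necklace x)"
proof -
  have "\<not> crossing w C x y"
    using same_block_if_crossing[OF part nc invariant, of x y "block_of x" "block_of y"] block_of assms by blast
  moreover have "x \<noteq> y" using assms(3) by auto
  ultimately show ?thesis
    unfolding alignment_def left_of_iff_necklace_blocks[OF assms]
      left_of_iff_necklace_blocks[OF assms(2,1) assms(3)[symmetric]] by blast
qed

lemma card_alignments_across:
  assumes "\<And>B i j. B \<in> P \<Longrightarrow> i \<in> B \<Longrightarrow> j \<in> B \<Longrightarrow> \<not> alignment w C i j"
  shows "card (alignments n w C) = card aligned_across"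
proof (rule card_alignments_eq_card_orientation)
  fix x y assume xy: "x \<in> {1..n}" "y \<in> {1..n}"
  show "alignment w C x y \<longleftrightarrow> (x, y) \<in> aligned_across \<or> (y, x) \<in> aligned_across"
  proof (cases "block_of x = block_of y")
    case True
    then have "\<not> alignment w C x y" using assms[of "block_of x" x y] block_of[OF xy(1)] block_of[OF xy(2)] by simp
    then show ?thesis using True by (simp add: aligned_across_def)
  next
    case False
    then show ?thesis using alignment_across_iff[OF xy False] xy by (auto simp: aligned_across_def)
  qed
qed (auto simp: aligned_across_def)

lemma card_aligned_across_block_pair:
  assumes AB: "A \<in> P" "B \<in> P" "A \<noteq> B"
  shows "card (aligned_across \<inter> A \<times> B) = \<kappa> A * (card B - \<kappa> B)"
proof -
  obtain x0 y0 where x0: "x0 \<in> A" and y0: "y0 \<in> B" using block_nonempty AB by blast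
  have mem: "x0 \<in> {1..n}" "y0 \<in> {1..n}" using block_subset AB x0 y0 by blast+
  have "(x, y) \<in> aligned_across \<longleftrightarrow> w x \<in> necklace y0 \<and> w y \<notin> necklace x0" if "x \<in> A" "y \<in> B" for x y
  proof -
    have "x \<in> {1..n}" "y \<in> {1..n}" "block_of x = A" "block_of y = B"
      using that block_subset block_of_eq AB by blast+
    then show ?thesis
      using necklace_constant_on_block[OF AB(1) that(1) AB(2) that(2) y0 AB(3)] AB(3)
        necklace_constant_on_block[OF AB(2) that(2) AB(1) that(1) x0 AB(3)[symmetric]]
      by (simp add: aligned_across_def)
  qed
  then have "aligned_across \<inter> A \<times> B = {x \<in> A. w x \<in> necklace y0} \<times> {y \<in> B. w y \<notin> necklace x0}" by auto
  moreover have "{y \<in> B. w y \<notin> necklace x0} = B - {y \<in> B. w y \<in> necklace x0}" by auto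
  ultimately show ?thesis
    using card_heads_in_necklace[OF AB(1) mem(2)] card_heads_in_necklace[OF AB(2) mem(1)] block_finite[OF AB(2)]
    by (simp add: card_cartesian_product card_Diff_subset)
qed

lemma card_across_block_pair:
  assumes J: "J \<in> M" and AB: "A \<in> P" "B \<in> P" "A \<noteq> B"
  shows "card (across J \<inter> A \<times> B) = \<kappa> A * (card B - \<kappa> B)"
proof -
  have "across J \<inter> A \<times> B = (J \<inter> A) \<times> (B - J \<inter> B)"
    using block_subset[OF AB(2)] block_of_eq AB by (auto simp: across_def)
  then show ?thesis
    using card_block[OF J AB(1)] card_block[OF J AB(2)] block_finite[OF AB(2)]
    by (simp add: card_cartesian_product card_Diff_subset)
qed

lemma card_aligned_across:
  assumes J: "J \<in> M"
  shows "card aligned_across = card (across J)"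
proof -
  have subset: "aligned_across \<subseteq> {1..n} \<times> {1..n}" "across J \<subseteq> {1..n} \<times> {1..n}"
    using M_D(1)[OF J] by (auto simp: aligned_across_def across_def)
  have "card (aligned_across \<inter> A \<times> B) = card (across J \<inter> A \<times> B)" if AB: "A \<in> P" "B \<in> P" for A B
  proof (cases "A = B")
    case True
    then have "aligned_across \<inter> A \<times> B = {}" "across J \<inter> A \<times> B = {}"
      using block_of_eq AB by (auto simp: aligned_across_def across_def)
    then show ?thesis by simp
  next
    case False
    then show ?thesis using card_aligned_across_block_pair[OF AB] card_across_block_pair[OF J AB] by simp
  qed
  then show ?thesis unfolding card_pairs_blocks[OF subset(1)] card_pairs_blocks[OF subset(2)]
    by (intro sum.cong) auto
qed

lemma card_neighbours_add_card_alignments: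
  assumes "\<And>B i j. B \<in> P \<Longrightarrow> i \<in> B \<Longrightarrow> j \<in> B \<Longrightarrow> \<not> alignment w C i j" and J: "J \<in> M"
  shows "card {I \<in> M. card (I \<inter> J) + 1 = k} + card (alignments n w C) = k * (n - k)"
proof -
  have Jk: "J \<in> ksubsets n k" using J M_subset by blast
  have split: "chart_index n J = exchange_edges n M J \<union> across J" "exchange_edges n M J \<inter> across J = {}"
    using exchange_in_M_iff[OF J] by (auto simp: exchange_edges_def across_def chart_index_def)
  have "finite (exchange_edges n M J)" "finite (across J)"
    using finite_chart_index[OF Jk] unfolding split(1) by simp_all
  then have "card (exchange_edges n M J) + card (across J) = k * (n - k)"
    using card_chart_index[OF Jk] card_Un_disjoint[OF _ _ split(2)] unfolding split(1) by simp
  then show ?thesis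
    using card_johnson_neighbours[OF M_subset Jk] card_alignments_across[OF assms(1)] card_aligned_across[OF J]
    by simp
qed

end

section \<open>Positroids closed under double exchanges\<close>

lemma ex_subset_separating:
  assumes "finite A" "a \<in> A" "c \<in> A" "a \<noteq> c" "0 < l" "l < card A"
  obtains S where "S \<subseteq> A" "card S = l" "a \<in> S" "c \<notin> S"
proof -
  have "card (A - {a, c}) = card A - 2" using assms by (simp add: card_Diff_subset)
  then have "l - 1 \<le> card (A - {a, c})" using assms by simp
  then obtain T where T: "T \<subseteq> A - {a, c}" "card T = l - 1" "finite T" by (rule obtain_subset_with_card_n)
  have "card (insert a T) = l" using T assms(5) by (subst card_insert_disjoint) auto
  then show thesis using T assms by (intro that[of "insert a T"]) auto
qed

definition exchange_rel :: "nat \<Rightarrow> nat set set \<Rightarrow> nat set \<Rightarrow> (nat \<times> nat) set" where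
  "exchange_rel n M J = (exchange_edges n M J \<union> (exchange_edges n M J)\<inverse>)\<^sup>*"

lemma sym_exchange_rel: "sym (exchange_rel n M J)"
  unfolding exchange_rel_def by (intro sym_rtrancl sym_Un_converse)

lemma trans_exchange_rel: "trans (exchange_rel n M J)"
  unfolding exchange_rel_def by (rule trans_rtrancl)

lemma edge_in_exchange_rel: "e \<in> exchange_edges n M J \<Longrightarrow> e \<in> exchange_rel n M J"
  unfolding exchange_rel_def by blast

lemma mem_class_iff:
  assumes "equiv A R" "B \<in> A // R" "(x, y) \<in> R"
  shows "x \<in> B \<longleftrightarrow> y \<in> B"
  using assms equiv_def in_quotient_imp_closed symD by metis

locale double_exchange =
  fixes n k :: nat and M :: "nat set set"
  assumes ksubsets: "M \<subseteq> ksubsets n k"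
    and double: "\<And>J i i' j j'. J \<in> M \<Longrightarrow> i \<noteq> i' \<Longrightarrow> j \<noteq> j' \<Longrightarrow> (i, j) \<in> exchange_edges n M J \<Longrightarrow>
      (i', j') \<in> exchange_edges n M J \<Longrightarrow> insert j (insert j' (J - {i, i'})) \<in> M"
begin

abbreviation "edges J \<equiv> exchange_edges n M J"
abbreviation "rel J \<equiv> exchange_rel n M J"

lemma basis_subset: "J \<in> M \<Longrightarrow> J \<subseteq> {1..n}"
  using ksubsets ksubsetsD(1) by blast

lemma rectangular:
  assumes J: "J \<in> M" and e: "(i, j) \<in> edges J" "(i', j) \<in> edges J" "(i', j') \<in> edges J"
  shows "(i, j') \<in> edges J"
proof (cases "i = i' \<or> j = j'")
  case True
  then show ?thesis using e by auto
next
  case False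
  note d = exchange_edgesD[OF e(1)] exchange_edgesD[OF e(2)] exchange_edgesD[OF e(3)]
  let ?J = "insert j (J - {i'})"
  have i': "i' \<in> {1..n}" using d basis_subset[OF J] by blast
  have "insert i' (?J - {i}) = insert j (J - {i})" using d False by auto
  then have first: "(i, i') \<in> edges ?J" using d False i' by (intro exchange_edgesI) auto
  have "insert j' (?J - {j}) = insert j' (J - {i'})" using d by auto
  then have second: "(j, j') \<in> edges ?J" using d False by (intro exchange_edgesI) auto
  have "insert i' (insert j' (?J - {i, j})) \<in> M"
    using double[OF d(6) _ _ first second] d False by auto
  moreover have "insert i' (insert j' (?J - {i, j})) = insert j' (J - {i})" using d False by auto
  ultimately show ?thesis using d by (intro exchange_edgesI) auto
qed

lemma edge_if_rel:
  assumes J: "J \<in> M" and related: "(i, y) \<in> rel J" and i: "i \<in> J" and y: "y \<notin> J"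
  shows "(i, y) \<in> edges J"
proof -
  have "(y \<notin> J \<longrightarrow> (i, y) \<in> edges J) \<and> (y \<in> J \<longrightarrow> y = i \<or> (\<exists>j. (i, j) \<in> edges J \<and> (y, j) \<in> edges J))"
    using related unfolding exchange_rel_def
  proof (induction rule: rtrancl_induct)
    case base
    then show ?case using i by simp
  next
    case (step y z)
    from step.hyps(2) show ?case
    proof
      assume e: "(y, z) \<in> edges J"
      then have yz: "y \<in> J" "z \<notin> J" using exchange_edgesD[OF e] by auto
      then have "(i, z) \<in> edges J" using step.IH e rectangular[OF J] by blast
      then show ?case using yz by simp
    next
      assume "(y, z) \<in> (edges J)\<inverse>"
      then have e: "(z, y) \<in> edges J" by simp
      then have yz: "z \<in> J" "y \<notin> J" using exchange_edgesD[OF e] by auto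
      then have "(i, y) \<in> edges J" using step.IH by blast
      then show ?case using yz e by blast
    qed
  qed
  then show ?thesis using y by blast
qed

lemma reverse_edge:
  assumes "J \<in> M" "(a, b) \<in> edges J"
  shows "insert a (insert b (J - {a}) - {b}) = J" "(b, a) \<in> edges (insert b (J - {a}))"
proof -
  note d = exchange_edgesD[OF assms(2)]
  show eq: "insert a (insert b (J - {a}) - {b}) = J" using d by auto
  have "a \<in> {1..n}" using d(1) basis_subset[OF assms(1)] by blast
  then show "(b, a) \<in> edges (insert b (J - {a}))" using d assms(1) eq by (intro exchange_edgesI) auto
qed

lemma edge_in_rel_exchange:
  assumes J: "J \<in> M" and ab: "(a, b) \<in> edges J" and ij: "(i, j) \<in> edges J"
  shows "(i, j) \<in> rel (insert b (J - {a}))"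
proof -
  let ?J = "insert b (J - {a})"
  note d = exchange_edgesD[OF ij] and d' = exchange_edgesD[OF ab]
  have a: "a \<in> {1..n}" using d'(1) basis_subset[OF J] by blast
  have ab': "(a, b) \<in> rel ?J"
    using edge_in_exchange_rel[OF reverse_edge(2)[OF J ab]] by (rule symD[OF sym_exchange_rel])
  consider (same) "i = a" "j = b" | (tail) "i = a" "j \<noteq> b" | (head) "i \<noteq> a" "j = b" | (disjoint) "i \<noteq> a" "j \<noteq> b"
    by blast
  then show ?thesis
  proof cases
    case same
    then show ?thesis using ab' by simp
  next
    case tail
    then have "insert j (?J - {b}) = insert j (J - {i})" using d' by auto
    then have "(b, j) \<in> edges ?J" using d tail by (intro exchange_edgesI) auto
    then show ?thesis using transD[OF trans_exchange_rel ab' edge_in_exchange_rel] tail by simp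
  next
    case head
    then have "insert a (?J - {i}) = insert j (J - {i})" using d d' by auto
    then have "(i, a) \<in> edges ?J" using d d' head a by (intro exchange_edgesI) auto
    then show ?thesis using transD[OF trans_exchange_rel edge_in_exchange_rel ab'] head by simp
  next
    case disjoint
    then have "insert j (insert b (J - {i, a})) \<in> M" using double[OF J _ _ ij ab] by blast
    moreover have "insert j (?J - {i}) = insert j (insert b (J - {i, a}))" using d d' disjoint by auto
    ultimately have "(i, j) \<in> edges ?J" using d d' disjoint by (intro exchange_edgesI) auto
    then show ?thesis by (rule edge_in_exchange_rel)
  qed
qed

lemma rel_subset_exchange:
  assumes "J \<in> M" "(a, b) \<in> edges J"
  shows "rel J \<subseteq> rel (insert b (J - {a}))"
proof -
  have "edges J \<union> (edges J)\<inverse> \<subseteq> rel (insert b (J - {a}))"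
    using edge_in_rel_exchange[OF assms] symD[OF sym_exchange_rel] by auto
  then have "rel J \<subseteq> (rel (insert b (J - {a})))\<^sup>*" unfolding exchange_rel_def[of n M J] by (rule rtrancl_mono)
  then show ?thesis by (simp add: exchange_rel_def)
qed

lemma rel_exchange:
  assumes "J \<in> M" "(a, b) \<in> edges J"
  shows "rel (insert b (J - {a})) = rel J"
proof
  note reverse = reverse_edge[OF assms]
  show "rel (insert b (J - {a})) \<subseteq> rel J"
    using rel_subset_exchange[OF exchange_edgesD(3)[OF assms(2)] reverse(2)] unfolding reverse(1) .
  show "rel J \<subseteq> rel (insert b (J - {a}))" by (rule rel_subset_exchange[OF assms])
qed

end

locale exchange_positroid = positroid_data n w C k + double_exchange n k "positroid n k w C"
  for n k :: nat and w :: "nat \<Rightarrow> nat" and C :: "nat set" +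
  assumes n_pos: "1 \<le> n"
begin

lemma one_mem: "1 \<in> {1..n}"
  using n_pos by simp

definition component_rel :: "(nat \<times> nat) set" where
  "component_rel = rel (necklace 1) \<inter> {1..n} \<times> {1..n}"

definition components :: "nat set set" where
  "components = {1..n} // component_rel"

definition component_rank :: "nat set \<Rightarrow> nat" where
  "component_rank B = card (necklace 1 \<inter> B)"

lemma equiv_component_rel: "equiv {1..n} component_rel"
proof (rule equivI)
  show "component_rel \<subseteq> {1..n} \<times> {1..n}" by (auto simp: component_rel_def)
  show "refl_on {1..n} component_rel" by (auto simp: refl_on_def component_rel_def exchange_rel_def)
  show "sym component_rel" using symD[OF sym_exchange_rel] by (auto simp: sym_def component_rel_def)
  show "trans component_rel" using transD[OF trans_exchange_rel] unfolding trans_def component_rel_def by blast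
qed

lemma partition_components: "partition_on {1..n} components"
  unfolding components_def by (rule partition_on_quotient[OF equiv_component_rel])

lemma component_subset: "B \<in> components \<Longrightarrow> B \<subseteq> {1..n}"
  using partition_components by (auto simp: partition_on_def)

lemma component_rel_if_mem: "B \<in> components \<Longrightarrow> x \<in> B \<Longrightarrow> y \<in> B \<Longrightarrow> (x, y) \<in> component_rel"
  unfolding components_def using equiv_component_rel by (metis quotient_eq_iff)

lemma mem_component_iff: "B \<in> components \<Longrightarrow> (x, y) \<in> component_rel \<Longrightarrow> x \<in> B \<longleftrightarrow> y \<in> B"
  unfolding components_def by (rule mem_class_iff[OF equiv_component_rel])

lemma necklace_edge:
  assumes "r \<in> {1..n}" "w r \<noteq> r" shows "(r, w r) \<in> edges (necklace r)"
  using necklace_at_moved[OF assms] necklace_in_M[OF cyc_succ_mem[OF assms(1)]] necklace_cyc_succ[OF assms]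
  by (intro exchange_edgesI) simp_all

lemma rel_necklace: "r \<in> {1..n} \<Longrightarrow> rel (necklace r) = rel (necklace 1)"
proof (induction rule: necklace_induct)
  case (exchange r)
  then show ?case using rel_exchange[OF necklace_in_M necklace_edge] by simp
qed simp

lemma w_component_rel:
  assumes x: "x \<in> {1..n}" shows "(x, w x) \<in> component_rel"
proof (cases "w x = x")
  case True
  then show ?thesis using x by (simp add: component_rel_def exchange_rel_def)
next
  case False
  have "(x, w x) \<in> rel (necklace x)" using edge_in_exchange_rel[OF necklace_edge[OF x False]] .
  then show ?thesis using x w_mem[OF x] unfolding rel_necklace[OF x] component_rel_def by simp
qed

lemma component_invariant:
  assumes B: "B \<in> components" shows "w ` B = B"
proof (rule card_subset_eq)
  show "finite B" using component_subset[OF B] by (rule finite_subset) simp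
  show "w ` B \<subseteq> B" using mem_component_iff[OF B w_component_rel] component_subset[OF B] by blast
  show "card (w ` B) = card B" by (rule card_image[OF inj_on_w])
qed

lemma card_necklace_component:
  assumes "r \<in> {1..n}" and B: "B \<in> components"
  shows "card (necklace r \<inter> B) = component_rank B"
  using assms(1)
proof (induction rule: necklace_induct)
  case first
  show ?case by (simp add: component_rank_def)
next
  case (exchange r)
  have "card (insert (w r) (necklace r - {r}) \<inter> B) = card (necklace r \<inter> B)"
    using necklace_at_moved[OF exchange(1,2)] mem_component_iff[OF B w_component_rel[OF exchange(1)]]
    by (intro card_exchange_Int_eq) auto
  then show ?case using exchange.IH by simp
qed

text \<open>Otherwise exchanging \<open>x\<close> for \<open>y\<close> would give a basis that is Gale-smaller than the necklace element.\<close>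

lemma necklace_initial_on_component:
  assumes r: "r \<in> {1..n}" and B: "B \<in> components" and x: "x \<in> B" "x \<in> necklace r" and y: "y \<in> B"
    and less: "cyc_pos n r y < cyc_pos n r x"
  shows "y \<in> necklace r"
proof (rule ccontr)
  assume notin: "y \<notin> necklace r"
  let ?I = "insert y (necklace r - {x})" and ?X = "cyc_prefix n r (cyc_pos n r y)"
  have "(x, y) \<in> rel (necklace r)"
    using component_rel_if_mem[OF B x(1) y] unfolding rel_necklace[OF r] component_rel_def by blast
  then have "?I \<in> M" using edge_if_rel[OF necklace_in_M[OF r] _ x(2) notin] exchange_edgesD(3) by blast
  then have "card (?I \<inter> ?X) \<le> card (necklace r \<inter> ?X)" using r unfolding mem_M_iff by blast
  moreover have "?I \<inter> ?X = insert y (necklace r \<inter> ?X)"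
    using component_subset[OF B] y less by (auto simp: mem_cyc_prefix_iff)
  ultimately show False using notin by simp
qed

lemma block_positroid_components: "block_positroid n w C k components component_rank"
proof
  show "partition_on {1..n} components" by (rule partition_components)
  show "w ` B = B" if "B \<in> components" for B by (rule component_invariant[OF that])
  show "component_rank B \<le> card B" if "B \<in> components" for B
    unfolding component_rank_def using finite_subset[OF component_subset[OF that]] by (intro card_mono) auto
  show "x \<in> necklace r \<longleftrightarrow> cyc_rank n r B x < component_rank B"
    if r: "r \<in> {1..n}" and B: "B \<in> components" and x: "x \<in> B" for r B x
    unfolding card_necklace_component[OF r B, symmetric]
    by (rule mem_iff_cyc_rank_less[OF r component_subset[OF B] necklace_initial_on_component[OF r B] x])
qed

sublocale block_positroid n w C k components component_rank
  by (rule block_positroid_components)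

lemma component_rank_bounds:
  assumes B: "B \<in> components" and xy: "x \<in> B" "y \<in> B" "x \<noteq> y"
  shows "0 < component_rank B" "component_rank B < card B"
proof -
  have fin: "finite B" by (rule block_finite[OF B])
  have "(x, y) \<in> (edges (necklace 1) \<union> (edges (necklace 1))\<inverse>)\<^sup>*"
    using component_rel_if_mem[OF B xy(1,2)] by (simp add: component_rel_def exchange_rel_def)
  then obtain z where "(x, z) \<in> edges (necklace 1) \<or> (z, x) \<in> edges (necklace 1)"
    using xy(3) by (meson UnE converseD converse_rtranclE)
  then obtain i j where ij: "(i, j) \<in> edges (necklace 1)" and endpoint: "i = x \<or> j = x" by blast
  note d = exchange_edgesD[OF ij]
  have "(i, j) \<in> component_rel"
    using edge_in_exchange_rel[OF ij] d(1,2) necklace_subset[of 1] unfolding component_rel_def by blast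
  then have "i \<in> B" "j \<in> B" using mem_component_iff[OF B] endpoint xy(1) by blast+
  then have "necklace 1 \<inter> B \<noteq> {}" "necklace 1 \<inter> B \<subset> B" using d(1,2) by blast+
  then show "0 < component_rank B" "component_rank B < card B"
    unfolding component_rank_def using fin by (simp_all add: card_gt_0_iff psubset_card_mono)
qed

lemma arc_span_eq_component_rank:
  assumes B: "B \<in> components" and rank: "0 < component_rank B" "component_rank B < card B" and x: "x \<in> B"
  shows "arc_span n w B x = component_rank B"
proof -
  let ?s = "cyc_succ n x"
  have x': "x \<in> {1..n}" using block_subset[OF B] x by blast
  note here = initial[OF x' B] and next_step = initial[OF cyc_succ_mem[OF x'] B]
  have "x \<in> necklace x" using here[OF x] rank(1) by (simp add: cyc_rank_def cyc_pos_self)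
  moreover have "x \<notin> necklace ?s" using next_step[OF x] rank(2) cyc_rank_cyc_succ_self[OF block_subset[OF B] x] by simp
  ultimately have moved: "w x \<noteq> x" using necklace_cyc_succ_if_fixed[OF x'] by auto
  have wx: "w x \<in> B" by (rule w_in_block[OF B x])
  have "component_rank B \<le> cyc_rank n x B (w x)" using here[OF wx] necklace_at_moved[OF x' moved] by simp
  moreover have "cyc_rank n ?s B (w x) < component_rank B"
    using next_step[OF wx] unfolding necklace_cyc_succ[OF x' moved] by simp
  ultimately show ?thesis
    using cyc_rank_cyc_succ[OF block_subset[OF B] x wx moved] unfolding arc_span_def by linarith
qed

lemma spirograph_on_component:
  assumes B: "B \<in> components" shows "spirograph_on w B"
proof (cases "card B = 1")
  case True
  then obtain x where "B = {x}" by (auto simp: card_1_singleton_iff)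
  then show ?thesis using component_invariant[OF B] by (simp add: spirograph_on_def)
next
  case False
  obtain x where x: "x \<in> B" using block_nonempty[OF B] by blast
  have "B \<noteq> {x}" using False by auto
  then obtain y where "y \<in> B" "x \<noteq> y" using x by blast
  then have rank: "0 < component_rank B" "component_rank B < card B" using component_rank_bounds[OF B x] by blast+
  have "rank_in B (w x) = (rank_in B x + component_rank B) mod card B" if "x \<in> B" for x
    using rank_in_w_eq_shift[OF block_subset[OF B] component_invariant[OF B] that]
    unfolding arc_span_eq_component_rank[OF B rank that] .
  then show ?thesis
    unfolding spirograph_on_iff[OF block_finite[OF B] component_invariant[OF B]]
    using rank by (intro bexI[of _ "component_rank B"]) auto
qed

lemma ex_exchange_into_first_necklace:
  assumes J: "J \<subseteq> {1..n}" and cards: "\<And>B. B \<in> components \<Longrightarrow> card (J \<inter> B) = component_rank B"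
    and "\<not> J \<subseteq> necklace 1"
  obtains x y where "x \<in> J - necklace 1" "y \<in> necklace 1 - J" "(x, y) \<in> component_rel"
proof -
  obtain x where x: "x \<in> J" "x \<notin> necklace 1" using assms(3) by blast
  define B where "B = block_of x"
  have B: "B \<in> components" "x \<in> B" using block_of[of x] x(1) J unfolding B_def by blast+
  have "\<not> necklace 1 \<inter> B \<subseteq> J \<inter> B"
  proof
    assume "necklace 1 \<inter> B \<subseteq> J \<inter> B"
    then have "necklace 1 \<inter> B = J \<inter> B"
      using cards[OF B(1)] block_finite[OF B(1)] by (intro card_subset_eq) (simp_all add: component_rank_def)
    then show False using x B(2) by blast
  qed
  then obtain y where y: "y \<in> necklace 1" "y \<in> B" "y \<notin> J" by blast
  show thesis by (rule that[of x y]) (use x y component_rel_if_mem[OF B y(2)] in auto)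
qed

lemma rel_if_component_cards:
  assumes "J \<in> ksubsets n k" "\<And>B. B \<in> components \<Longrightarrow> card (J \<inter> B) = component_rank B"
  shows "rel J = rel (necklace 1)"
  using assms
proof (induction "card (J - necklace 1)" arbitrary: J rule: less_induct)
  case less
  note J = ksubsetsD[OF less.prems(1)]
  show ?case
  proof (cases "J \<subseteq> necklace 1")
    case True
    have "card (necklace 1) = k" using card_necklace[OF one_mem] card_anti_exceedances by simp
    then have "J = necklace 1" using card_subset_eq[OF finite_necklace True] J(2) by simp
    then show ?thesis by simp
  next
    case False
    obtain x y where x: "x \<in> J" "x \<notin> necklace 1" and y: "y \<in> necklace 1" "y \<notin> J" and xy: "(x, y) \<in> component_rel"
      using ex_exchange_into_first_necklace[OF J(1) less.prems(2) False] by blast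
    let ?J = "insert y (J - {x})"
    have y': "y \<in> {1..n} - J" using y necklace_subset by blast
    have J': "?J \<in> ksubsets n k" by (rule exchange_in_ksubsets[OF less.prems(1) x(1) y'])
    have cards: "card (?J \<inter> A) = component_rank A" if A: "A \<in> components" for A
      using card_exchange_Int_eq[OF J(3) x(1) y(2) mem_component_iff[OF A xy]] less.prems(2)[OF A] by simp
    have "?J - necklace 1 = (J - necklace 1) - {x}" using y by auto
    then have "card (?J - necklace 1) < card (J - necklace 1)" using x J(3) card_Diff1_less[of "J - necklace 1" x] by simp
    then have IH: "rel ?J = rel (necklace 1)" using less.hyps J' cards by blast
    have "(x, y) \<in> edges J" using x(1) y' in_M_if_block_cards[OF J' cards] by (intro exchange_edgesI)
    then show ?thesis using rel_exchange[OF in_M_if_block_cards[OF less.prems]] IH by simp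
  qed
qed

lemma noncrossing_components: "noncrossing components"
  unfolding noncrossing_def
proof (intro ballI impI notI)
  fix A B assume AB: "A \<in> components" "B \<in> components" "A \<noteq> B"
    and "\<exists>a b c d. a < b \<and> b < c \<and> c < d \<and> a \<in> A \<and> c \<in> A \<and> b \<in> B \<and> d \<in> B"
  then obtain a b c d where order: "a < b" "b < c" "c < d" and mem: "a \<in> A" "c \<in> A" "b \<in> B" "d \<in> B" by blast
  have ne: "a \<noteq> c" "d \<noteq> b" using order by auto
  obtain SA where SA: "SA \<subseteq> A" "card SA = component_rank A" "a \<in> SA" "c \<notin> SA"
    using ex_subset_separating[OF block_finite[OF AB(1)] mem(1,2) ne(1) component_rank_bounds[OF AB(1) mem(1,2) ne(1)]] .
  obtain SB where SB: "SB \<subseteq> B" "card SB = component_rank B" "d \<in> SB" "b \<notin> SB"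
    using ex_subset_separating[OF block_finite[OF AB(2)] mem(4,3) ne(2) component_rank_bounds[OF AB(2) mem(4,3) ne(2)]] .
  define S where "S = (\<lambda>D. necklace 1 \<inter> D)(A := SA, B := SB)"
  have S: "S D \<subseteq> D" "card (S D) = component_rank D" if "D \<in> components" for D
    using SA SB by (auto simp: S_def component_rank_def)
  define J where "J = \<Union>(S ` components)"
  have J: "J \<in> ksubsets n k" unfolding J_def by (rule Union_block_subsets(2)[OF S])
  have J_Int: "J \<inter> D = S D" if "D \<in> components" for D
    unfolding J_def by (rule Union_block_subsets(1)[OF S that])
  have cards: "card (J \<inter> D) = component_rank D" if "D \<in> components" for D
    using J_Int[OF that] S(2)[OF that] by simp
  have "J \<inter> A = SA" "J \<inter> B = SB" using J_Int AB by (simp_all add: S_def)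
  then have J_mem: "a \<in> J" "c \<notin> J" "b \<notin> J" "d \<in> J" using SA SB mem by blast+
  have "insert b (J - {a}) \<in> M"
    by (rule crossing_exchange_in_M[OF J cards AB order mem(1) J_mem(1) mem(3) J_mem(3) mem(2) J_mem(2) mem(4) J_mem(4)])
  moreover have ab: "a \<in> {1..n}" "b \<in> {1..n}" using component_subset AB mem by blast+
  ultimately have "(a, b) \<in> edges J" using J_mem by (intro exchange_edgesI) auto
  then have "(a, b) \<in> component_rel"
    using edge_in_exchange_rel ab rel_if_component_cards[OF J cards] unfolding component_rel_def by blast
  then show False using mem_component_iff[OF AB(1)] block_eq[OF AB(1,2)] AB(3) mem by blast
qed

end

context positroid_data
begin

lemma union_of_spirographs_if_smooth:
  assumes "smooth_in_grassmannian n k (positroid_variety n k M)"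
  shows "union_of_spirographs n w"
proof (cases "1 \<le> n")
  case True
  interpret exchange_positroid n k w C
    by unfold_locales (use M_subset double_exchange_if_smooth[OF M_subset assms] True in blast)+
  show ?thesis
    unfolding union_of_spirographs_def
    using partition_components noncrossing_components component_invariant spirograph_on_component by blast
next
  case False
  then show ?thesis unfolding union_of_spirographs_def
    by (intro exI[of _ "{}"]) (auto simp: partition_on_def noncrossing_def)
qed

end

section \<open>The equivalence\<close>

lemma degree_johnson_graph:
  assumes "J \<in> M"
  shows "degree_in (johnson_graph k M) J = card {I \<in> M. card (I \<inter> J) + 1 = k}"
proof -
  let ?N = "{I \<in> M. card (I \<inter> J) + 1 = k}"
  have "{e \<in> snd (johnson_graph k M). J \<in> e} = (\<lambda>I. {I, J}) ` ?N"
  proof (rule Set.set_eqI, rule iffI)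
    fix e assume "e \<in> {e \<in> snd (johnson_graph k M). J \<in> e}"
    then obtain I I' where e: "e = {I, I'}" "I \<in> M" "I' \<in> M" "card (I \<inter> I') + 1 = k" "J = I \<or> J = I'"
      by (auto simp: johnson_graph_def)
    from e(5) show "e \<in> (\<lambda>I. {I, J}) ` ?N"
    proof
      assume "J = I"
      then show ?thesis using e by (intro image_eqI[of _ _ I']) (auto simp: Int_commute)
    next
      assume "J = I'"
      then show ?thesis using e by (intro image_eqI[of _ _ I]) auto
    qed
  next
    fix e assume "e \<in> (\<lambda>I. {I, J}) ` ?N"
    then show "e \<in> {e \<in> snd (johnson_graph k M). J \<in> e}" using assms by (auto simp: johnson_graph_def)
  qed
  moreover have "inj_on (\<lambda>I. {I, J}) ?N" by (auto simp: inj_on_def doubleton_eq_iff)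
  ultimately show ?thesis by (simp only: degree_in_def card_image)
qed

lemma regular_johnson_graph_iff:
  "(\<forall>J\<in>M. int (card {I \<in> M. card (I \<inter> J) + 1 = k}) = N) \<longleftrightarrow>
   regular_graph (johnson_graph k M) \<and>
   (\<forall>J\<in>fst (johnson_graph k M). int (degree_in (johnson_graph k M) J) = N)"
proof -
  have fst: "fst (johnson_graph k M) = M" by (simp add: johnson_graph_def)
  have "regular_graph (johnson_graph k M)" if "\<forall>J\<in>M. int (degree_in (johnson_graph k M) J) = N"
    unfolding regular_graph_def fst using that by (intro exI[of _ "nat N"]) auto
  moreover have "(\<forall>J\<in>M. int (card {I \<in> M. card (I \<inter> J) + 1 = k}) = N) \<longleftrightarrow>
      (\<forall>J\<in>M. int (degree_in (johnson_graph k M) J) = N)"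
    by (intro ball_cong refl) (simp only: degree_johnson_graph)
  ultimately show ?thesis unfolding fst by blast
qed

context decorated_perm
begin

lemma no_alignment_in_proper_spirograph:
  assumes "B \<subseteq> {1..n}" "proper_spirograph w B" "i \<in> B" "j \<in> B"
  shows "\<not> alignment w C i j"
proof (cases "card B = 1")
  case True
  then have "i = j" using assms(3,4) by (auto simp: card_1_singleton_iff)
  then show ?thesis by (simp add: alignment_def)
next
  case False
  then show ?thesis
    using assms no_alignment_in_spirograph unfolding proper_spirograph_def by blast
qed

end

context positroid_data
begin

lemma ex_noncrossing_block_positroid:
  assumes uncrossed
  obtains P \<kappa> where "noncrossing_block_positroid n w C k P \<kappa>" "\<And>B. B \<in> P \<Longrightarrow> proper_spirograph w B"
proof -
  obtain P where P: "partition_on {1..n} P" "noncrossing P" and proper: "\<And>B. B \<in> P \<Longrightarrow> proper_spirograph w B"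
    using ex_proper_spirograph_partition[OF order_refl permutes_image[OF perm] assms] by blast
  have "\<exists>c\<le>card B. \<forall>r\<in>{1..n}. \<forall>x\<in>B. x \<in> necklace r \<longleftrightarrow> cyc_rank n r B x < c" if B: "B \<in> P" for B
  proof -
    have "B \<subseteq> {1..n}" "B \<noteq> {}" using P(1) B by (auto simp: partition_on_def)
    then obtain c where "c \<le> card B"
        "\<And>r x. r \<in> {1..n} \<Longrightarrow> x \<in> B \<Longrightarrow> x \<in> necklace r \<longleftrightarrow> cyc_rank n r B x < c"
      by (rule necklace_initial_on_proper_spirograph[OF _ _ proper[OF B]]) blast
    then show ?thesis by blast
  qed
  then obtain \<kappa> where \<kappa>: "\<And>B. B \<in> P \<Longrightarrow> \<kappa> B \<le> card B"
    "\<And>B r x. B \<in> P \<Longrightarrow> r \<in> {1..n} \<Longrightarrow> x \<in> B \<Longrightarrow> x \<in> necklace r \<longleftrightarrow> cyc_rank n r B x < \<kappa> B"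
    by metis
  have "noncrossing_block_positroid n w C k P \<kappa>"
    by unfold_locales (use P proper \<kappa> in \<open>simp_all add: proper_spirograph_def\<close>)
  then show thesis using that proper by blast
qed

lemma smooth_if_uncrossed:
  assumes uncrossed
  shows "smooth_in_grassmannian n k (positroid_variety n k M)"
  using noncrossing_block_positroid.smooth ex_noncrossing_block_positroid[OF assms] by metis

lemma degree_if_uncrossed:
  assumes uncrossed and J: "J \<in> M"
  shows "card {I \<in> M. card (I \<inter> J) + 1 = k} + card (alignments n w C) = k * (n - k)"
proof -
  obtain P \<kappa> where blocks: "noncrossing_block_positroid n w C k P \<kappa>"
    and proper: "\<And>B. B \<in> P \<Longrightarrow> proper_spirograph w B"
    by (rule ex_noncrossing_block_positroid[OF \<open>uncrossed\<close>]) blast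
  interpret noncrossing_block_positroid n w C k P \<kappa> by (rule blocks)
  show ?thesis
    using card_neighbours_add_card_alignments[OF _ J] no_alignment_in_proper_spirograph block_subset proper by blast
qed

lemma int_eq_degree_iff: "int a = int k * (int n - int k) - int b \<longleftrightarrow> a + b = k * (n - k)"
proof -
  have "int (k * (n - k)) = int k * (int n - int k)" using k_le_n by (simp add: of_nat_diff)
  then show ?thesis by linarith
qed

end

theorem theorem1p6:
  fixes n k :: nat and w :: "nat \<Rightarrow> nat" and C :: "nat set" and M :: "nat set set"
  assumes "k \<le> n"
    and "(w, C) \<in> decorated_perms n k"
    and "M = positroid n k w C"
  shows
    "(smooth_in_grassmannian n k (positroid_variety n k M) \<longleftrightarrow>
      (\<forall>J\<in>M. int (card {I \<in> M. card (I \<inter> J) + 1 = k}) =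
              int k * (int n - int k) - int (card (alignments n w C)))) \<and>
     ((\<forall>J\<in>M. int (card {I \<in> M. card (I \<inter> J) + 1 = k}) =
              int k * (int n - int k) - int (card (alignments n w C))) \<longleftrightarrow>
      (regular_graph (johnson_graph k M) \<and>
       (\<forall>J\<in>fst (johnson_graph k M). int (degree_in (johnson_graph k M) J) =
              int k * (int n - int k) - int (card (alignments n w C))))) \<and>
     ((regular_graph (johnson_graph k M) \<and>
       (\<forall>J\<in>fst (johnson_graph k M). int (degree_in (johnson_graph k M) J) =
              int k * (int n - int k) - int (card (alignments n w C)))) \<longleftrightarrow>
      \<not> (\<exists>i\<in>{1..n}. \<exists>j\<in>{1..n}. crossed_alignment n w C i j)) \<and>
     (\<not> (\<exists>i\<in>{1..n}. \<exists>j\<in>{1..n}. crossed_alignment n w C i j) \<longleftrightarrow>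
      union_of_spirographs n w)"
    (is "(?smooth \<longleftrightarrow> ?degree) \<and> (?degree \<longleftrightarrow> ?regular) \<and> (?regular \<longleftrightarrow> ?uncrossed) \<and> (?uncrossed \<longleftrightarrow> ?spirographs)")
proof -
  interpret positroid_data n w C k
    using assms(2) by unfold_locales (auto simp: decorated_perms_def)
  have "?degree \<longleftrightarrow> ?regular" by (rule regular_johnson_graph_iff)
  moreover have "?degree \<longleftrightarrow> ?uncrossed"
    unfolding assms(3) int_eq_degree_iff using uncrossed_if_degree degree_if_uncrossed by blast
  moreover have "?uncrossed \<longleftrightarrow> ?spirographs"
    using union_of_spirographs_if_uncrossed uncrossed_if_union_of_spirographs by blast
  moreover have "?smooth \<longleftrightarrow> ?spirographs"
    unfolding assms(3)
    using union_of_spirographs_if_smooth smooth_if_uncrossed uncrossed_if_union_of_spirographs by blast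
  ultimately show ?thesis by argo
qed

end
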